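(* Let $\Omega=(-1,1)\times(-1,1)$, $T>0$, $\mathscr{D}=\Omega\times(0,T)$, and $\rho_0(x)=+1$ for $x_2>0$, $\rho_0(x)=-1$ for $x_2<0$. Let $(\overline\rho,\overline v,\overline m)$ be an admissible subsolution with mixing zone $\mathscr{U}$ (as defined in the context). Then there exists a sequence of weak solutions $(\rho_k,v_k)$ of the incompressible porous media equation in $\Omega\times(0,T)$ with initial condition $\rho_0$ satisfying $|\rho_k(x,t)|=1$ for a.e. $(x,t)\in\Omega\times(0,T)$, such that $$\rho_k=\overline\rho\ \text{ a.e. in }\mathscr{D}\setminus\mathscr{U}\qquad\text{and}\qquad\rho_k\overset{*}{\rightharpoonup}\overline\rho\ \text{ in }L^\infty(\mathscr{U})\ \text{ as }k\to\infty.$$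
   Context: Notation: $\nabla^\perp=(-\partial_2,\partial_1)$, and $(0,s)$ denotes the vector in $\mathbb{R}^2$ with components $0$ and $s$. Weak solution: a pair $(\rho,v)$ with $\rho\in L^\infty(\Omega\times(0,T))$, $v\in L^\infty(0,T;L^2(\Omega))$ is a weak solution of the incompressible porous media equation ($\partial_t\rho+\operatorname{div}(\rho v)=0$, $\operatorname{div}v=0$, $v+\nabla p=-(0,\rho)$, with $v\cdot\nu=0$ on $\partial\Omega$) with initial condition $\rho_0\in L^\infty(\Omega)$ if for all $\phi\in C_c^\infty(\mathbb{R}^2\times(-\infty,T))$ $$\int_0^T\!\!\int_\Omega\rho(\partial_t\phi+v\cdot\nabla\phi)\,dx\,dt+\int_\Omega\rho_0(x)\phi(x,0)\,dx=0,\qquad \int_0^T\!\!\int_\Omega v\cdot\nabla\phi\,dx\,dt=0,$$ and, for a.e. $t\in(0,T)$ and all $\psi\in C_c^\infty(\Omega)$, $\int_\Omega(v+(0,\rho))\cdot\nabla^\perp\psi\,dx=0$. Admissible subsolution: a triple $(\rho,v,m)\in L^\infty(\mathscr{D};\mathbb{R}\times\mathbb{R}^2\times\mathbb{R}^2)$ such that (i) for all $\phi\in C_c^\infty(\overline\Omega\times[0,T))$: $\int_0^T\!\int_\Omega(\rho\,\partial_t\phi+m\cdot\nabla\phi)\,dx\,dt+\int_\Omega\phi(x,0)\rho_0(x)\,dx=0$; (ii) for a.e. $t\in(0,T)$: $\int_\Omega v\cdot\nabla\psi\,dx=0$ for all $\psi\in C^\infty(\overline\Omega)$; (iii) for a.e.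 $t\in(0,T)$: $\int_\Omega(v+(0,\rho))\cdot\nabla^\perp\psi\,dx=0$ for all $\psi\in C_c^\infty(\Omega)$; (iv) $|m-\rho v+\tfrac12(0,1-\rho^2)|\le\tfrac12(1-\rho^2)$ a.e. in $\mathscr{D}$; and there exists an open subset $\mathscr{U}\subset\mathscr{D}$ (called the mixing zone) such that (v) $|\rho|=1$ a.e. in $\mathscr{D}\setminus\mathscr{U}$; (vi) $(\rho,v,m)$ is continuous in $\mathscr{U}$; (vii) $|m-\rho v+\tfrac12(0,1-\rho^2)|<\tfrac12(1-\rho^2)$ in $\mathscr{U}$. *)

theory Defs
  imports "HOL-Analysis.Analysis"
begin

type_synonym R2 = "real \<times> real"
type_synonym spacetime = "R2 \<times> real"

primrec Ck :: "nat \<Rightarrow> ('a::euclidean_space \<Rightarrow> real) \<Rightarrow> bool" where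
  "Ck 0 f \<longleftrightarrow> continuous_on UNIV f"
| "Ck (Suc n) f \<longleftrightarrow> f differentiable_on UNIV \<and>
     (\<forall>b\<in>Basis. Ck n (\<lambda>x. frechet_derivative f (at x) b))"

definition smooth :: "('a::euclidean_space \<Rightarrow> real) \<Rightarrow> bool" where
  "smooth f \<longleftrightarrow> (\<forall>n. Ck n f)"

text \<open>A compactly supported smooth function on an open set \<open>W\<close> is identified with its
  extension by zero to the whole space.\<close>

definition test_functions :: "'a::euclidean_space set \<Rightarrow> ('a \<Rightarrow> real) set" where
  "test_functions W = {\<phi>. smooth \<phi> \<and> compact (closure {z. \<phi> z \<noteq> 0}) \<and> closure {z. \<phi> z \<noteq> 0} \<subseteq> W}"

definition grad :: "(R2 \<Rightarrow> real) \<Rightarrow> R2 \<Rightarrow> R2" where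
  "grad \<psi> x = (frechet_derivative \<psi> (at x) (1, 0), frechet_derivative \<psi> (at x) (0, 1))"

definition grad_perp :: "(R2 \<Rightarrow> real) \<Rightarrow> R2 \<Rightarrow> R2" where
  "grad_perp \<psi> x = (- frechet_derivative \<psi> (at x) (0, 1), frechet_derivative \<psi> (at x) (1, 0))"

text \<open>On space-time, the gradient is taken in the space variables only.\<close>

definition grad_x :: "(spacetime \<Rightarrow> real) \<Rightarrow> spacetime \<Rightarrow> R2" where
  "grad_x \<phi> z = (frechet_derivative \<phi> (at z) ((1, 0), 0), frechet_derivative \<phi> (at z) ((0, 1), 0))"

definition dt :: "(spacetime \<Rightarrow> real) \<Rightarrow> spacetime \<Rightarrow> real" where
  "dt \<phi> z = frechet_derivative \<phi> (at z) ((0, 0), 1)"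

text \<open>Elements of the Lebesgue spaces are represented by functions, not by classes modulo
  null sets.\<close>

definition Linf :: "'a::euclidean_space set \<Rightarrow> ('a \<Rightarrow> 'b::real_normed_vector) set" where
  "Linf S = {f. f \<in> borel_measurable (lebesgue_on S) \<and>
     (\<exists>C. AE x in lebesgue_on S. norm (f x) \<le> C)}"

text \<open>\<open>L\<^sup>\<infinity>(0,T; L\<^sup>2(\<Omega>))\<close>. As \<open>L\<^sup>2(\<Omega>)\<close> is separable, strong measurability in time is joint
  measurability in space-time.\<close>

definition Linf_L2 :: "R2 set \<Rightarrow> real \<Rightarrow> (spacetime \<Rightarrow> R2) set" where
  "Linf_L2 \<Omega> T = {v. v \<in> borel_measurable (lebesgue_on (\<Omega> \<times> {0<..<T})) \<and>
     (\<exists>C. AE t in lebesgue_on {0<..<T}.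
        (\<lambda>x. v (x, t)) \<in> borel_measurable (lebesgue_on \<Omega>) \<and>
        integrable (lebesgue_on \<Omega>) (\<lambda>x. (norm (v (x, t)))\<^sup>2) \<and>
        sqrt (LINT x|lebesgue_on \<Omega>. (norm (v (x, t)))\<^sup>2) \<le> C)}"

text \<open>\<open>L\<^sup>\<infinity>(S)\<close> is regarded as the dual of \<open>L\<^sup>1(S)\<close>.\<close>

definition weak_star_converges ::
    "'a::euclidean_space set \<Rightarrow> (nat \<Rightarrow> 'a \<Rightarrow> real) \<Rightarrow> ('a \<Rightarrow> real) \<Rightarrow> bool" where
  "weak_star_converges S f l \<longleftrightarrow> (\<forall>k. f k \<in> Linf S) \<and> l \<in> Linf S \<and>
     (\<forall>g. integrable (lebesgue_on S) g \<longrightarrow>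
        (\<lambda>k. LINT z|lebesgue_on S. f k z * g z) \<longlonglongrightarrow> (LINT z|lebesgue_on S. l z * g z))"

text \<open>The boundary condition \<open>v \<cdot> \<nu> = 0\<close> is contained in the weak form of \<open>div v = 0\<close>, whose
  test functions need not vanish on the boundary of \<open>\<Omega>\<close>.\<close>

definition weak_solution ::
    "R2 set \<Rightarrow> real \<Rightarrow> (R2 \<Rightarrow> real) \<Rightarrow> (spacetime \<Rightarrow> real) \<Rightarrow> (spacetime \<Rightarrow> R2) \<Rightarrow> bool" where
  "weak_solution \<Omega> T \<rho>\<^sub>0 \<rho> v \<longleftrightarrow>
     \<rho>\<^sub>0 \<in> Linf \<Omega> \<and> \<rho> \<in> Linf (\<Omega> \<times> {0<..<T}) \<and> v \<in> Linf_L2 \<Omega> T \<and>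
     (\<forall>\<phi> \<in> test_functions (UNIV \<times> {..<T}).
        (LINT z|lebesgue_on (\<Omega> \<times> {0<..<T}). \<rho> z * (dt \<phi> z + v z \<bullet> grad_x \<phi> z)) +
        (LINT x|lebesgue_on \<Omega>. \<rho>\<^sub>0 x * \<phi> (x, 0)) = 0 \<and>
        (LINT z|lebesgue_on (\<Omega> \<times> {0<..<T}). v z \<bullet> grad_x \<phi> z) = 0) \<and>
     (AE t in lebesgue_on {0<..<T}. \<forall>\<psi> \<in> test_functions \<Omega>.
        (LINT x|lebesgue_on \<Omega>. (v (x, t) + (0, \<rho> (x, t))) \<bullet> grad_perp \<psi> x) = 0)"

text \<open>Functions in \<open>C\<^sup>\<infinity>\<close> of the closure of \<open>\<Omega>\<close>, and compactly supported smooth functions on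
  the closure of \<open>\<Omega>\<close> times \<open>[0,T)\<close>, are the restrictions of smooth functions on the whole
  space, respectively of test functions on \<open>\<real>\<^sup>2 \<times> (-\<infinity>,T)\<close>. Continuity of \<open>(\<rho>, v, m)\<close> on the
  mixing zone \<open>U\<close> refers to the given representatives.\<close>

definition admissible_subsolution ::
    "R2 set \<Rightarrow> real \<Rightarrow> (R2 \<Rightarrow> real) \<Rightarrow> (spacetime \<Rightarrow> real) \<Rightarrow> (spacetime \<Rightarrow> R2) \<Rightarrow>
     (spacetime \<Rightarrow> R2) \<Rightarrow> spacetime set \<Rightarrow> bool" where
  "admissible_subsolution \<Omega> T \<rho>\<^sub>0 \<rho> v m U \<longleftrightarrow>
     (\<lambda>z. (\<rho> z, v z, m z)) \<in> Linf (\<Omega> \<times> {0<..<T}) \<and>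
     (\<forall>\<phi> \<in> test_functions (UNIV \<times> {..<T}).
        (LINT z|lebesgue_on (\<Omega> \<times> {0<..<T}). \<rho> z * dt \<phi> z + m z \<bullet> grad_x \<phi> z) +
        (LINT x|lebesgue_on \<Omega>. \<phi> (x, 0) * \<rho>\<^sub>0 x) = 0) \<and>
     (AE t in lebesgue_on {0<..<T}. \<forall>\<psi>. smooth \<psi> \<longrightarrow>
        (LINT x|lebesgue_on \<Omega>. v (x, t) \<bullet> grad \<psi> x) = 0) \<and>
     (AE t in lebesgue_on {0<..<T}. \<forall>\<psi> \<in> test_functions \<Omega>.
        (LINT x|lebesgue_on \<Omega>. (v (x, t) + (0, \<rho> (x, t))) \<bullet> grad_perp \<psi> x) = 0) \<and>
     (AE z in lebesgue_on (\<Omega> \<times> {0<..<T}).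
        norm (m z - \<rho> z *\<^sub>R v z + (1/2) *\<^sub>R (0, 1 - (\<rho> z)\<^sup>2)) \<le> (1/2) * (1 - (\<rho> z)\<^sup>2)) \<and>
     open U \<and> U \<subseteq> \<Omega> \<times> {0<..<T} \<and>
     (AE z in lebesgue_on (\<Omega> \<times> {0<..<T} - U). \<bar>\<rho> z\<bar> = 1) \<and>
     continuous_on U (\<lambda>z. (\<rho> z, v z, m z)) \<and>
     (\<forall>z\<in>U. norm (m z - \<rho> z *\<^sub>R v z + (1/2) *\<^sub>R (0, 1 - (\<rho> z)\<^sup>2)) < (1/2) * (1 - (\<rho> z)\<^sup>2))"

end

theory Submission
  imports Defs
begin

text \<open>Convex integration with an explicit iteration instead of a Baire argument. A pair of compactly
  supported potentials \<open>(\<theta>, \<eta>)\<close> perturbs a subsolution by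
  \<open>\<rho>' = \<Delta>\<theta>\<close>, \<open>v' = \<nabla>\<^sup>\<bottom>(-\<partial>\<^sub>1\<theta>)\<close>, \<open>m' = -\<partial>\<^sub>t\<nabla>\<theta> + \<nabla>\<^sup>\<bottom>\<eta>\<close>,
  which solves the linear system exactly. At a strict subsolution there is a plane wave direction
  whose density amplitude may be as large as \<open>(1 - \<rho>\<^sup>2)/8\<close> in both signs, whatever the size of the
  velocity. Localising such waves in disjoint balls (Vitali) gives strict subsolutions with
  \<open>\<parallel>\<rho>'\<parallel>\<^sup>2 \<ge> c \<integral>(1 - \<rho>\<^sup>2)\<^sup>2\<close> and \<open>\<theta>\<close> uniformly small, so that \<open>\<rho>'\<close> is weakly
  small. Repeating this with \<open>\<theta>\<close> so small that every increment is almost orthogonal to the previous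
  densities makes the densities Cauchy in \<open>L\<^sup>2\<close> and forces \<open>|\<rho>| = 1\<close> in the limit; the velocities
  follow because \<open>\<parallel>v'\<parallel> \<le> \<parallel>\<rho>'\<parallel>\<close>, and \<open>|m - \<rho>v| \<le> 1 - \<rho>\<^sup>2\<close> identifies the limit of \<open>m\<close>.\<close>

section \<open>Partial derivatives and functions of class \<open>C\<^sup>k\<close>\<close>

text \<open>The obstacle is that inequality (iv) bounds \<open>m - \<rho> v\<close> but not
  \<open>v\<close>: the relaxed constraint set is unbounded, so no fixed compact set contains the
  states of the construction. All quantitative control therefore rests on the density, which stays
  in (-1, 1) on the mixing zone. Two such densities differ by less than 2, and an estimate of
  velocity by density on each time slice turns this into the bound that is uniform in time and L^2
  in space, as a weak solution requires. The potentials come from solving the constraints. For v =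
  grad_perp chi the divergence vanishes, and Darcy's law becomes Laplace chi = -d_1 \<rho>. Solving
  this for a given density is nonlocal; prescribing \<rho> = Laplace \<theta> instead makes chi =
  -d_1 \<theta> local. Perturbations can then be supported compactly inside the mixing zone, which
  is why boundary condition, initial datum and the values outside the zone survive every step
  unchanged. The potentials are differentiated at most three times, so cut-offs of finite order are
  enough.\<close>

definition pd :: "'a::euclidean_space \<Rightarrow> ('a \<Rightarrow> real) \<Rightarrow> 'a \<Rightarrow> real" where
  "pd b f = (\<lambda>z. frechet_derivative f (at z) b)"

lemma Ck_Suc_pd:
  "Ck (Suc n) f \<longleftrightarrow> f differentiable_on UNIV \<and> (\<forall>b\<in>Basis. Ck n (pd b f))"
  by (simp add: pd_def)

declare Ck.simps(2) [simp del]

lemma Ck_SucD: "Ck (Suc n) f \<Longrightarrow> Ck n f"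
proof (induction n arbitrary: f)
  case 0
  then show ?case by (simp add: Ck_Suc_pd differentiable_imp_continuous_on)
next
  case (Suc n)
  then show ?case
    using Ck_Suc_pd by blast
qed

lemma Ck_mono: "Ck n f \<Longrightarrow> m \<le> n \<Longrightarrow> Ck m f"
  by (induction n) (auto simp: le_Suc_eq dest: Ck_SucD)

lemma Ck_continuous: "Ck n f \<Longrightarrow> continuous_on UNIV f"
  using Ck_mono[of n f 0] by simp

lemma Ck_has_derivative:
  assumes "Ck (Suc n) f"
  shows "(f has_derivative (\<lambda>h. pd h f z)) (at z)"
  using assms unfolding Ck_Suc_pd pd_def
  by (simp add: differentiable_on_def frechet_derivative_works[symmetric])

lemma pd_eqI: "(f has_derivative f') (at z) \<Longrightarrow> pd b f z = f' b"
  unfolding pd_def by (metis frechet_derivative_at)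

text \<open>Any explicit derivative will do, because uniqueness identifies its values on the basis
  with the partial derivatives. The closure properties below follow from this rule by induction on
  the order, with the function left arbitrary.\<close>

lemma Ck_SucI:
  assumes "\<And>z. (f has_derivative f' z) (at z)" "\<And>b. b \<in> Basis \<Longrightarrow> Ck n (\<lambda>z. f' z b)"
  shows "Ck (Suc n) f"
proof -
  have "pd b f = (\<lambda>z. f' z b)" for b
    using assms(1) pd_eqI by blast
  then show ?thesis
    using assms unfolding Ck_Suc_pd differentiable_on_def
    by (metis UNIV_I differentiable_at_imp_differentiable_on differentiable_def)
qed

lemma pd_const [simp]: "pd b (\<lambda>z. c) = (\<lambda>z. 0)"
  by (rule ext, rule pd_eqI[of _ "\<lambda>_. 0"], simp)

lemma Ck_const [simp, intro]: "Ck n (\<lambda>z. c)"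
proof (induction n arbitrary: c)
  case (Suc n)
  show ?case by (rule Ck_SucI[where f'="\<lambda>_ _. 0"]) (auto intro: Suc)
qed simp

lemma Ck_pd: "Ck (Suc n) f \<Longrightarrow> b \<in> Basis \<Longrightarrow> Ck n (pd b f)"
  by (simp add: Ck_Suc_pd)

lemma pd_add:
  assumes "Ck (Suc n) f" "Ck (Suc m) g"
  shows "pd b (\<lambda>z. f z + g z) = (\<lambda>z. pd b f z + pd b g z)"
  by (rule ext, rule pd_eqI) (intro derivative_intros Ck_has_derivative[OF assms(1)] Ck_has_derivative[OF assms(2)])

lemma Ck_add [intro]: "Ck n f \<Longrightarrow> Ck n g \<Longrightarrow> Ck n (\<lambda>z. f z + g z)"
proof (induction n arbitrary: f g)
  case (Suc n)
  show ?case
    by (rule Ck_SucI) (auto intro!: has_derivative_add Ck_has_derivative Suc.IH Ck_pd Suc.prems)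
qed (auto intro: continuous_intros)

lemma pd_mult:
  assumes "Ck (Suc n) f" "Ck (Suc m) g"
  shows "pd b (\<lambda>z. f z * g z) = (\<lambda>z. f z * pd b g z + pd b f z * g z)"
  by (rule ext, rule pd_eqI)
     (rule has_derivative_mult[OF Ck_has_derivative[OF assms(1)] Ck_has_derivative[OF assms(2)]])

lemma Ck_mult [intro]: "Ck n f \<Longrightarrow> Ck n g \<Longrightarrow> Ck n (\<lambda>z. f z * g z)"
proof (induction n arbitrary: f g)
  case (Suc n)
  show ?case
    by (rule Ck_SucI[where f'="\<lambda>z h. f z * pd h g z + pd h f z * g z"])
       (auto intro!: has_derivative_mult Ck_has_derivative[OF Suc.prems(1)]
          Ck_has_derivative[OF Suc.prems(2)] Suc.IH Ck_pd Ck_SucD[OF Suc.prems(1)] Ck_SucD[OF Suc.prems(2)] Suc.prems)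
qed (auto intro: continuous_intros)

lemma pd_cmult:
  assumes "Ck (Suc n) f"
  shows "pd b (\<lambda>z. c * f z) = (\<lambda>z. c * pd b f z)"
  using pd_mult[OF Ck_const[of _ c] assms] by simp

lemma Ck_cmult: "Ck n f \<Longrightarrow> Ck n (\<lambda>z. c * f z)"
  by (rule Ck_mult[OF Ck_const])

lemma Ck_minus [intro]: "Ck n f \<Longrightarrow> Ck n (\<lambda>z. - f z)"
  using Ck_cmult[of n f "-1"] by simp

lemma Ck_diff [intro]: "Ck n f \<Longrightarrow> Ck n g \<Longrightarrow> Ck n (\<lambda>z. f z - g z)"
  using Ck_add[of n f "\<lambda>z. - g z"] by auto

lemma pd_diff:
  assumes "Ck (Suc n) f" "Ck (Suc m) g"
  shows "pd b (\<lambda>z. f z - g z) = (\<lambda>z. pd b f z - pd b g z)"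
  by (rule ext, rule pd_eqI) (intro derivative_intros Ck_has_derivative[OF assms(1)] Ck_has_derivative[OF assms(2)])

lemma Ck_sum [intro]: "(\<And>i. i \<in> I \<Longrightarrow> Ck n (f i)) \<Longrightarrow> Ck n (\<lambda>z. \<Sum>i\<in>I. f i z)"
  by (induction I rule: infinite_finite_induct) auto

lemma pd_sum:
  assumes "\<And>i. i \<in> I \<Longrightarrow> Ck (Suc n) (f i)"
  shows "pd b (\<lambda>z. \<Sum>i\<in>I. f i z) = (\<lambda>z. \<Sum>i\<in>I. pd b (f i) z)"
  by (rule ext, rule pd_eqI) (intro has_derivative_sum Ck_has_derivative[OF assms])

lemma Ck_bounded_linear: "bounded_linear f \<Longrightarrow> Ck n f"
proof (cases n)
  case (Suc m)
  assume f: "bounded_linear f"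
  show ?thesis unfolding Suc
    by (rule Ck_SucI[OF bounded_linear_imp_has_derivative[OF f]]) simp
qed (auto simp: linear_continuous_on)

text \<open>Differentiating along \<open>b\<close> produces the derivative of \<open>f\<close> along
  \<open>L b\<close>, so the induction closes when \<open>L b\<close> is again a basis vector or
  zero. This covers the two maps that occur: translations and the inclusion of a time slice.\<close>

lemma Ck_affine_compose:
  fixes L :: "'a::euclidean_space \<Rightarrow> 'b::euclidean_space"
  assumes L: "bounded_linear L" and B: "\<And>b. b \<in> Basis \<Longrightarrow> L b \<in> Basis \<or> L b = 0"
  shows "Ck n f \<Longrightarrow> Ck n (\<lambda>z. f (L z + c))"
proof (induction n arbitrary: f)
  case 0
  then show ?case
    by (auto intro!: continuous_on_compose2[of UNIV f] continuous_on_add continuous_on_const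
        linear_continuous_on[OF L])
next
  case (Suc n)
  show ?case
  proof (rule Ck_SucI)
    show "((\<lambda>z. f (L z + c)) has_derivative (\<lambda>h. pd (L h) f (L z + c))) (at z)" for z
    proof (rule has_derivative_compose[where f="\<lambda>z. L z + c" and f'=L, OF _ Ck_has_derivative[OF Suc.prems]])
      show "((\<lambda>z. L z + c) has_derivative L) (at z)"
        using has_derivative_add_const[OF bounded_linear_imp_has_derivative[OF L]] .
    qed
    show "Ck n (\<lambda>z. pd (L b) f (L z + c))" if "b \<in> Basis" for b
    proof (cases "L b = 0")
      case True
      have "pd 0 f = (\<lambda>z. 0)"
        using linear_0[OF has_derivative_linear[OF Ck_has_derivative[OF Suc.prems]]] by (auto simp: fun_eq_iff)
      then show ?thesis using True by simp
    next
      case False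
      then show ?thesis using B[OF that] Suc.IH[OF Ck_pd[OF Suc.prems]] by blast
    qed
  qed
qed

lemma pd_affine_compose:
  assumes "bounded_linear L" "Ck (Suc n) f"
  shows "pd b (\<lambda>z. f (L z + c)) z = pd (L b) f (L z + c)"
  by (rule pd_eqI, rule has_derivative_compose[where f="\<lambda>z. L z + c" and f'=L, OF _ Ck_has_derivative[OF assms(2)]])
     (rule has_derivative_add_const[OF bounded_linear_imp_has_derivative[OF assms(1)]])

section \<open>Plane waves and truncated powers\<close>

lemma Ck_cos_affine: "Ck n (\<lambda>z::'a::euclidean_space. cos (k * (\<zeta> \<bullet> z) + \<tau>))"
proof (induction n arbitrary: \<tau>)
  case (Suc n)
  show ?case
  proof (rule Ck_SucI)
    \<comment> \<open>The derivative of the cosine is written as a cosine with phase advanced by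
      pi/2. With \<open>\<tau>\<close> arbitrary, the induction stays inside one family of
      functions.\<close>
    show "((\<lambda>z. cos (k * (\<zeta> \<bullet> z) + \<tau>)) has_derivative
        (\<lambda>h. (k * (\<zeta> \<bullet> h)) * cos (k * (\<zeta> \<bullet> z) + (\<tau> + pi/2)))) (at z)" for z
      by (auto intro!: derivative_eq_intros simp: cos_add sin_add algebra_simps)
    show "Ck n (\<lambda>z. k * (\<zeta> \<bullet> b) * cos (k * (\<zeta> \<bullet> z) + (\<tau> + pi/2)))" for b
      by (intro Ck_cmult Suc)
  qed
qed (auto intro!: continuous_intros)

lemma pd_cos_affine:
  "pd b (\<lambda>z. cos (k * (\<zeta> \<bullet> z) + \<tau>)) = (\<lambda>z. - (k * (\<zeta> \<bullet> b)) * sin (k * (\<zeta> \<bullet> z) + \<tau>))"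
proof
  fix z
  have "((\<lambda>z. cos (k * (\<zeta> \<bullet> z) + \<tau>)) has_derivative
        (\<lambda>h. - (k * (\<zeta> \<bullet> h)) * sin (k * (\<zeta> \<bullet> z) + \<tau>))) (at z)" 
      by (auto intro!: derivative_eq_intros simp: algebra_simps)
  from pd_eqI[OF this] show "pd b (\<lambda>z. cos (k * (\<zeta> \<bullet> z) + \<tau>)) z = - (k * (\<zeta> \<bullet> b)) * sin (k * (\<zeta> \<bullet> z) + \<tau>)" .
qed

lemma Ck_sin_affine: "Ck n (\<lambda>z::'a::euclidean_space. sin (k * (\<zeta> \<bullet> z) + \<tau>))"
proof -
  have "sin (x + \<tau>) = cos (x + (\<tau> - pi/2))" for x
    by (simp add: cos_add cos_diff sin_diff sin_add)
  then show ?thesis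
    using Ck_cos_affine[of n k \<zeta> "\<tau> - pi/2"] by simp
qed

lemma pd_sin_affine:
  "pd b (\<lambda>z. sin (k * (\<zeta> \<bullet> z) + \<tau>)) = (\<lambda>z. (k * (\<zeta> \<bullet> b)) * cos (k * (\<zeta> \<bullet> z) + \<tau>))"
proof
  fix z
  have "((\<lambda>z. sin (k * (\<zeta> \<bullet> z) + \<tau>)) has_derivative
        (\<lambda>h. (k * (\<zeta> \<bullet> h)) * cos (k * (\<zeta> \<bullet> z) + \<tau>))) (at z)" 
      by (auto intro!: derivative_eq_intros simp: algebra_simps)
  from pd_eqI[OF this] show "pd b (\<lambda>z. sin (k * (\<zeta> \<bullet> z) + \<tau>)) z = (k * (\<zeta> \<bullet> b)) * cos (k * (\<zeta> \<bullet> z) + \<tau>)" .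
qed

lemma has_real_derivative_max_0_power:
  "((\<lambda>x::real. max 0 x ^ (n + 2)) has_real_derivative real (n + 2) * max 0 x ^ (n + 1)) (at x)"
proof -
  consider "x < 0" | "x > 0" | "x = 0" by linarith
  then show ?thesis
  proof cases
    case 1
    have "((\<lambda>x::real. 0) has_real_derivative 0) (at x)" by simp
    moreover have "eventually (\<lambda>y. y < 0) (nhds x)"
      using 1 eventually_nhds_in_open[of "{..<0}" x] by simp
    then have "eventually (\<lambda>y. 0 = max 0 y ^ (n + 2)) (nhds x)"
      by eventually_elim (simp add: max_def)
    ultimately show ?thesis using 1 DERIV_cong_ev[OF refl _ refl] by (fastforce simp: max_def)
  next
    case 2
    have "((\<lambda>x::real. x ^ (n + 2)) has_real_derivative real (n + 2) * x ^ (n + 1)) (at x)"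
      using DERIV_pow[of "n+2" x UNIV] by simp
    moreover have "eventually (\<lambda>y. y > 0) (nhds x)"
      using 2 eventually_nhds_in_open[of "{0<..}" x] by simp
    then have "eventually (\<lambda>y. y ^ (n + 2) = max 0 y ^ (n + 2)) (nhds x)"
      by eventually_elim (simp add: max_def)
    ultimately have "((\<lambda>x::real. max 0 x ^ (n + 2)) has_real_derivative real (n + 2) * x ^ (n + 1)) (at x)"
      by (simp add: DERIV_cong_ev)
    then show ?thesis using 2 by (simp add: max_def)
  next
    case 3
    \<comment> \<open>At the kink the difference quotient is at most |h|^(n + 1), so an exponent of
      at least 2 makes the derivative exist and vanish there.\<close>
    have "((\<lambda>h::real. max 0 h ^ (n + 2) / h) \<longlongrightarrow> 0) (at 0)"
    proof (rule Lim_null_comparison)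
      show "\<forall>\<^sub>F h::real in at 0. norm (max 0 h ^ (n + 2) / h) \<le> \<bar>h\<bar> ^ (n + 1)"
      proof (rule always_eventually, rule allI)
        show "norm (max 0 h ^ (n + 2) / h) \<le> \<bar>h\<bar> ^ (n + 1)" for h :: real
          using zero_le_power[of "\<bar>h\<bar>" "n + 1"] by (cases "h > 0") (auto simp: max_def)
      qed
      show "((\<lambda>h::real. \<bar>h\<bar> ^ (n + 1)) \<longlongrightarrow> 0) (at 0)"
        by (auto intro!: tendsto_eq_intros)
    qed
    then show ?thesis using 3 by (simp add: DERIV_def)
  qed
qed

text \<open>Each derivative costs one power of the positive part. This is the source of all cut-offs
  in the construction.\<close>

lemma Ck_max_0_power:
  assumes q: "\<And>n. Ck n q"
  shows "Ck n (\<lambda>z. max 0 (q z) ^ (n + 1))"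
proof (induction n)
  case 0
  then show ?case using Ck_continuous[OF q] by (auto intro!: continuous_intros)
next
  case (Suc n)
  show ?case
  proof (rule Ck_SucI)
    show "((\<lambda>z. max 0 (q z) ^ (Suc n + 1)) has_derivative
       (\<lambda>h. real (n+2) * (max 0 (q z) ^ (n + 1) * pd h q z))) (at z)" for z
      using has_derivative_compose[OF Ck_has_derivative[OF q]
          has_real_derivative_max_0_power[unfolded has_field_derivative_def]]
      by (simp add: mult.assoc)
    show "Ck n (\<lambda>z. real (n+2) * (max 0 (q z) ^ (n + 1) * pd b q z))" if "b \<in> Basis" for b
      by (intro Ck_cmult Ck_mult Suc Ck_pd[OF q that])
  qed
qed

lemma Ck_inner_right: "Ck n (\<lambda>z. a \<bullet> z)"
  by (rule Ck_bounded_linear) (rule bounded_linear_inner_right)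

lemma Ck_norm_power2: "Ck n (\<lambda>z::'a::euclidean_space. (norm (z - c))\<^sup>2)"
proof -
  have "(norm (z - c))\<^sup>2 = (\<Sum>b\<in>Basis. (b \<bullet> z - b \<bullet> c) * (b \<bullet> z - b \<bullet> c))" for z
    by (subst norm_eq_sqrt_inner, simp, subst euclidean_inner, simp add: inner_diff_left inner_diff_right inner_commute)
  moreover have "Ck n (\<lambda>z. \<Sum>b\<in>Basis. (b \<bullet> z - b \<bullet> c) * (b \<bullet> z - b \<bullet> c))"
    by (intro Ck_sum Ck_mult Ck_diff Ck_inner_right Ck_const)
  ultimately show ?thesis by simp
qed

lemma Ck_real_polynomial_function: "real_polynomial_function p \<Longrightarrow> Ck n p"
  by (induction rule: real_polynomial_function.induct) (auto intro: Ck_bounded_linear)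

lemma smooth_Ck: "smooth f \<Longrightarrow> Ck n f"
  by (simp add: smooth_def)

section \<open>Compactly supported functions and integration by parts\<close>

text \<open>The finite-order counterpart of \<open>test_functions\<close>. The set \<open>W\<close>
  may be closed: potentials living on closed balls have separated supports as soon as the balls are
  disjoint.\<close>

definition Cc :: "nat \<Rightarrow> 'a::euclidean_space set \<Rightarrow> ('a \<Rightarrow> real) set" where
  "Cc n W = {f. Ck n f \<and> compact (closure {z. f z \<noteq> 0}) \<and> closure {z. f z \<noteq> 0} \<subseteq> W}"

lemma CcD: "f \<in> Cc n W \<Longrightarrow> Ck n f"
  by (simp add: Cc_def)

lemma Cc_outside: "f \<in> Cc n W \<Longrightarrow> z \<notin> W \<Longrightarrow> f z = 0"
  unfolding Cc_def using closure_subset[of "{z. f z \<noteq> 0}"] by auto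

lemma Cc_mono: "f \<in> Cc n W \<Longrightarrow> m \<le> n \<Longrightarrow> W \<subseteq> V \<Longrightarrow> f \<in> Cc m V"
  unfolding Cc_def using Ck_mono by auto

lemma CcI_subset:
  assumes "Ck n f" "compact K" "K \<subseteq> W" "\<And>z. z \<notin> K \<Longrightarrow> f z = 0"
  shows "f \<in> Cc n W"
proof -
  have "closure {z. f z \<noteq> 0} \<subseteq> K"
    by (rule closure_minimal) (use assms compact_imp_closed in auto)
  then show ?thesis
    unfolding Cc_def using assms(1-3) compact_Int_closed[OF assms(2) closed_closure, of "{z. f z \<noteq> 0}"]
    by (auto simp: Int_absorb1)
qed

lemma Cc_zero [simp]: "(\<lambda>z. 0) \<in> Cc n W"
  by (simp add: Cc_def)

lemma Cc_ex_compact: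
  assumes "f \<in> Cc n W"
  shows "\<exists>K. compact K \<and> K \<subseteq> W \<and> (\<forall>z. z \<notin> K \<longrightarrow> f z = 0)"
  using assms closure_subset[of "{z. f z \<noteq> 0}"] unfolding Cc_def by blast

lemma Cc_obtain_compact:
  assumes "f \<in> Cc n W"
  obtains K where "compact K" "K \<subseteq> W" "\<And>z. z \<notin> K \<Longrightarrow> f z = 0"
  using Cc_ex_compact[OF assms] by blast

lemma Cc_add [intro]:
  assumes "f \<in> Cc n W" "g \<in> Cc n W"
  shows "(\<lambda>z. f z + g z) \<in> Cc n W"
proof -
  obtain K L where "compact K" "K \<subseteq> W" "\<And>z. z \<notin> K \<Longrightarrow> f z = 0" "compact L" "L \<subseteq> W" "\<And>z. z \<notin> L \<Longrightarrow> g z = 0"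
    using assms by (metis Cc_ex_compact)
  then show ?thesis
    by (intro CcI_subset[of _ _ "K \<union> L"] Ck_add CcD[OF assms(1)] CcD[OF assms(2)]) auto
qed

lemma Cc_mult_left [intro]:
  assumes "f \<in> Cc n W" "Ck n g"
  shows "(\<lambda>z. f z * g z) \<in> Cc n W"
proof -
  obtain K where "compact K" "K \<subseteq> W" "\<And>z. z \<notin> K \<Longrightarrow> f z = 0"
    using Cc_obtain_compact[OF assms(1)] by blast
  then show ?thesis
    by (intro CcI_subset[of _ _ "K"] Ck_mult CcD[OF assms(1)] assms) auto
qed

lemma Cc_cmult: "f \<in> Cc n W \<Longrightarrow> (\<lambda>z. c * f z) \<in> Cc n W"
  using Cc_mult_left[of f n W "\<lambda>_. c"] by (simp add: mult.commute)

lemma Cc_diff [intro]: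
  assumes "f \<in> Cc n W" "g \<in> Cc n W"
  shows "(\<lambda>z. f z - g z) \<in> Cc n W"
  using Cc_add[OF assms(1) Cc_cmult[OF assms(2), of "-1"]] by simp

lemma Cc_sum [intro]: "(\<And>i. i \<in> I \<Longrightarrow> f i \<in> Cc n W) \<Longrightarrow> (\<lambda>z. \<Sum>i\<in>I. f i z) \<in> Cc n W"
  by (induction I rule: infinite_finite_induct) auto

lemma pd_local_zero:
  assumes "open S" "z \<in> S" "\<And>y. y \<in> S \<Longrightarrow> f y = 0"
  shows "pd b f z = 0"
proof -
  have "(f has_derivative (\<lambda>_. 0)) (at z)"
    by (rule has_derivative_transform_within_open[of "\<lambda>_. 0" _ _ UNIV S]) (use assms in auto)
  then show ?thesis by (rule pd_eqI)
qed

lemma Cc_pd [intro]: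
  assumes "f \<in> Cc (Suc n) W" "b \<in> Basis"
  shows "pd b f \<in> Cc n W"
proof -
  obtain K where K: "compact K" "K \<subseteq> W" "\<And>z. z \<notin> K \<Longrightarrow> f z = 0"
    using Cc_obtain_compact[OF assms(1)] by blast
  show ?thesis
  proof (rule CcI_subset[of _ _ K])
    show "pd b f z = 0" if "z \<notin> K" for z
      by (rule pd_local_zero[of "-K"]) (use K that compact_imp_closed in auto)
  qed (use K Ck_pd[OF CcD[OF assms(1)] assms(2)] in auto)
qed

lemma Cc_bounded:
  assumes "f \<in> Cc n W"
  obtains B where "B > 0" "\<And>z. \<bar>f z\<bar> \<le> B"
proof -
  obtain K where K: "compact K" "K \<subseteq> W" "\<And>z. z \<notin> K \<Longrightarrow> f z = 0"
    using Cc_obtain_compact[OF assms(1)] by blast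
  have "bounded (f ` K)"
    using Ck_continuous[OF CcD[OF assms]] K(1)
    by (intro compact_imp_bounded compact_continuous_image) (auto intro: continuous_on_subset)
  then obtain B where "B > 0" "\<And>z. z \<in> K \<Longrightarrow> \<bar>f z\<bar> \<le> B"
    unfolding bounded_pos by auto
  then show ?thesis using that[of B] K(3) by (metis abs_zero less_imp_le)
qed

lemma Ck_borel_measurable: "Ck n f \<Longrightarrow> f \<in> borel_measurable borel"
  by (simp add: Ck_continuous borel_measurable_continuous_onI)

lemma Cc_integrable:
  assumes "f \<in> Cc n W"
  shows "integrable lborel f"
proof -
  obtain K where K: "compact K" "K \<subseteq> W" "\<And>z. z \<notin> K \<Longrightarrow> f z = 0"
    using Cc_obtain_compact[OF assms(1)] by blast
  have "integrable lborel (\<lambda>z. indicator K z *\<^sub>R f z)"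
    using borel_integrable_compact[OF K(1), of f] Ck_continuous[OF CcD[OF assms]] 
    by (auto intro: continuous_on_subset simp: indicator_def if_distrib cong: if_cong)
  also have "(\<lambda>z. indicator K z *\<^sub>R f z) = f"
    using K(3) by (auto simp: fun_eq_iff indicator_def)
  finally show ?thesis .
qed

section \<open>Integration by parts and symmetry of second derivatives\<close>

lemma line_has_real_derivative_pd:
  assumes "Ck (Suc n) f"
  shows "((\<lambda>s. f (z + s *\<^sub>R b)) has_real_derivative pd b f (z + s *\<^sub>R b)) (at s)"
proof -
  have "((\<lambda>s. z + s *\<^sub>R b) has_derivative (\<lambda>h. h *\<^sub>R b)) (at s)"
    by (auto intro!: derivative_eq_intros)
  from has_derivative_compose[OF this Ck_has_derivative[OF assms]]
  have D: "((\<lambda>s. f (z + s *\<^sub>R b)) has_derivative (\<lambda>h. pd (h *\<^sub>R b) f (z + s *\<^sub>R b))) (at s)" .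
  have "pd (h *\<^sub>R b) f (z + s *\<^sub>R b) = pd b f (z + s *\<^sub>R b) * h" for h
    using linear_scale[OF has_derivative_linear[OF Ck_has_derivative[OF assms]], of h b] by simp
  then show ?thesis using D unfolding has_field_derivative_def by simp
qed

lemma line_mvt_pd:
  assumes "Ck (Suc n) f" "h > 0"
  obtains s where "0 < s" "s < h" "f (z + h *\<^sub>R b) - f z = h * pd b f (z + s *\<^sub>R b)"
  using MVT2[OF assms(2), of "\<lambda>s. f (z + s *\<^sub>R b)" "\<lambda>s. pd b f (z + s *\<^sub>R b)"]
    line_has_real_derivative_pd[OF assms(1)] by auto

text \<open>Translation invariance makes the integral of every difference quotient vanish.\<close>

lemma integral_pd_zero:
  fixes f :: "'a::euclidean_space \<Rightarrow> real"
  assumes f: "f \<in> Cc (Suc n) W" and b: "b \<in> Basis"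
  shows "(LINT z|lborel. pd b f z) = 0"
proof -
  obtain K where K: "compact K" "K \<subseteq> W" "\<And>z. z \<notin> K \<Longrightarrow> f z = 0"
    using Cc_obtain_compact[OF f] by blast
  obtain B where B: "B > 0" "\<And>z. \<bar>pd b f z\<bar> \<le> B"
    using Cc_bounded[OF Cc_pd[OF f b]] by blast
  \<comment> \<open>\<open>K'\<close> contains the supports of all difference quotients with step at
    most 1, which provides one integrable majorant for the whole sequence.\<close>
  define K' where "K' = (\<lambda>(x, s). x - s *\<^sub>R b) ` (K \<times> {0..1})"
  have K': "compact K'"
    unfolding K'_def using K(1)
    by (intro compact_continuous_image compact_Times) (auto intro!: continuous_intros simp: case_prod_beta)
  define h where "h n = inverse (real (Suc n))" for n
  have h: "h n > 0" "h n \<le> 1" for n by (auto simp: h_def inverse_le_1_iff)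
  have h0: "h \<longlonglongrightarrow> 0" unfolding h_def by (rule LIMSEQ_inverse_real_of_nat)
  define g where "g n z = (f (z + h n *\<^sub>R b) - f z) / h n" for n z
  note fm [measurable] = Ck_borel_measurable[OF CcD[OF f]] Ck_borel_measurable[OF CcD[OF Cc_pd[OF f b]]]
  have int0: "(LINT z|lborel. g n z) = 0" for n
  proof -
    have tr: "integrable lborel (\<lambda>z. f (z + h n *\<^sub>R b)) \<and> (LINT z|lborel. f (z + h n *\<^sub>R b)) = (LINT z|lborel. f z)"
    proof -
      have e: "(\<lambda>z. f (z + h n *\<^sub>R b)) = (\<lambda>z. f (h n *\<^sub>R b + z))" by (simp add: add.commute)
      have "(LINT z|lborel. f z) = (LINT z|distr lborel borel ((+) (h n *\<^sub>R b)). f z)"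
        by (simp add: lborel_distr_plus)
      moreover have "integrable (distr lborel borel ((+) (h n *\<^sub>R b))) f"
        by (simp add: lborel_distr_plus Cc_integrable[OF f])
      ultimately show ?thesis unfolding e
        by (simp add: integral_distr integrable_distr_eq)
    qed
    then show ?thesis
      unfolding g_def using Cc_integrable[OF f] by simp
  qed
  have "(\<lambda>n. LINT z|lborel. g n z) \<longlonglongrightarrow> (LINT z|lborel. pd b f z)"
  proof (rule integral_dominated_convergence[where w="\<lambda>z. B * indicator K' z"])
    show "integrable lborel (\<lambda>z. B * indicator K' z)"
      using emeasure_compact_finite[OF K'] borel_compact[OF K']
      by (intro integrable_mult_right integrable_real_indicator) auto
    show "AE z in lborel. (\<lambda>n. g n z) \<longlonglongrightarrow> pd b f z"
    proof (rule AE_I2)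
      fix z
      have "((\<lambda>t. (f (z + t *\<^sub>R b) - f z) / t) \<longlongrightarrow> pd b f z) (at 0)"
        using line_has_real_derivative_pd[OF CcD[OF f], of z b 0] by (simp add: DERIV_def)
      moreover have "filterlim h (at 0) sequentially"
        unfolding filterlim_at using h0 h(1) by (simp add: less_imp_neq[symmetric])
      ultimately show "(\<lambda>n. g n z) \<longlonglongrightarrow> pd b f z"
        unfolding g_def by (rule filterlim_compose)
    qed
    show "AE z in lborel. norm (g n z) \<le> B * indicator K' z" for n
    proof (rule AE_I2)
      fix z
      show "norm (g n z) \<le> B * indicator K' z"
      proof (cases "z \<in> K'")
        case True
        obtain s where "f (z + h n *\<^sub>R b) - f z = h n * pd b f (z + s *\<^sub>R b)"
          using line_mvt_pd[OF CcD[OF f] h(1)] by blast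
        then show ?thesis using True B(2) h(1)[of n] by (simp add: g_def)
      next
        case False
        have "z \<notin> K" using False unfolding K'_def image_iff by force
        moreover have "z + h n *\<^sub>R b \<notin> K"
        proof
          assume "z + h n *\<^sub>R b \<in> K"
          then have "(\<lambda>(x, s). x - s *\<^sub>R b) (z + h n *\<^sub>R b, h n) \<in> K'"
            unfolding K'_def using h[of n] by (intro imageI) auto
          then show False using False by simp
        qed
        ultimately show ?thesis using K(3) False by (simp add: g_def)
      qed
    qed
  qed (auto simp: g_def)
  then show ?thesis
    by (simp add: int0 LIMSEQ_const_iff)
qed

text \<open>Compact support is asked of one factor only. The other factor will be a test function
  that may be nonzero on the boundary and at time zero, or a polynomial.\<close>

lemma integral_by_parts_pd:
  fixes f g :: "'a::euclidean_space \<Rightarrow> real"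
  assumes f: "f \<in> Cc (Suc n) W" and g: "Ck (Suc m) g" and b: "b \<in> Basis"
  shows "(LINT z|lborel. pd b f z * g z) = - (LINT z|lborel. f z * pd b g z)"
proof -
  have f1: "f \<in> Cc (Suc 0) W" and g1: "Ck (Suc 0) g"
    using f g by (auto intro: Cc_mono Ck_mono)
  have "(LINT z|lborel. pd b (\<lambda>z. f z * g z) z) = 0"
    by (rule integral_pd_zero[OF Cc_mult_left[OF f1 g1] b])
  moreover have "integrable lborel (\<lambda>z. pd b f z * g z)" "integrable lborel (\<lambda>z. f z * pd b g z)"
    using Cc_integrable[OF Cc_mult_left[OF Cc_pd[OF f1 b]], of g]
       Cc_integrable[OF Cc_mult_left[OF Cc_mono[OF f1, of 0] Ck_pd[OF g1 b]]] Ck_SucD[OF g1]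
    by (auto intro: Cc_integrable)
  ultimately show ?thesis
    by (simp add: pd_mult[OF CcD[OF f1] g1])
qed

text \<open>The second difference of \<open>f\<close> over a square of side h, evaluated by the mean
  value theorem in either order, equals h^2 times one of the mixed derivatives at a point within 2 h
  of \<open>z\<close>. Continuity of both derivatives then gives equality as h tends to 0.\<close>

lemma pd_commute:
  fixes f :: "'a::euclidean_space \<Rightarrow> real"
  assumes f: "Ck (Suc (Suc n)) f" and ab: "a \<in> Basis" "b \<in> Basis"
  shows "pd a (pd b f) = pd b (pd a f)"
proof
  fix z
  have quot: "\<exists>y. dist y z \<le> 2 * h \<and> f (z + h *\<^sub>R a + h *\<^sub>R b) - f (z + h *\<^sub>R a) - f (z + h *\<^sub>R b) + f z = h * (h * pd a (pd b f) y)"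
    if h: "h > 0" and ab: "a \<in> Basis" "b \<in> Basis" for h :: real and a b
  proof -
    define F where "F z = f (z + h *\<^sub>R a) - f z" for z
    have sh: "Ck m g \<Longrightarrow> Ck m (\<lambda>z. g (z + c))" for m c and g :: "'a \<Rightarrow> real"
      using Ck_affine_compose[of "\<lambda>z::'a. z" m g c] by (auto simp: bounded_linear_ident)
    have F: "Ck (Suc n) F"
      unfolding F_def[abs_def] by (intro Ck_diff sh Ck_SucD[OF f])
    have pF: "pd b F y = pd b f (y + h *\<^sub>R a) - pd b f y" for y
      unfolding F_def[abs_def]
      using pd_affine_compose[OF bounded_linear_ident f, of b "h *\<^sub>R a" y]
      by (simp add: pd_diff[OF sh[OF f] f])
    obtain s where s: "0 < s" "s < h" "F (z + h *\<^sub>R b) - F z = h * pd b F (z + s *\<^sub>R b)"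
      using line_mvt_pd[OF F h] by blast
    obtain t where t: "0 < t" "t < h"
      "pd b f ((z + s *\<^sub>R b) + h *\<^sub>R a) - pd b f (z + s *\<^sub>R b) = h * pd a (pd b f) ((z + s *\<^sub>R b) + t *\<^sub>R a)"
      using line_mvt_pd[OF Ck_pd[OF f ab(2)] h] by blast
    have "dist ((z + s *\<^sub>R b) + t *\<^sub>R a) z \<le> norm (s *\<^sub>R b) + norm (t *\<^sub>R a)"
      by (simp add: dist_norm add.assoc norm_triangle_ineq del: norm_scaleR inner_Basis)
    also have "\<dots> \<le> 2 * h" using s t ab by simp
    finally show ?thesis
      using s(3) t(3) by (intro exI[of _ "(z + s *\<^sub>R b) + t *\<^sub>R a"]) (auto simp: F_def pF algebra_simps)
  qed
  define y where "y a b m = (SOME y. dist y z \<le> 2 * (1/real (Suc m)) \<and> f (z + (1/real (Suc m)) *\<^sub>R a + (1/real (Suc m)) *\<^sub>R b) - f (z + (1/real (Suc m)) *\<^sub>R a) - f (z + (1/real (Suc m)) *\<^sub>R b) + f z = (1/real (Suc m)) * ((1/real (Suc m)) * pd a (pd b f) y))" for a b and m :: nat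
  have y: "dist (y a b m) z \<le> 2 * (1/real (Suc m))" 
      "f (z + (1/real (Suc m)) *\<^sub>R a + (1/real (Suc m)) *\<^sub>R b) - f (z + (1/real (Suc m)) *\<^sub>R a) - f (z + (1/real (Suc m)) *\<^sub>R b) + f z = (1/real (Suc m)) * ((1/real (Suc m)) * pd a (pd b f) (y a b m))"
    if "a \<in> Basis" "b \<in> Basis" for a b m
    using someI_ex[OF quot[of "1/real (Suc m)", OF _ that]] unfolding y_def by auto
  have eq: "pd a (pd b f) (y a b m) = pd b (pd a f) (y b a m)" for m
  proof -
    define h where "h = 1 / real (Suc m)"
    have "h \<noteq> 0" by (simp add: h_def)
    have "f (z + h *\<^sub>R a + h *\<^sub>R b) = f (z + h *\<^sub>R b + h *\<^sub>R a)"
      by (simp add: add_ac)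
    then have "h * (h * pd a (pd b f) (y a b m)) = h * (h * pd b (pd a f) (y b a m))"
      using y(2)[OF ab, of m, folded h_def] y(2)[OF ab(2,1), of m, folded h_def] by linarith
    then show ?thesis using \<open>h \<noteq> 0\<close> by simp
  qed
  have lim: "(\<lambda>m. pd a (pd b f) (y a b m)) \<longlonglongrightarrow> pd a (pd b f) z" if ab: "a \<in> Basis" "b \<in> Basis" for a b
  proof -
    have "(\<lambda>m. dist (y a b m) z) \<longlonglongrightarrow> 0"
    proof (rule tendsto_sandwich[of "\<lambda>_. 0"])
      show "(\<lambda>m. 2 * (1/real (Suc m))) \<longlonglongrightarrow> 0"
        using tendsto_mult_right_zero[OF LIMSEQ_inverse_real_of_nat, of 2] by (simp add: inverse_eq_divide)
    qed (use y(1)[OF ab] in auto)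
    then have "(y a b) \<longlonglongrightarrow> z" by (rule iffD2[OF tendsto_dist_iff])
    moreover have "isCont (pd a (pd b f)) z"
      using Ck_continuous[OF Ck_pd[OF Ck_pd[OF f ab(2)] ab(1)]] by (simp add: continuous_on_eq_continuous_at)
    ultimately show ?thesis by (simp add: isCont_tendsto_compose)
  qed
  show "pd a (pd b f) z = pd b (pd a f) z"
    using LIMSEQ_unique[OF lim[OF ab]] lim[OF ab(2,1)] by (simp add: eq)
qed

lemma integral_pd_pd_mult:
  fixes f g :: "'a::euclidean_space \<Rightarrow> real"
  assumes f: "f \<in> Cc 2 W" and g: "Ck 2 g" and ab: "a \<in> Basis" "b \<in> Basis"
  shows "(LINT z|lborel. pd a (pd b f) z * g z) = (LINT z|lborel. f z * pd b (pd a g) z)"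
proof -
  have f': "f \<in> Cc (Suc (Suc 0)) W" and g': "Ck (Suc (Suc 0)) g"
    using f g by (simp_all add: numeral_2_eq_2)
  show ?thesis
    using integral_by_parts_pd[OF Cc_pd[OF f' ab(2)] g' ab(1)] integral_by_parts_pd[OF f' Ck_pd[OF g' ab(1)] ab(2)]
    by simp
qed

text \<open>This identity bounds the velocity by the density in \<open>L\<^sup>2\<close>, which is what makes the
  velocities converge strongly although no bound on them is built into the construction.\<close>

lemma integral_mixed_pd:
  fixes f :: "'a::euclidean_space \<Rightarrow> real"
  assumes f: "f \<in> Cc 3 W" and ab: "a \<in> Basis" "b \<in> Basis"
  shows "(LINT z|lborel. pd a (pd a f) z * pd b (pd b f) z) = (LINT z|lborel. (pd a (pd b f) z)\<^sup>2)"
proof -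
  have f': "f \<in> Cc (Suc (Suc (Suc 0))) W"
    using f by (simp add: numeral_3_eq_3)
  note pf = Cc_pd[OF f'] and C = CcD
  have 1: "pd a (pd b (pd b f)) = pd b (pd a (pd b f))"
    by (rule pd_commute[OF CcD[OF pf[OF ab(2)]] ab])
  have 2: "pd a (pd b f) = pd b (pd a f)"
    by (rule pd_commute[OF CcD[OF f'] ab])
  have "(LINT z|lborel. pd a (pd a f) z * pd b (pd b f) z) = - (LINT z|lborel. pd a f z * pd b (pd a (pd b f)) z)"
    using integral_by_parts_pd[OF pf[OF ab(1)] CcD[OF Cc_pd[OF pf[OF ab(2)] ab(2)]] ab(1)] by (simp add: 1)
  also have "\<dots> = (LINT z|lborel. pd b (pd a f) z * pd a (pd b f) z)"
    using integral_by_parts_pd[OF pf[OF ab(1)] CcD[OF Cc_pd[OF pf[OF ab(2)] ab(1)]] ab(2)] by simp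
  finally show ?thesis by (simp add: 2 power2_eq_square)
qed

section \<open>The linear system and its potentials\<close>

lemma Cc_pd_numeral:
  assumes "b \<in> Basis"
  shows "f \<in> Cc 3 W \<Longrightarrow> pd b f \<in> Cc 2 W" "f \<in> Cc 2 W \<Longrightarrow> pd b f \<in> Cc 1 W" "f \<in> Cc 1 W \<Longrightarrow> pd b f \<in> Cc 0 W"
  using Cc_pd[of f 2 W b] Cc_pd[of f 1 W b] Cc_pd[of f 0 W b] assms by (simp_all add: eval_nat_numeral)

lemma Cc_Ck_mult_integrable:
  assumes "f \<in> Cc n W" "Ck m g"
  shows "integrable lborel (\<lambda>z. f z * g z)"
  by (rule Cc_integrable[of _ 0 W]) (intro Cc_mult_left Cc_mono[OF assms(1)] Ck_mono[OF assms(2)]; simp)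

lemma integrable_lebesgue_lborel:
  fixes f :: "'a::euclidean_space \<Rightarrow> 'b::euclidean_space"
  shows "integrable lborel f \<Longrightarrow> integrable lebesgue f"
  using integrable_completion[of f lborel] by (auto dest: borel_measurable_integrable)

lemma integral_lebesgue_lborel:
  fixes f :: "'a::euclidean_space \<Rightarrow> 'b::euclidean_space"
  shows "f \<in> borel_measurable borel \<Longrightarrow> integral\<^sup>L lebesgue f = integral\<^sup>L lborel f"
  using integral_completion[of f lborel] by simp

lemma integrable_lebesgue_on_supported:
  fixes f :: "'a::euclidean_space \<Rightarrow> 'b::euclidean_space"
  assumes "integrable lborel f" "D \<in> sets lebesgue"
  shows "integrable (lebesgue_on D) f"
  using integrable_mult_indicator[OF assms(2) integrable_lebesgue_lborel[OF assms(1)]] assms(2)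
  by (subst integrable_restrict_space) auto

text \<open>Integration by parts takes place on the whole space, whereas the equations are stated on
  a domain. For perturbations supported in the domain the two integrals agree.\<close>

lemma integral_lebesgue_on_supported:
  fixes f :: "'a::euclidean_space \<Rightarrow> 'b::euclidean_space"
  assumes "f \<in> borel_measurable borel" "D \<in> sets lebesgue" "\<And>z. z \<notin> D \<Longrightarrow> f z = 0"
  shows "integral\<^sup>L (lebesgue_on D) f = integral\<^sup>L lborel f"
proof -
  have "integral\<^sup>L (lebesgue_on D) f = (LINT z|lebesgue. indicator D z *\<^sub>R f z)"
    using assms(2) by (subst integral_restrict_space) auto
  also have "(\<lambda>z. indicator D z *\<^sub>R f z) = f"
    using assms(3) by (auto simp: indicator_def)
  finally show ?thesis using integral_lebesgue_lborel[OF assms(1)] by simp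
qed

lemma integral_laplace_mult:
  fixes f g :: "'a::euclidean_space \<Rightarrow> real"
  assumes f: "f \<in> Cc 2 W" and g: "Ck 2 g" and ab: "a \<in> Basis" "b \<in> Basis"
  shows "(LINT z|lborel. (pd a (pd a f) z + pd b (pd b f) z) * g z)
    = (LINT z|lborel. f z * (pd a (pd a g) z + pd b (pd b g) z))"
proof -
  have g2: "Ck 0 (pd c (pd c g))" if "c \<in> Basis" for c
    by (rule Ck_pd[OF Ck_pd[OF _ that] that]) (use g in \<open>simp add: eval_nat_numeral\<close>)
  note i1 = Cc_Ck_mult_integrable[OF Cc_pd_numeral(3)[OF _ Cc_pd_numeral(2)[OF _ f]] g]
  note i2 = Cc_Ck_mult_integrable[OF f g2]
  show ?thesis
    using integral_pd_pd_mult[OF f g ab(1) ab(1)] integral_pd_pd_mult[OF f g ab(2) ab(2)]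
    by (simp add: ring_distribs i1 i2 ab)
qed

text \<open>When the square on the right is expanded, \<open>integral_mixed_pd\<close> turns the
  cross term into twice the integral of the squared mixed derivative, so only nonnegative terms
  remain. For the two space directions the left side is |v|^2 and the right side is the squared
  density of the perturbation with potential \<open>f\<close>.\<close>

lemma integral_pd_square_le_laplace:
  fixes f :: "'a::euclidean_space \<Rightarrow> real"
  assumes f: "f \<in> Cc 3 W" and ab: "a \<in> Basis" "b \<in> Basis"
  shows "(LINT z|lborel. (pd b (pd a f) z)\<^sup>2 + (pd a (pd a f) z)\<^sup>2)
    \<le> (LINT z|lborel. (pd a (pd a f) z + pd b (pd b f) z)\<^sup>2)"
proof -
  have c: "pd c (pd d f) \<in> Cc 1 W" if "c \<in> Basis" "d \<in> Basis" for c d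
    using Cc_pd_numeral(2)[OF that(1) Cc_pd_numeral(1)[OF that(2) f]] .
  have i: "integrable lborel (\<lambda>z. pd c (pd d f) z * pd c' (pd d' f) z)"
    if "c \<in> Basis" "d \<in> Basis" "c' \<in> Basis" "d' \<in> Basis" for c d c' d'
    using Cc_Ck_mult_integrable[OF c CcD[OF c]] that by blast
  have com: "pd a (pd b f) = pd b (pd a f)"
    using pd_commute[of 1 f a b] CcD[OF f] ab by (simp add: eval_nat_numeral)
  have e1: "(LINT z|lborel. pd b (pd a f) z * pd b (pd a f) z + pd a (pd a f) z * pd a (pd a f) z)
    = (LINT z|lborel. pd b (pd a f) z * pd b (pd a f) z) + (LINT z|lborel. pd a (pd a f) z * pd a (pd a f) z)"
    by (intro Bochner_Integration.integral_add i ab)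
  have "(LINT z|lborel. (pd a (pd a f) z + pd b (pd b f) z)\<^sup>2)
    = (LINT z|lborel. pd a (pd a f) z * pd a (pd a f) z + 2 * (pd a (pd a f) z * pd b (pd b f) z)
        + pd b (pd b f) z * pd b (pd b f) z)"
    by (simp add: power2_eq_square algebra_simps)
  also have "\<dots> = (LINT z|lborel. pd a (pd a f) z * pd a (pd a f) z) 
      + 2 * (LINT z|lborel. pd b (pd a f) z * pd b (pd a f) z)
      + (LINT z|lborel. pd b (pd b f) z * pd b (pd b f) z)"
    using integral_mixed_pd[OF f ab] by (simp add: i ab com power2_eq_square)
  finally have e2: "(LINT z|lborel. (pd a (pd a f) z + pd b (pd b f) z)\<^sup>2) = \<dots>" .
  have "(LINT z|lborel. pd b (pd b f) z * pd b (pd b f) z) \<ge> 0"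
    "(LINT z|lborel. pd b (pd a f) z * pd b (pd a f) z) \<ge> 0"
    by (auto intro!: integral_nonneg_AE)
  then show ?thesis
    unfolding e2 using e1 by (simp add: power2_eq_square)
qed

abbreviation "e\<^sub>1 \<equiv> ((1, 0), 0) :: spacetime"
abbreviation "e\<^sub>2 \<equiv> ((0, 1), 0) :: spacetime"
abbreviation "e\<^sub>t \<equiv> ((0, 0), 1) :: spacetime"

lemma spacetime_Basis [simp]: "e\<^sub>1 \<in> Basis" "e\<^sub>2 \<in> Basis" "e\<^sub>t \<in> Basis" 
  and R2_Basis [simp]: "(1, 0) \<in> (Basis :: R2 set)" "(0, 1) \<in> (Basis :: R2 set)"
  by (auto simp: Basis_prod_def zero_prod_def)

text \<open>Every pair of compactly supported potentials yields a solution
  \<open>(drho \<theta>, dvel \<theta>, dmom \<theta> \<eta>)\<close> of the linear system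
  \<open>\<partial>\<^sub>t\<rho> + div m = 0\<close>, \<open>div v = 0\<close>, \<open>curl (v + (0, \<rho>)) = 0\<close>.\<close>

definition drho :: "(spacetime \<Rightarrow> real) \<Rightarrow> spacetime \<Rightarrow> real" where
  "drho \<theta> z = pd e\<^sub>1 (pd e\<^sub>1 \<theta>) z + pd e\<^sub>2 (pd e\<^sub>2 \<theta>) z"

definition dvel :: "(spacetime \<Rightarrow> real) \<Rightarrow> spacetime \<Rightarrow> R2" where
  "dvel \<theta> z = (pd e\<^sub>2 (pd e\<^sub>1 \<theta>) z, - pd e\<^sub>1 (pd e\<^sub>1 \<theta>) z)"

definition dmom :: "(spacetime \<Rightarrow> real) \<Rightarrow> (spacetime \<Rightarrow> real) \<Rightarrow> spacetime \<Rightarrow> R2" where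
  "dmom \<theta> \<eta> z = (- pd e\<^sub>1 (pd e\<^sub>t \<theta>) z - pd e\<^sub>2 \<eta> z, - pd e\<^sub>2 (pd e\<^sub>t \<theta>) z + pd e\<^sub>1 \<eta> z)"

lemma drho_Cc: "\<theta> \<in> Cc 3 W \<Longrightarrow> drho \<theta> \<in> Cc 1 W"
  unfolding drho_def[abs_def] by (intro Cc_add Cc_pd_numeral) auto

lemma inner_R2: "(x::R2) \<bullet> y = fst x * fst y + snd x * snd y"
  by (simp add: inner_prod_def)

lemma dt_grad_x_pd:
  "dt \<phi> = pd e\<^sub>t \<phi>" "grad_x \<phi> z = (pd e\<^sub>1 \<phi> z, pd e\<^sub>2 \<phi> z)"
  by (auto simp: dt_def grad_x_def pd_def)

text \<open>After all derivatives have been moved onto \<open>\<phi>\<close>, the terms cancel in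
  pairs by symmetry of second derivatives. No boundary terms arise even if \<open>\<phi>\<close> is
  nonzero at time zero, because the potentials are compactly supported; so a perturbation leaves the
  initial datum unchanged.\<close>

lemma integral_transport_zero:
  assumes \<theta>: "\<theta> \<in> Cc 3 W" and \<eta>: "\<eta> \<in> Cc 2 W" and \<phi>: "smooth \<phi>"
  shows "(LINT z|lborel. drho \<theta> z * dt \<phi> z + dmom \<theta> \<eta> z \<bullet> grad_x \<phi> z) = 0"
proof -
  have c: "pd c (pd d \<theta>) \<in> Cc 1 W" if "c \<in> Basis" "d \<in> Basis" for c d
    using Cc_pd_numeral(2)[OF that(1) Cc_pd_numeral(1)[OF that(2) \<theta>]] .
  have \<phi>1: "Ck n (pd b \<phi>)" if "b \<in> Basis" for n b
    by (rule Ck_pd[OF smooth_Ck[OF \<phi>] that])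
  have com\<phi>: "pd a (pd b \<phi>) = pd b (pd a \<phi>)" if "a \<in> Basis" "b \<in> Basis" for a b
    using pd_commute[OF smooth_Ck[OF \<phi>] that] .
  have com\<theta>: "pd a (pd b \<theta>) = pd b (pd a \<theta>)" if "a \<in> Basis" "b \<in> Basis" for a b
    using pd_commute[of 1 \<theta> a b] CcD[OF \<theta>] that by (simp add: eval_nat_numeral)
  have i: "integrable lborel (\<lambda>z. pd c (pd d \<theta>) z * pd b \<phi> z)"
    if "c \<in> Basis" "d \<in> Basis" "b \<in> Basis" for b c d
    using Cc_Ck_mult_integrable[OF c \<phi>1] that by blast
  have i': "integrable lborel (\<lambda>z. pd c \<eta> z * pd b \<phi> z)" if "c \<in> Basis" "b \<in> Basis" for b c
    using Cc_Ck_mult_integrable[OF Cc_pd_numeral(2)[OF _ \<eta>] \<phi>1] that by blast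
  have p: "(LINT z|lborel. pd c (pd d \<theta>) z * pd b \<phi> z) = - (LINT z|lborel. pd d \<theta> z * pd c (pd b \<phi>) z)"
    if "c \<in> Basis" "d \<in> Basis" "b \<in> Basis" for b c d
    using integral_by_parts_pd[of "pd d \<theta>" 1 W 0 "pd b \<phi>" c] Cc_pd_numeral(1)[OF that(2) \<theta>] \<phi>1 that by (simp add: eval_nat_numeral)
  have p': "(LINT z|lborel. pd c \<eta> z * pd b \<phi> z) = - (LINT z|lborel. \<eta> z * pd c (pd b \<phi>) z)"
    if "c \<in> Basis" "b \<in> Basis" for b c
    using integral_by_parts_pd[of \<eta> 1 W 0 "pd b \<phi>" c] \<eta> \<phi>1 that by (simp add: eval_nat_numeral)
  have "(LINT z|lborel. drho \<theta> z * dt \<phi> z + dmom \<theta> \<eta> z \<bullet> grad_x \<phi> z)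
    = (LINT z|lborel. ((pd e\<^sub>1 (pd e\<^sub>1 \<theta>) z * pd e\<^sub>t \<phi> z + pd e\<^sub>2 (pd e\<^sub>2 \<theta>) z * pd e\<^sub>t \<phi> z)
       - (pd e\<^sub>t (pd e\<^sub>1 \<theta>) z * pd e\<^sub>1 \<phi> z + pd e\<^sub>t (pd e\<^sub>2 \<theta>) z * pd e\<^sub>2 \<phi> z))
       - (pd e\<^sub>2 \<eta> z * pd e\<^sub>1 \<phi> z - pd e\<^sub>1 \<eta> z * pd e\<^sub>2 \<phi> z))"
    by (simp add: drho_def dmom_def dt_grad_x_pd inner_R2 algebra_simps com\<theta>[of e\<^sub>t])
  also have "\<dots> = 0"
    by (simp add: i i' p p' com\<phi>[of e\<^sub>1 e\<^sub>t] com\<phi>[of e\<^sub>2 e\<^sub>t] com\<phi>[of e\<^sub>1 e\<^sub>2])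
  finally show ?thesis .
qed

text \<open>The test function may be nonzero on the lateral boundary, so a perturbation also
  respects the no-flux condition.\<close>

lemma integral_dvel_grad_x:
  assumes \<theta>: "\<theta> \<in> Cc 3 W" and \<phi>: "smooth \<phi>"
  shows "(LINT z|lborel. dvel \<theta> z \<bullet> grad_x \<phi> z) = 0"
proof -
  have c: "pd c (pd d \<theta>) \<in> Cc 1 W" if "c \<in> Basis" "d \<in> Basis" for c d
    using Cc_pd_numeral(2)[OF that(1) Cc_pd_numeral(1)[OF that(2) \<theta>]] .
  have \<phi>1: "Ck n (pd b \<phi>)" if "b \<in> Basis" for n b
    by (rule Ck_pd[OF smooth_Ck[OF \<phi>] that])
  have com\<phi>: "pd a (pd b \<phi>) = pd b (pd a \<phi>)" if "a \<in> Basis" "b \<in> Basis" for a b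
    using pd_commute[OF smooth_Ck[OF \<phi>] that] .
  have i: "integrable lborel (\<lambda>z. pd c (pd d \<theta>) z * pd b \<phi> z)"
    if "c \<in> Basis" "d \<in> Basis" "b \<in> Basis" for b c d
    using Cc_Ck_mult_integrable[OF c \<phi>1] that by blast
  have p: "(LINT z|lborel. pd c (pd d \<theta>) z * pd b \<phi> z) = - (LINT z|lborel. pd d \<theta> z * pd c (pd b \<phi>) z)"
    if "c \<in> Basis" "d \<in> Basis" "b \<in> Basis" for b c d
    using integral_by_parts_pd[of "pd d \<theta>" 1 W 0 "pd b \<phi>" c] Cc_pd_numeral(1)[OF that(2) \<theta>] \<phi>1 that by (simp add: eval_nat_numeral)
  show ?thesis
    by (simp add: dvel_def dt_grad_x_pd inner_R2 i p com\<phi>[of e\<^sub>1 e\<^sub>2])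
qed

text \<open>The field tested here is d_2 of the gradient of \<open>\<theta>\<close>. On a time slice
  \<open>dvel\<close> plus (0, \<open>drho\<close>) has exactly this form, because the two copies of
  d_1 d_1 \<open>\<theta>\<close> cancel.\<close>

lemma integral_curl_zero:
  fixes \<theta> :: "R2 \<Rightarrow> real"
  assumes \<theta>: "\<theta> \<in> Cc 3 W" and \<psi>: "smooth \<psi>"
  shows "(LINT x|lborel. (pd (0, 1) (pd (1, 0) \<theta>) x, pd (0, 1) (pd (0, 1) \<theta>) x) \<bullet> grad_perp \<psi> x) = 0"
proof -
  have c: "pd c (pd d \<theta>) \<in> Cc 1 W" if "c \<in> Basis" "d \<in> Basis" for c d
    using Cc_pd_numeral(2)[OF that(1) Cc_pd_numeral(1)[OF that(2) \<theta>]] .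
  have \<psi>1: "Ck n (pd b \<psi>)" if "b \<in> Basis" for n b
    by (rule Ck_pd[OF smooth_Ck[OF \<psi>] that])
  have com\<psi>: "pd a (pd b \<psi>) = pd b (pd a \<psi>)" if "a \<in> Basis" "b \<in> Basis" for a b
    using pd_commute[OF smooth_Ck[OF \<psi>] that] .
  have com\<theta>: "pd a (pd b \<theta>) = pd b (pd a \<theta>)" if "a \<in> Basis" "b \<in> Basis" for a b
    using pd_commute[of 1 \<theta> a b] CcD[OF \<theta>] that by (simp add: eval_nat_numeral)
  have i: "integrable lborel (\<lambda>z. pd c (pd d \<theta>) z * pd b \<psi> z)"
    if "c \<in> Basis" "d \<in> Basis" "b \<in> Basis" for b c d
    using Cc_Ck_mult_integrable[OF c \<psi>1] that by blast
  have p: "(LINT z|lborel. pd c (pd d \<theta>) z * pd b \<psi> z) = - (LINT z|lborel. pd d \<theta> z * pd c (pd b \<psi>) z)"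
    if "c \<in> Basis" "d \<in> Basis" "b \<in> Basis" for b c d
    using integral_by_parts_pd[of "pd d \<theta>" 1 W 0 "pd b \<psi>" c] Cc_pd_numeral(1)[OF that(2) \<theta>] \<psi>1 that by (simp add: eval_nat_numeral)
  have "grad_perp \<psi> x = (- pd (0, 1) \<psi> x, pd (1, 0) \<psi> x)" for x
    by (simp add: grad_perp_def pd_def)
  then show ?thesis
    by (simp add: inner_R2 com\<theta>[of "(0,1)" "(1,0)"] i p com\<psi>[of "(1,0)" "(0,1)"])
qed

lemma slice_Cc:
  fixes \<theta> :: "spacetime \<Rightarrow> real"
  assumes \<theta>: "\<theta> \<in> Cc n W"
  shows "(\<lambda>x. \<theta> (x, t)) \<in> Cc n {x. (x, t) \<in> W}"
proof -
  obtain K where K: "compact K" "K \<subseteq> W" "\<And>z. z \<notin> K \<Longrightarrow> \<theta> z = 0"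
    using Cc_obtain_compact[OF \<theta>] by blast
  have L: "bounded_linear (\<lambda>x::R2. (x, 0::real))"
    by (intro bounded_linear_Pair bounded_linear_ident bounded_linear_zero)
  show ?thesis
  proof (rule CcI_subset)
    show "Ck n (\<lambda>x. \<theta> (x, t))"
      using Ck_affine_compose[OF L _ CcD[OF \<theta>], of "(0, t)"] by (auto simp: Basis_prod_def)
    have "compact (K \<inter> UNIV \<times> {t})"
      using K(1) by (intro compact_Int_closed closed_Times) auto
    then have "compact (fst ` (K \<inter> UNIV \<times> {t}))"
      by (intro compact_continuous_image continuous_intros)
    also have "fst ` (K \<inter> UNIV \<times> {t}) = {x. (x, t) \<in> K}"
      by force
    finally show "compact {x. (x, t) \<in> K}" .
  qed (use K in auto)
qed

lemma pd_slice:
  fixes \<theta> :: "spacetime \<Rightarrow> real"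
  assumes \<theta>: "Ck (Suc n) \<theta>"
  shows "pd b (\<lambda>x. \<theta> (x, t)) = (\<lambda>x. pd (b, 0) \<theta> (x, t))"
proof
  fix x
  have L: "bounded_linear (\<lambda>x::R2. (x, 0::real))"
    by (intro bounded_linear_Pair bounded_linear_ident bounded_linear_zero)
  show "pd b (\<lambda>x. \<theta> (x, t)) x = pd (b, 0) \<theta> (x, t)"
    using pd_affine_compose[OF L \<theta>, of b "(0, t)" x] by simp
qed

lemma pd_pd_slice:
  fixes \<theta> :: "spacetime \<Rightarrow> real"
  assumes \<theta>: "\<theta> \<in> Cc 3 W" and "a \<in> Basis" "b \<in> Basis"
  shows "pd a (pd b (\<lambda>x. \<theta> (x, t))) = (\<lambda>x. pd (a, 0) (pd (b, 0) \<theta>) (x, t))"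
proof -
  have 1: "Ck (Suc 2) \<theta>" using CcD[OF \<theta>] by (simp add: eval_nat_numeral)
  have "(b, 0) \<in> (Basis :: spacetime set)" using assms(3) by (simp add: Basis_prod_def)
  then have 2: "Ck (Suc 1) (pd (b, 0) \<theta>)" using CcD[OF Cc_pd_numeral(1)[OF _ \<theta>]] by (simp add: eval_nat_numeral)
  show ?thesis by (simp add: pd_slice[OF 1] pd_slice[OF 2])
qed

lemma slice_integral_curl_zero:
  assumes \<theta>: "\<theta> \<in> Cc 3 W" and \<psi>: "smooth \<psi>"
  shows "(LINT x|lborel. (dvel \<theta> (x, t) + (0, drho \<theta> (x, t))) \<bullet> grad_perp \<psi> x) = 0"
  using integral_curl_zero[OF slice_Cc[OF \<theta>] \<psi>, of t]
  by (simp add: dvel_def drho_def pd_pd_slice[OF \<theta>])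

text \<open>This slicewise version gives the velocity bound that is uniform in time; the space-time
  version \<open>integral_dvel_le\<close> carries convergence from densities to velocities.\<close>

lemma slice_integral_dvel_le:
  assumes \<theta>: "\<theta> \<in> Cc 3 W"
  shows "(LINT x|lborel. (norm (dvel \<theta> (x, t)))\<^sup>2) \<le> (LINT x|lborel. (drho \<theta> (x, t))\<^sup>2)"
  using integral_pd_square_le_laplace[OF slice_Cc[OF \<theta>], of "(1,0)" "(0,1)" t]
  by (simp add: dvel_def drho_def norm_prod_def pd_pd_slice[OF \<theta>])

lemma integral_dvel_le:
  assumes \<theta>: "\<theta> \<in> Cc 3 W"
  shows "(LINT z|lborel. (norm (dvel \<theta> z))\<^sup>2) \<le> (LINT z|lborel. (drho \<theta> z)\<^sup>2)"
  using integral_pd_square_le_laplace[OF \<theta>, of e\<^sub>1 e\<^sub>2]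
  by (simp add: dvel_def drho_def norm_prod_def)

section \<open>Plane waves that preserve strictness\<close>

text \<open>The slack in inequality (iv). Condition (vii) becomes positivity of one continuous
  function, hence an open condition on the state.\<close>

definition gap :: "real \<Rightarrow> R2 \<Rightarrow> R2 \<Rightarrow> real" where
  "gap r v m = (1/2) * (1 - r\<^sup>2) - norm (m - r *\<^sub>R v + (1/2) *\<^sub>R (0, 1 - r\<^sup>2))"

lemma gap_pos_abs_less_1: "gap r v m > 0 \<Longrightarrow> \<bar>r\<bar> < 1"
  unfolding gap_def by (simp add: abs_square_less_1[symmetric]) (smt (verit) norm_ge_zero)

text \<open>A plane wave with spatial direction (x, y) and density amplitude 1 has velocity
  amplitude (x y, -x^2). These vectors run through the circle of radius 1/2 around (0, -1/2) at
  twice the angle, so every unit vector (a, b) equals twice such a velocity plus (0, 1).\<close>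

lemma unit_vector_half_angle:
  fixes a b :: real
  assumes "a\<^sup>2 + b\<^sup>2 = 1"
  obtains x y :: real where "x\<^sup>2 + y\<^sup>2 = 1" "x * y = a / 2" "x\<^sup>2 = (1 - b) / 2"
proof -
  obtain t where t: "a = cos t" "b = sin t" using sincos_total_2pi[OF assms] by metis
  define u where "u = pi/4 - t/2"
  have 2: "2 * u = pi/2 - t" by (simp add: u_def field_simps)
  have s: "sin (2 * u) = a" "cos (2 * u) = b" unfolding 2 t by (simp_all add: sin_diff cos_diff)
  show ?thesis
  proof (rule that[of "sin u" "cos u"])
    show "sin u * cos u = a / 2" using s(1) by (simp add: sin_double)
    show "(sin u)\<^sup>2 = (1 - b) / 2" using s(2) by (simp add: cos_double_sin)
  qed simp
qed

text \<open>Along the chosen direction the vector inside the norm stays on one line: it equals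
  \<open>(R - r s - s\<^sup>2/2) e\<close>, while the bound becomes \<open>M - r s - s\<^sup>2/2\<close>, with \<open>R < M = (1 - r\<^sup>2)/2\<close>.\<close>

lemma gap_oscillation_direction:
  assumes "gap r v m > 0"
  obtains x y :: real and p :: R2 where "x\<^sup>2 + y\<^sup>2 = 1"
    "\<And>s. \<bar>s\<bar> \<le> (1 - r\<^sup>2) / 8 \<Longrightarrow> gap (r + s) (v + s *\<^sub>R (x * y, - x\<^sup>2)) (m + s *\<^sub>R p) > 0"
proof -
  define E where "E = m - r *\<^sub>R v + (1/2) *\<^sub>R (0, 1 - r\<^sup>2)"
  define R where "R = norm E"
  have r1: "\<bar>r\<bar> < 1" using gap_pos_abs_less_1[OF assms] .
  have RM: "R < (1 - r\<^sup>2) / 2" using assms by (simp add: gap_def R_def E_def)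
  obtain a b where ab: "a\<^sup>2 + b\<^sup>2 = 1" "E = R *\<^sub>R (a, b)"
  proof (cases "E = 0")
    case True
    then show ?thesis using that[of 1 0] by (simp add: R_def zero_prod_def)
  next
    case False
    then have R: "R > 0" by (simp add: R_def)
    have eq: "R\<^sup>2 = (fst E)\<^sup>2 + (snd E)\<^sup>2" by (simp add: R_def norm_prod_def)
    have "(fst E / R)\<^sup>2 + (snd E / R)\<^sup>2 = ((fst E)\<^sup>2 + (snd E)\<^sup>2) / R\<^sup>2"
      by (simp add: power_divide add_divide_distrib)
    also have "\<dots> = 1" unfolding eq[symmetric] using R by simp
    finally have "(fst E / R)\<^sup>2 + (snd E / R)\<^sup>2 = 1" .
    then show ?thesis using that[of "fst E / R" "snd E / R"] R by (simp add: prod_eq_iff)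
  qed
  obtain x y where xy: "x\<^sup>2 + y\<^sup>2 = 1" "x * y = a / 2" "x\<^sup>2 = (1 - b) / 2"
    using unit_vector_half_angle[OF ab(1)] by metis
  \<comment> \<open>The choice of (x, y) already makes the coefficient of s^2 equal to -(a, b)/2.
    The vector \<open>p\<close> is solved from the requirement that the coefficient of s be -r (a,
    b); the velocity \<open>v\<close> is absorbed in \<open>p\<close>, so it never limits the
    amplitude.\<close>
  define p where "p = v + r *\<^sub>R (x * y, - x\<^sup>2) + r *\<^sub>R (0, 1) - r *\<^sub>R (a, b)"
  show ?thesis
  proof (rule that[OF xy(1), of p])
    fix s :: real assume s: "\<bar>s\<bar> \<le> (1 - r\<^sup>2) / 8"
    have "(m + s *\<^sub>R p) - (r + s) *\<^sub>R (v + s *\<^sub>R (x * y, - x\<^sup>2)) + (1/2) *\<^sub>R (0, 1 - (r + s)\<^sup>2)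
        = E - (r * s + s\<^sup>2 / 2) *\<^sub>R (a, b)"
      unfolding E_def p_def xy(2,3) by (simp add: prod_eq_iff field_simps power2_eq_square)
    also have "\<dots> = (R - r * s - s\<^sup>2 / 2) *\<^sub>R (a, b)"
      unfolding ab(2) by (simp add: algebra_simps)
    finally have n: "norm ((m + s *\<^sub>R p) - (r + s) *\<^sub>R (v + s *\<^sub>R (x * y, - x\<^sup>2)) + (1/2) *\<^sub>R (0, 1 - (r + s)\<^sup>2))
        = \<bar>R - r * s - s\<^sup>2 / 2\<bar>"
      using ab(1) by (simp add: norm_prod_def real_sqrt_abs[symmetric] del: real_sqrt_abs)
        (simp add: power_mult_distrib distrib_left[symmetric] del: distrib_left)
    have r2: "0 < 1 - r\<^sup>2" "1 - r\<^sup>2 \<le> 1" using r1 by (simp_all add: abs_square_less_1)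
    have s8: "8 * \<bar>s\<bar> \<le> 1 - r\<^sup>2" using s by simp
    have "r * s \<le> \<bar>s\<bar>" using r1 mult_mono[of "\<bar>r\<bar>" 1 "\<bar>s\<bar>" "\<bar>s\<bar>"] by (simp add: abs_mult[symmetric])
    moreover have "s\<^sup>2 \<le> \<bar>s\<bar>"
    proof -
      have "\<bar>s\<bar> \<le> 1" using s8 r2 by linarith
      then show ?thesis using mult_left_le[of "\<bar>s\<bar>" "\<bar>s\<bar>"] by (simp add: power2_eq_square)
    qed
    moreover have "R \<ge> 0" by (simp add: R_def)
    \<comment> \<open>This is the lower side of the absolute value; the upper side is R < (1 -
      r^2)/2. Since |r| < 1 and |s| \<le> 1, the left side is at most 6 |s|, which is at most 3/4 of
      1 - r^2.\<close>
    ultimately have "4 * (r * s) + 2 * s\<^sup>2 < 1 - r\<^sup>2 + 2 * R"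
      using s8 r2 by linarith
    then show "gap (r + s) (v + s *\<^sub>R (x * y, - x\<^sup>2)) (m + s *\<^sub>R p) > 0"
      unfolding gap_def n using RM by (simp add: power2_sum abs_if field_simps)
  qed
qed

section \<open>Localised oscillations and their derivatives\<close>

lemma pd_pd_mult_cos_affine:
  assumes \<beta>: "\<beta> \<in> Cc 3 W" and ab: "a \<in> Basis" "b \<in> Basis"
  shows "pd a (pd b (\<lambda>z. \<beta> z * cos (k * (\<zeta> \<bullet> z) + \<tau>))) z =
    (pd a (pd b \<beta>) z - k\<^sup>2 * (\<zeta> \<bullet> a) * (\<zeta> \<bullet> b) * \<beta> z) * cos (k * (\<zeta> \<bullet> z) + \<tau>)
     - k * ((\<zeta> \<bullet> a) * pd b \<beta> z + (\<zeta> \<bullet> b) * pd a \<beta> z) * sin (k * (\<zeta> \<bullet> z) + \<tau>)"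
proof -
  have C: "Ck (Suc 2) \<beta>" using CcD[OF \<beta>] by (simp add: eval_nat_numeral)
  have Cb: "Ck (Suc 1) (pd b \<beta>)" using Ck_pd[OF C ab(2)] by (simp add: eval_nat_numeral)
  note cc = Ck_cos_affine[of _ k \<zeta> \<tau>] and ss = Ck_sin_affine[of _ k \<zeta> \<tau>]
  have 1: "pd b (\<lambda>z. \<beta> z * cos (k * (\<zeta> \<bullet> z) + \<tau>)) =
    (\<lambda>z. pd b \<beta> z * cos (k * (\<zeta> \<bullet> z) + \<tau>) + (- (k * (\<zeta> \<bullet> b))) * (\<beta> z * sin (k * (\<zeta> \<bullet> z) + \<tau>)))"
    unfolding pd_mult[OF C cc] pd_cos_affine by (simp add: algebra_simps)
  have 2: "pd a (\<lambda>z. pd b \<beta> z * cos (k * (\<zeta> \<bullet> z) + \<tau>)) z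
    = pd a (pd b \<beta>) z * cos (k * (\<zeta> \<bullet> z) + \<tau>) - k * (\<zeta> \<bullet> a) * pd b \<beta> z * sin (k * (\<zeta> \<bullet> z) + \<tau>)"
    unfolding pd_mult[OF Cb cc] pd_cos_affine by (simp add: algebra_simps)
  have 3: "pd a (\<lambda>z. \<beta> z * sin (k * (\<zeta> \<bullet> z) + \<tau>)) z
    = pd a \<beta> z * sin (k * (\<zeta> \<bullet> z) + \<tau>) + k * (\<zeta> \<bullet> a) * \<beta> z * cos (k * (\<zeta> \<bullet> z) + \<tau>)"
    unfolding pd_mult[OF C ss] pd_sin_affine by (simp add: algebra_simps)
  have c1: "Ck (Suc 1) (\<lambda>z. pd b \<beta> z * cos (k * (\<zeta> \<bullet> z) + \<tau>))"
    by (intro Ck_mult Cb cc)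
  have c2: "Ck (Suc 2) (\<lambda>z. \<beta> z * sin (k * (\<zeta> \<bullet> z) + \<tau>))"
    by (intro Ck_mult C ss)
  show ?thesis
    unfolding 1 pd_add[OF c1 Ck_cmult[OF c2]] pd_cmult[OF c2] 2 3
    by (simp add: algebra_simps power2_eq_square)
qed

lemma eventually_div_less:
  fixes K d :: real
  assumes "d > 0"
  shows "\<forall>\<^sub>F N in sequentially. N \<ge> (1::nat) \<and> K / real N < d"
proof -
  have "(\<lambda>N. K / real N) \<longlonglongrightarrow> 0"
    by (rule lim_const_over_n)
  then have "\<forall>\<^sub>F N in sequentially. K / real N < d"
    using assms order_tendstoD(2) by blast
  then show ?thesis
    using eventually_ge_at_top[of "1::nat"] by eventually_elim auto
qed

text \<open>The factor 1/N^2 here and the factor 1/N in \<open>osc\<^sub>\<eta>\<close> undo two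
  derivatives of the wave and one derivative respectively, and the minus sign compensates cos'' =
  -cos. Both leading terms are then multiples of the same cosine.\<close>

definition osc\<^sub>\<theta> :: "('a::euclidean_space \<Rightarrow> real) \<Rightarrow> real \<Rightarrow> 'a \<Rightarrow> real \<Rightarrow> nat \<Rightarrow> 'a \<Rightarrow> real" where
  "osc\<^sub>\<theta> \<beta> A \<zeta> \<tau> N z = - (A / (real N)\<^sup>2) * (\<beta> z * cos (real N * (\<zeta> \<bullet> z) + \<tau>))"

definition osc\<^sub>\<eta> :: "('a::euclidean_space \<Rightarrow> real) \<Rightarrow> real \<Rightarrow> 'a \<Rightarrow> real \<Rightarrow> nat \<Rightarrow> 'a \<Rightarrow> real" where
  "osc\<^sub>\<eta> \<beta> B \<zeta> \<tau> N z = (B / real N) * (\<beta> z * sin (real N * (\<zeta> \<bullet> z) + \<tau>))"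

lemma osc_Cc:
  assumes "\<beta> \<in> Cc n W"
  shows "osc\<^sub>\<theta> \<beta> A \<zeta> \<tau> N \<in> Cc n W" "osc\<^sub>\<eta> \<beta> B \<zeta> \<tau> N \<in> Cc n W"
  unfolding osc\<^sub>\<theta>_def[abs_def] osc\<^sub>\<eta>_def[abs_def]
  by (intro Cc_cmult Cc_mult_left assms Ck_cos_affine Ck_sin_affine)+

text \<open>Only the terms in which both derivatives hit the wave survive as N grows. The estimate
  is uniform in \<open>\<tau>\<close> because the phase is selected by \<open>phase_choice\<close>
  after the frequency has been fixed.\<close>

lemma osc\<^sub>\<theta>_second_derivative:
  assumes \<beta>: "\<beta> \<in> Cc 3 W" and ab: "a \<in> Basis" "b \<in> Basis" and d: "d > 0"
  shows "\<forall>\<^sub>F N in sequentially. \<forall>\<tau> z.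
    \<bar>pd a (pd b (osc\<^sub>\<theta> \<beta> A \<zeta> \<tau> N)) z - (\<zeta> \<bullet> a) * (\<zeta> \<bullet> b) * (A * \<beta> z * cos (real N * (\<zeta> \<bullet> z) + \<tau>))\<bar> < d"
proof -
  obtain B0 where B0: "B0 > 0" "\<And>z. \<bar>pd a (pd b \<beta>) z\<bar> \<le> B0"
    using Cc_bounded[OF Cc_pd_numeral(2)[OF ab(1) Cc_pd_numeral(1)[OF ab(2) \<beta>]]] by blast
  obtain B1 where B1: "B1 > 0" "\<And>z. \<bar>pd a \<beta> z\<bar> \<le> B1"
    using Cc_bounded[OF Cc_pd_numeral(1)[OF ab(1) \<beta>]] by blast
  obtain B2 where B2: "B2 > 0" "\<And>z. \<bar>pd b \<beta> z\<bar> \<le> B2"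
    using Cc_bounded[OF Cc_pd_numeral(1)[OF ab(2) \<beta>]] by blast
  define L where "L = B0 + (\<bar>\<zeta> \<bullet> a\<bar> * B2 + \<bar>\<zeta> \<bullet> b\<bar> * B1)"
  have "\<forall>\<^sub>F N in sequentially. N \<ge> (1::nat) \<and> (\<bar>A\<bar> * L) / real N < d"
    by (rule eventually_div_less[OF d])
  then show ?thesis
  proof eventually_elim
    case (elim N)
    show ?case
    proof (intro allI)
      fix \<tau> z
      define c s where "c = cos (real N * (\<zeta> \<bullet> z) + \<tau>)" and "s = sin (real N * (\<zeta> \<bullet> z) + \<tau>)"
      define n where "n = real N"
      have n: "n \<ge> 1" using elim by (simp add: n_def)
      have cs: "\<bar>c\<bar> \<le> 1" "\<bar>s\<bar> \<le> 1" by (auto simp: c_def s_def)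
      have k: "Ck (Suc (Suc 1)) (\<lambda>z. \<beta> z * cos (real N * (\<zeta> \<bullet> z) + \<tau>))"
        using CcD[OF \<beta>] by (intro Ck_mult Ck_cos_affine) (simp add: eval_nat_numeral)
      \<comment> \<open>The leading term cancels exactly. What is left in \<open>D\<close> has at
        most one derivative on the wave, so it grows no faster than N, against a prefactor of order
        1/N^2.\<close>
      define D where "D = pd a (pd b \<beta>) z * c - n * (((\<zeta> \<bullet> a) * pd b \<beta> z + (\<zeta> \<bullet> b) * pd a \<beta> z) * s)"
      have "pd a (pd b (osc\<^sub>\<theta> \<beta> A \<zeta> \<tau> N)) z = - (A / n\<^sup>2) * pd a (pd b (\<lambda>z. \<beta> z * cos (n * (\<zeta> \<bullet> z) + \<tau>))) z"
        unfolding osc\<^sub>\<theta>_def[abs_def] pd_cmult[OF k] pd_cmult[OF Ck_pd[OF k ab(2)]] n_def ..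
      also have "\<dots> - (\<zeta> \<bullet> a) * (\<zeta> \<bullet> b) * (A * \<beta> z * c) = - (A / n\<^sup>2) * D"
        unfolding pd_pd_mult_cos_affine[OF \<beta> ab] D_def c_def s_def n_def[symmetric] using n
        by (simp add: field_simps power2_eq_square)
      finally have eq: "pd a (pd b (osc\<^sub>\<theta> \<beta> A \<zeta> \<tau> N)) z - (\<zeta> \<bullet> a) * (\<zeta> \<bullet> b) * (A * \<beta> z * c) = - (A / n\<^sup>2) * D" .
      have "\<bar>D\<bar> \<le> \<bar>pd a (pd b \<beta>) z * c\<bar> + \<bar>n * (((\<zeta> \<bullet> a) * pd b \<beta> z + (\<zeta> \<bullet> b) * pd a \<beta> z) * s)\<bar>"
        unfolding D_def by (rule abs_triangle_ineq4)
      also have "\<bar>pd a (pd b \<beta>) z * c\<bar> \<le> n * B0"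
      proof -
        have "\<bar>pd a (pd b \<beta>) z * c\<bar> \<le> B0 * 1"
          unfolding abs_mult by (intro mult_mono B0 cs) (use B0 in auto)
        also have "\<dots> \<le> n * B0" using n B0 by simp
        finally show ?thesis .
      qed
      also have "\<bar>n * (((\<zeta> \<bullet> a) * pd b \<beta> z + (\<zeta> \<bullet> b) * pd a \<beta> z) * s)\<bar>
          \<le> n * ((\<bar>\<zeta> \<bullet> a\<bar> * B2 + \<bar>\<zeta> \<bullet> b\<bar> * B1) * 1)"
      proof -
        have "\<bar>(\<zeta> \<bullet> a) * pd b \<beta> z + (\<zeta> \<bullet> b) * pd a \<beta> z\<bar> \<le> \<bar>\<zeta> \<bullet> a\<bar> * \<bar>pd b \<beta> z\<bar> + \<bar>\<zeta> \<bullet> b\<bar> * \<bar>pd a \<beta> z\<bar>"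
          unfolding abs_mult[symmetric] by (rule abs_triangle_ineq)
        also have "\<dots> \<le> \<bar>\<zeta> \<bullet> a\<bar> * B2 + \<bar>\<zeta> \<bullet> b\<bar> * B1"
          by (intro add_mono mult_left_mono B1 B2) auto
        finally have "\<bar>((\<zeta> \<bullet> a) * pd b \<beta> z + (\<zeta> \<bullet> b) * pd a \<beta> z) * s\<bar> \<le> (\<bar>\<zeta> \<bullet> a\<bar> * B2 + \<bar>\<zeta> \<bullet> b\<bar> * B1) * 1"
          unfolding abs_mult[of _ s] using B1 B2 by (intro mult_mono cs) auto
        then show ?thesis using n by (simp add: abs_mult[of n])
      qed
      finally have "\<bar>D\<bar> \<le> n * L"
        by (simp add: L_def algebra_simps)
      then have "\<bar>- (A / n\<^sup>2) * D\<bar> \<le> (\<bar>A\<bar> / n\<^sup>2) * (n * L)"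
        unfolding abs_mult by (intro mult_mono) auto
      also have "\<dots> = (\<bar>A\<bar> * L) / n" using n by (simp add: power2_eq_square)
      also have "\<dots> < d" using elim by (simp add: n_def)
      finally show "\<bar>pd a (pd b (osc\<^sub>\<theta> \<beta> A \<zeta> \<tau> N)) z - (\<zeta> \<bullet> a) * (\<zeta> \<bullet> b) * (A * \<beta> z * cos (real N * (\<zeta> \<bullet> z) + \<tau>))\<bar> < d"
        using eq by (simp add: c_def)
    qed
  qed
qed

lemma osc\<^sub>\<eta>_derivative:
  assumes \<beta>: "\<beta> \<in> Cc 3 W" and a: "a \<in> Basis" and d: "d > 0"
  shows "\<forall>\<^sub>F N in sequentially. \<forall>\<tau> z.
    \<bar>pd a (osc\<^sub>\<eta> \<beta> B \<zeta> \<tau> N) z - (\<zeta> \<bullet> a) * (B * \<beta> z * cos (real N * (\<zeta> \<bullet> z) + \<tau>))\<bar> < d"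
proof -
  obtain B1 where B1: "B1 > 0" "\<And>z. \<bar>pd a \<beta> z\<bar> \<le> B1"
    using Cc_bounded[OF Cc_pd_numeral(1)[OF a \<beta>]] by blast
  have "\<forall>\<^sub>F N in sequentially. N \<ge> (1::nat) \<and> (\<bar>B\<bar> * B1) / real N < d"
    by (rule eventually_div_less[OF d])
  then show ?thesis
  proof eventually_elim
    case (elim N)
    show ?case
    proof (intro allI)
      fix \<tau> z
      have C: "Ck (Suc 2) \<beta>" using CcD[OF \<beta>] by (simp add: eval_nat_numeral)
      have S: "Ck (Suc 2) (\<lambda>z. sin (real N * (\<zeta> \<bullet> z) + \<tau>))" by (rule Ck_sin_affine)
      have eq: "pd a (osc\<^sub>\<eta> \<beta> B \<zeta> \<tau> N) z - (\<zeta> \<bullet> a) * (B * \<beta> z * cos (real N * (\<zeta> \<bullet> z) + \<tau>))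
        = (B / real N) * (pd a \<beta> z * sin (real N * (\<zeta> \<bullet> z) + \<tau>))"
        unfolding osc\<^sub>\<eta>_def[abs_def] pd_cmult[OF Ck_mult[OF C S]] pd_mult[OF C S] pd_sin_affine
        using elim by (simp add: field_simps)
      have "\<bar>pd a \<beta> z * sin (real N * (\<zeta> \<bullet> z) + \<tau>)\<bar> \<le> B1 * 1"
        unfolding abs_mult using B1 by (intro mult_mono) auto
      then have "\<bar>(B / real N) * (pd a \<beta> z * sin (real N * (\<zeta> \<bullet> z) + \<tau>))\<bar> \<le> \<bar>B / real N\<bar> * (B1 * 1)"
        unfolding abs_mult[of "B / real N"] by (intro mult_left_mono) auto
      also have "\<dots> = (\<bar>B\<bar> * B1) / real N" by simp
      finally show "\<bar>pd a (osc\<^sub>\<eta> \<beta> B \<zeta> \<tau> N) z - (\<zeta> \<bullet> a) * (B * \<beta> z * cos (real N * (\<zeta> \<bullet> z) + \<tau>))\<bar> < d"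
        unfolding eq using elim by linarith
    qed
  qed
qed

lemma osc\<^sub>\<theta>_small:
  assumes \<beta>: "\<beta> \<in> Cc 3 W" and d: "d > 0"
  shows "\<forall>\<^sub>F N in sequentially. \<forall>\<tau> z. \<bar>osc\<^sub>\<theta> \<beta> A \<zeta> \<tau> N z\<bar> < d"
proof -
  obtain B1 where B1: "B1 > 0" "\<And>z. \<bar>\<beta> z\<bar> \<le> B1"
    using Cc_bounded[OF \<beta>] by blast
  have "\<forall>\<^sub>F N in sequentially. N \<ge> (1::nat) \<and> (\<bar>A\<bar> * B1) / real N < d"
    by (rule eventually_div_less[OF d])
  then show ?thesis
  proof eventually_elim
    case (elim N)
    show ?case
    proof (intro allI)
      fix \<tau> z
      have "\<bar>\<beta> z * cos (real N * (\<zeta> \<bullet> z) + \<tau>)\<bar> \<le> B1 * 1"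
        unfolding abs_mult using B1 by (intro mult_mono) auto
      moreover have "\<bar>- (A / (real N)\<^sup>2)\<bar> \<le> \<bar>A\<bar> / real N"
        using elim by (auto simp: power2_eq_square abs_mult divide_simps mult_le_cancel_left1)
      ultimately have "\<bar>osc\<^sub>\<theta> \<beta> A \<zeta> \<tau> N z\<bar> \<le> (\<bar>A\<bar> / real N) * (B1 * 1)"
        unfolding osc\<^sub>\<theta>_def abs_mult[of "- (A / (real N)\<^sup>2)"] by (intro mult_mono) auto
      then show "\<bar>osc\<^sub>\<theta> \<beta> A \<zeta> \<tau> N z\<bar> < d" using elim by simp
    qed
  qed
qed

text \<open>The exponent 4 is the smallest that \<open>Ck_max_0_power\<close> allows for class
  C^3.\<close>

definition bump :: "'a::euclidean_space \<Rightarrow> real \<Rightarrow> 'a \<Rightarrow> real" where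
  "bump c r z = max 0 (1 - (1 / r\<^sup>2) * (norm (z - c))\<^sup>2) ^ 4"

lemma bump_Cc:
  assumes "r > 0"
  shows "bump c r \<in> Cc 3 (cball c r)"
proof (rule CcI_subset[of _ _ "cball c r"])
  have "\<And>n. Ck n (\<lambda>z. 1 - (1 / r\<^sup>2) * (norm (z - c))\<^sup>2)"
    by (intro Ck_diff Ck_const Ck_cmult Ck_norm_power2)
  from Ck_max_0_power[OF this, of 3] show "Ck 3 (bump c r)"
    by (simp add: bump_def[abs_def])
  fix z assume "z \<notin> cball c r"
  then have "r < norm (z - c)" by (simp add: dist_norm norm_minus_commute)
  then have "r\<^sup>2 < (norm (z - c))\<^sup>2" using assms by (simp add: power_strict_mono)
  then have "1 < (1 / r\<^sup>2) * (norm (z - c))\<^sup>2" using assms by (simp add: less_divide_eq)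
  then show "bump c r z = 0" by (simp add: bump_def)
qed auto

lemma bump_bounds:
  shows "0 \<le> bump c r z" "bump c r z \<le> 1"
  unfolding bump_def by (auto intro!: power_le_one)

lemma bump_inner:
  assumes "r > 0" "z \<in> cball c (r/2)"
  shows "(3/4)^4 \<le> bump c r z"
proof -
  have "norm (z - c) \<le> r/2" using assms by (simp add: dist_norm norm_minus_commute)
  then have "(norm (z - c))\<^sup>2 \<le> (r/2)\<^sup>2" by (intro power_mono) auto
  then have "(1 / r\<^sup>2) * (norm (z - c))\<^sup>2 \<le> 1/4" using assms by (simp add: field_simps)
  then have "3/4 \<le> 1 - (1 / r\<^sup>2) * (norm (z - c))\<^sup>2" by linarith
  then have "3/4 \<le> max 0 (1 - (1 / r\<^sup>2) * (norm (z - c))\<^sup>2)" by (rule order_trans) (rule max.cobounded2)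
  then show ?thesis unfolding bump_def by (rule power_mono) simp
qed

lemma integral_bump_square:
  fixes c :: spacetime
  assumes "r > 0"
  shows "(LINT z|lborel. (bump c r z)\<^sup>2) \<ge> (3/4)^8 / 8 * measure lborel (cball c r)"
proof -
  have fin: "emeasure lborel (cball c s) < \<infinity>" for s :: real
    by (rule emeasure_compact_finite) simp
  \<comment> \<open>Space-time is three-dimensional, so halving the radius costs a factor 8.\<close>
  have "measure lborel (cball c (r/2)) = measure lborel (cball c r) / 8"
    using assms content_cball[of "r/2" c] content_cball[of r c] by (simp add: power_divide)
  then have "(3/4)^8 / 8 * measure lborel (cball c r) = (LINT z|lborel. (3/4)^8 * indicator (cball c (r/2)) z)"
    by simp
  also have "\<dots> \<le> (LINT z|lborel. (bump c r z)\<^sup>2)"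
  proof (rule integral_mono)
    show "integrable lborel (\<lambda>z. (3/4)^8 * indicator (cball c (r/2)) z :: real)"
      using fin[of "r/2"] by (intro integrable_mult_right integrable_real_indicator) auto
    show "integrable lborel (\<lambda>z. (bump c r z)\<^sup>2)"
      unfolding power2_eq_square using bump_Cc[OF assms]
      by (intro Cc_Ck_mult_integrable[of _ 3 "cball c r" 3]) (auto dest: CcD)
    show "(3/4)^8 * indicator (cball c (r/2)) z \<le> (bump c r z)\<^sup>2" for z
    proof (cases "z \<in> cball c (r/2)")
      case True
      have "((3/4)^4)\<^sup>2 \<le> (bump c r z)\<^sup>2"
        using bump_inner[OF assms True] by (intro power_mono) auto
      then show ?thesis using True by (simp add: power_mult[symmetric])
    qed simp
  qed
  finally show ?thesis .
qed

lemma norm_triple_le: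
  fixes b c :: R2 and a :: real
  shows "norm (a, b, c) \<le> \<bar>a\<bar> + (\<bar>fst b\<bar> + \<bar>snd b\<bar>) + (\<bar>fst c\<bar> + \<bar>snd c\<bar>)"
proof -
  have "norm (a, b, c) \<le> \<bar>a\<bar> + (norm b + norm c)"
    using norm_Pair_le[of a "(b, c)"] norm_Pair_le[of b c] by simp
  moreover have "norm b \<le> \<bar>fst b\<bar> + \<bar>snd b\<bar>" "norm c \<le> \<bar>fst c\<bar> + \<bar>snd c\<bar>"
    using norm_Pair_le[of "fst b" "snd b"] norm_Pair_le[of "fst c" "snd c"] by simp_all
  ultimately show ?thesis by linarith
qed

text \<open>One of the two phases captures at least half of the mass, because the squares of
  cosine and sine add up to 1.\<close>

lemma phase_choice:
  assumes \<beta>: "\<beta> \<in> Cc n W"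
  obtains \<tau> where "(LINT z|lborel. (\<beta> z * cos (k * (\<zeta> \<bullet> z) + \<tau>))\<^sup>2) \<ge> (LINT z|lborel. (\<beta> z)\<^sup>2) / 2"
proof -
  define I where "I \<tau> = (LINT z|lborel. (\<beta> z * cos (k * (\<zeta> \<bullet> z) + \<tau>))\<^sup>2)" for \<tau>
  have i: "integrable lborel (\<lambda>z. (\<beta> z * cos (k * (\<zeta> \<bullet> z) + \<tau>))\<^sup>2)" for \<tau>
    unfolding power2_eq_square
    by (rule Cc_Ck_mult_integrable[OF _ CcD]) (rule Cc_mult_left[OF \<beta> Ck_cos_affine])+
  have "I 0 + I (pi/2) = (LINT z|lborel. (\<beta> z * cos (k * (\<zeta> \<bullet> z) + 0))\<^sup>2 + (\<beta> z * cos (k * (\<zeta> \<bullet> z) + pi/2))\<^sup>2)"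
    unfolding I_def by (rule Bochner_Integration.integral_add[symmetric]) (rule i)+
  also have "\<dots> = (LINT z|lborel. (\<beta> z)\<^sup>2)"
  proof (rule Bochner_Integration.integral_cong[OF refl])
    fix z
    have "(\<beta> z * cos (k * (\<zeta> \<bullet> z)))\<^sup>2 + (\<beta> z * - sin (k * (\<zeta> \<bullet> z)))\<^sup>2
      = (\<beta> z)\<^sup>2 * ((sin (k * (\<zeta> \<bullet> z)))\<^sup>2 + (cos (k * (\<zeta> \<bullet> z)))\<^sup>2)"
      by (simp only: power_mult_distrib power2_minus distrib_left add.commute)
    then show "(\<beta> z * cos (k * (\<zeta> \<bullet> z) + 0))\<^sup>2 + (\<beta> z * cos (k * (\<zeta> \<bullet> z) + pi/2))\<^sup>2 = (\<beta> z)\<^sup>2"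
      by (simp add: cos_add)
  qed
  finally have "I 0 \<ge> (LINT z|lborel. (\<beta> z)\<^sup>2) / 2 \<or> I (pi/2) \<ge> (LINT z|lborel. (\<beta> z)\<^sup>2) / 2"
    by linarith
  then show ?thesis using that unfolding I_def by blast
qed

text \<open>A wave of amplitude \<open>a\<close> carries at least \<open>a\<^sup>2\<close> times \<open>(3/4)^8/16\<close> of the volume of its ball:
  the bump exceeds \<open>(3/4)^4\<close> on the ball of half the radius, and the phase costs a factor 2. The rest
  of the constant compares \<open>a = (1 - \<rho>\<^sup>2)/8\<close> at the centre with the values nearby.\<close>

definition gain :: real where "gain = (3/4)^8 / 16384"

lemma gain_pos: "gain > 0" by (simp add: gain_def)

text \<open>The order of the quantifiers matters. The threshold for the radius depends on the point
  alone, while the frequency may depend on the radius and on \<open>\<epsilon>\<close>; since all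
  small radii are available at every point, the balls form a Vitali cover.\<close>

lemma local_perturbation:
  fixes \<rho> :: "spacetime \<Rightarrow> real" and v m :: "spacetime \<Rightarrow> R2"
  assumes U: "open U" "z\<^sub>0 \<in> U"
    and cont: "continuous_on U (\<lambda>z. (\<rho> z, v z, m z))"
    and strict: "\<And>z. z \<in> U \<Longrightarrow> gap (\<rho> z) (v z) (m z) > 0"
  shows "\<exists>r\<^sub>0>0. \<forall>r. 0 < r \<and> r < r\<^sub>0 \<longrightarrow> cball z\<^sub>0 r \<subseteq> U \<and>
    (\<forall>\<epsilon>>0. \<exists>\<theta> \<eta>. \<theta> \<in> Cc 3 (cball z\<^sub>0 r) \<and> \<eta> \<in> Cc 3 (cball z\<^sub>0 r) \<and> (\<forall>z. \<bar>\<theta> z\<bar> \<le> \<epsilon>) \<and>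
      (\<forall>z\<in>cball z\<^sub>0 r. gap (\<rho> z + drho \<theta> z) (v z + dvel \<theta> z) (m z + dmom \<theta> \<eta> z) > 0) \<and>
      (LINT z|lborel. (drho \<theta> z)\<^sup>2) \<ge> gain * (LINT z|lborel. indicator (cball z\<^sub>0 r) z * (1 - (\<rho> z)\<^sup>2)\<^sup>2))"
proof -
  define A where "A = (1 - (\<rho> z\<^sub>0)\<^sup>2) / 8"
  have r1: "\<bar>\<rho> z\<bar> < 1" if "z \<in> U" for z using gap_pos_abs_less_1[OF strict[OF that]] .
  have A: "A > 0" using r1[OF U(2)] by (simp add: A_def abs_square_less_1)
  obtain x y p where xy: "x\<^sup>2 + y\<^sup>2 = 1"
    and dir: "\<And>s. \<bar>s\<bar> \<le> A \<Longrightarrow> gap (\<rho> z\<^sub>0 + s) (v z\<^sub>0 + s *\<^sub>R (x * y, - x\<^sup>2)) (m z\<^sub>0 + s *\<^sub>R p) > 0"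
    using gap_oscillation_direction[OF strict[OF U(2)]] unfolding A_def by blast
  define w where "w s = (s, s *\<^sub>R (x * y, - x\<^sup>2), s *\<^sub>R p)" for s :: real
  define Z where "Z z = (\<rho> z, v z, m z)" for z
  define G where "G = {q. 0 < gap (fst q) (fst (snd q)) (snd (snd q))}"
  have G: "open G"
    unfolding G_def gap_def by (intro open_Collect_less continuous_intros)
  \<comment> \<open>The states visited by the wave form a compact segment inside the open set of
    strict states. This yields one tolerance \<open>\<delta>\<close> for all values of the
    oscillation.\<close>
  define S where "S = (\<lambda>s. Z z\<^sub>0 + w s) ` {-A..A}"
  have S: "compact S"
    unfolding S_def w_def by (intro compact_continuous_image continuous_intros) auto
  have "S \<subseteq> G"
    unfolding S_def G_def Z_def w_def using dir by auto
  then obtain \<delta> where \<delta>: "\<delta> > 0" "(\<Union>q\<in>S. ball q \<delta>) \<subseteq> G"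
    using compact_subset_open_imp_ball_epsilon_subset[OF S G] by metis
  have isc: "isCont Z z\<^sub>0"
    using cont U unfolding Z_def[abs_def] by (simp add: continuous_on_eq_continuous_at)
  then have "isCont (\<lambda>z. 1 - (fst (Z z))\<^sup>2) z\<^sub>0"
    by (intro continuous_intros)
  then have "((\<lambda>z. 1 - (fst (Z z))\<^sup>2) \<longlongrightarrow> 1 - (fst (Z z\<^sub>0))\<^sup>2) (nhds z\<^sub>0)"
    using tendsto_at_iff_tendsto_nhds[of "\<lambda>z. 1 - (fst (Z z))\<^sup>2" z\<^sub>0] by (simp add: isCont_def)
  \<comment> \<open>At the centre 1 - \<rho>^2 equals 8 A. Nearby it is allowed to double, and this
    enters the constant \<open>gain\<close>.\<close>
  moreover have "1 - (fst (Z z\<^sub>0))\<^sup>2 < 16 * A" using A by (simp add: A_def Z_def)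
  ultimately have ev1: "\<forall>\<^sub>F z in nhds z\<^sub>0. 1 - (\<rho> z)\<^sup>2 < 16 * A"
    by (simp add: order_tendstoD(2) Z_def)
  have "(Z \<longlongrightarrow> Z z\<^sub>0) (nhds z\<^sub>0)"
    using isc by (simp add: isCont_def tendsto_at_iff_tendsto_nhds)
  then have ev2: "\<forall>\<^sub>F z in nhds z\<^sub>0. dist (Z z) (Z z\<^sub>0) < \<delta> / 2"
    using \<delta>(1) by (intro tendstoD) auto
  have "\<forall>\<^sub>F z in nhds z\<^sub>0. z \<in> U"
    using U by (rule eventually_nhds_in_open)
  with ev1 ev2 have "\<forall>\<^sub>F z in nhds z\<^sub>0. z \<in> U \<and> 1 - (\<rho> z)\<^sup>2 < 16 * A \<and> dist (Z z) (Z z\<^sub>0) < \<delta> / 2"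
    by eventually_elim simp
  then obtain r\<^sub>0 where r0: "r\<^sub>0 > 0"
    and near: "\<And>z. dist z z\<^sub>0 < r\<^sub>0 \<Longrightarrow> z \<in> U \<and> 1 - (\<rho> z)\<^sup>2 < 16 * A \<and> dist (Z z) (Z z\<^sub>0) < \<delta> / 2"
    unfolding eventually_nhds_metric by blast
  show ?thesis
  proof (intro exI[of _ r\<^sub>0] conjI r0 allI impI)
    fix r assume r: "0 < r \<and> r < r\<^sub>0"
    have near': "z \<in> U \<and> 1 - (\<rho> z)\<^sup>2 < 16 * A \<and> dist (Z z) (Z z\<^sub>0) < \<delta> / 2" if "z \<in> cball z\<^sub>0 r" for z
      using near[of z] that r by (simp add: dist_commute)
    show QU: "cball z\<^sub>0 r \<subseteq> U" using near' by blast
    fix \<epsilon> :: real assume \<epsilon>: "\<epsilon> > 0"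
    define V where "V = measure lborel (cball z\<^sub>0 r)"
    have fin: "emeasure lborel (cball z\<^sub>0 r) < \<infinity>"
      by (rule emeasure_compact_finite) simp
    have \<beta>: "bump z\<^sub>0 r \<in> Cc 3 (cball z\<^sub>0 r)" using bump_Cc r by blast
    \<comment> \<open>The errors in the five components of the state add up to at most 8
      \<open>d\<close>, hence \<delta>/2; the density error is below 2 \<open>d\<close>, hence below
      A/100.\<close>
    define d where "d = min (\<delta> / 16) (A / 200)"
    have d: "d > 0" "d \<le> \<delta> / 16" "d \<le> A / 200" using \<delta>(1) A by (auto simp: d_def)
    \<comment> \<open>A wave with density amplitude 1 and momentum amplitude \<open>p\<close>
      conserves mass when its time frequency plus the product of \<open>p\<close> with (x, y)
      vanishes; this fixes the last component. The number \<open>b\<close> is the component of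
      \<open>p\<close> along (-y, x), which does not contribute to the divergence and is supplied by
      \<open>\<eta>\<close>.\<close>
    define \<zeta> :: spacetime where "\<zeta> = ((x, y), - (fst p * x + snd p * y))"
    define b where "b = x * snd p - y * fst p"
    define B where "B = A * b"
    have \<zeta>: "\<zeta> \<bullet> e\<^sub>1 = x" "\<zeta> \<bullet> e\<^sub>2 = y" "\<zeta> \<bullet> e\<^sub>t = - (fst p * x + snd p * y)"
      by (auto simp: \<zeta>_def)
    note od = osc\<^sub>\<theta>_second_derivative[OF \<beta> _ _ d(1), where A=A and \<zeta>=\<zeta>]
      and oe = osc\<^sub>\<eta>_derivative[OF \<beta> _ d(1), where B=B and \<zeta>=\<zeta>]
    have "\<forall>\<^sub>F N in sequentially. 
      (\<forall>\<tau> z. \<bar>osc\<^sub>\<theta> (bump z\<^sub>0 r) A \<zeta> \<tau> N z\<bar> < \<epsilon>) \<and>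
      (\<forall>\<tau> z. \<bar>pd e\<^sub>1 (pd e\<^sub>1 (osc\<^sub>\<theta> (bump z\<^sub>0 r) A \<zeta> \<tau> N)) z - (\<zeta> \<bullet> e\<^sub>1) * (\<zeta> \<bullet> e\<^sub>1) * (A * bump z\<^sub>0 r z * cos (real N * (\<zeta> \<bullet> z) + \<tau>))\<bar> < d) \<and>
      (\<forall>\<tau> z. \<bar>pd e\<^sub>2 (pd e\<^sub>2 (osc\<^sub>\<theta> (bump z\<^sub>0 r) A \<zeta> \<tau> N)) z - (\<zeta> \<bullet> e\<^sub>2) * (\<zeta> \<bullet> e\<^sub>2) * (A * bump z\<^sub>0 r z * cos (real N * (\<zeta> \<bullet> z) + \<tau>))\<bar> < d) \<and>
      (\<forall>\<tau> z. \<bar>pd e\<^sub>2 (pd e\<^sub>1 (osc\<^sub>\<theta> (bump z\<^sub>0 r) A \<zeta> \<tau> N)) z - (\<zeta> \<bullet> e\<^sub>2) * (\<zeta> \<bullet> e\<^sub>1) * (A * bump z\<^sub>0 r z * cos (real N * (\<zeta> \<bullet> z) + \<tau>))\<bar> < d) \<and>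
      (\<forall>\<tau> z. \<bar>pd e\<^sub>1 (pd e\<^sub>t (osc\<^sub>\<theta> (bump z\<^sub>0 r) A \<zeta> \<tau> N)) z - (\<zeta> \<bullet> e\<^sub>1) * (\<zeta> \<bullet> e\<^sub>t) * (A * bump z\<^sub>0 r z * cos (real N * (\<zeta> \<bullet> z) + \<tau>))\<bar> < d) \<and>
      (\<forall>\<tau> z. \<bar>pd e\<^sub>2 (pd e\<^sub>t (osc\<^sub>\<theta> (bump z\<^sub>0 r) A \<zeta> \<tau> N)) z - (\<zeta> \<bullet> e\<^sub>2) * (\<zeta> \<bullet> e\<^sub>t) * (A * bump z\<^sub>0 r z * cos (real N * (\<zeta> \<bullet> z) + \<tau>))\<bar> < d) \<and>
      (\<forall>\<tau> z. \<bar>pd e\<^sub>1 (osc\<^sub>\<eta> (bump z\<^sub>0 r) B \<zeta> \<tau> N) z - (\<zeta> \<bullet> e\<^sub>1) * (B * bump z\<^sub>0 r z * cos (real N * (\<zeta> \<bullet> z) + \<tau>))\<bar> < d) \<and>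
      (\<forall>\<tau> z. \<bar>pd e\<^sub>2 (osc\<^sub>\<eta> (bump z\<^sub>0 r) B \<zeta> \<tau> N) z - (\<zeta> \<bullet> e\<^sub>2) * (B * bump z\<^sub>0 r z * cos (real N * (\<zeta> \<bullet> z) + \<tau>))\<bar> < d)"
      by (intro eventually_conj osc\<^sub>\<theta>_small[OF \<beta> \<epsilon>] od oe spacetime_Basis)
    from eventually_happens'[OF sequentially_bot this] obtain N :: nat where
      small: "\<And>\<tau> z. \<bar>osc\<^sub>\<theta> (bump z\<^sub>0 r) A \<zeta> \<tau> N z\<bar> < \<epsilon>" and
      e11: "\<And>\<tau> z. \<bar>pd e\<^sub>1 (pd e\<^sub>1 (osc\<^sub>\<theta> (bump z\<^sub>0 r) A \<zeta> \<tau> N)) z - x * x * (A * bump z\<^sub>0 r z * cos (real N * (\<zeta> \<bullet> z) + \<tau>))\<bar> < d" and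
      e22: "\<And>\<tau> z. \<bar>pd e\<^sub>2 (pd e\<^sub>2 (osc\<^sub>\<theta> (bump z\<^sub>0 r) A \<zeta> \<tau> N)) z - y * y * (A * bump z\<^sub>0 r z * cos (real N * (\<zeta> \<bullet> z) + \<tau>))\<bar> < d" and
      e21: "\<And>\<tau> z. \<bar>pd e\<^sub>2 (pd e\<^sub>1 (osc\<^sub>\<theta> (bump z\<^sub>0 r) A \<zeta> \<tau> N)) z - y * x * (A * bump z\<^sub>0 r z * cos (real N * (\<zeta> \<bullet> z) + \<tau>))\<bar> < d" and
      e1t: "\<And>\<tau> z. \<bar>pd e\<^sub>1 (pd e\<^sub>t (osc\<^sub>\<theta> (bump z\<^sub>0 r) A \<zeta> \<tau> N)) z - x * - (fst p * x + snd p * y) * (A * bump z\<^sub>0 r z * cos (real N * (\<zeta> \<bullet> z) + \<tau>))\<bar> < d" and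
      e2t: "\<And>\<tau> z. \<bar>pd e\<^sub>2 (pd e\<^sub>t (osc\<^sub>\<theta> (bump z\<^sub>0 r) A \<zeta> \<tau> N)) z - y * - (fst p * x + snd p * y) * (A * bump z\<^sub>0 r z * cos (real N * (\<zeta> \<bullet> z) + \<tau>))\<bar> < d" and
      h1: "\<And>\<tau> z. \<bar>pd e\<^sub>1 (osc\<^sub>\<eta> (bump z\<^sub>0 r) B \<zeta> \<tau> N) z - x * (B * bump z\<^sub>0 r z * cos (real N * (\<zeta> \<bullet> z) + \<tau>))\<bar> < d" and
      h2: "\<And>\<tau> z. \<bar>pd e\<^sub>2 (osc\<^sub>\<eta> (bump z\<^sub>0 r) B \<zeta> \<tau> N) z - y * (B * bump z\<^sub>0 r z * cos (real N * (\<zeta> \<bullet> z) + \<tau>))\<bar> < d"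
      unfolding \<zeta> by blast
    obtain \<tau> where \<tau>: "(LINT z|lborel. (bump z\<^sub>0 r z * cos (real N * (\<zeta> \<bullet> z) + \<tau>))\<^sup>2) \<ge> (LINT z|lborel. (bump z\<^sub>0 r z)\<^sup>2) / 2"
      using phase_choice[OF \<beta>] by blast
    define \<theta> where "\<theta> = osc\<^sub>\<theta> (bump z\<^sub>0 r) A \<zeta> \<tau> N"
    define \<eta> where "\<eta> = osc\<^sub>\<eta> (bump z\<^sub>0 r) B \<zeta> \<tau> N"
    define g where "g z = bump z\<^sub>0 r z * cos (real N * (\<zeta> \<bullet> z) + \<tau>)" for z
    define s where "s z = A * g z" for z
    have gs: "A * bump z\<^sub>0 r z * cos (real N * (\<zeta> \<bullet> z) + \<tau>) = s z"
      "B * bump z\<^sub>0 r z * cos (real N * (\<zeta> \<bullet> z) + \<tau>) = b * s z" for z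
      by (auto simp: s_def g_def B_def)
    note E = e11[of \<tau>, folded \<theta>_def, unfolded gs] e22[of \<tau>, folded \<theta>_def, unfolded gs] e21[of \<tau>, folded \<theta>_def, unfolded gs]
      e1t[of \<tau>, folded \<theta>_def, unfolded gs] e2t[of \<tau>, folded \<theta>_def, unfolded gs] 
      h1[of \<tau>, folded \<eta>_def, unfolded gs] h2[of \<tau>, folded \<eta>_def, unfolded gs]
    have \<theta>C: "\<theta> \<in> Cc 3 (cball z\<^sub>0 r)" and \<eta>C: "\<eta> \<in> Cc 3 (cball z\<^sub>0 r)"
      unfolding \<theta>_def \<eta>_def by (intro osc_Cc \<beta>)+
    have g1: "\<bar>g z\<bar> \<le> 1" for z
      unfolding g_def abs_mult using bump_bounds[of z\<^sub>0 r z] by (intro mult_le_one) auto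
    have sA: "\<bar>s z\<bar> \<le> A" for z
      using mult_left_mono[OF g1, of A z] A by (simp add: s_def abs_mult)
    have dr: "\<bar>drho \<theta> z - s z\<bar> < 2 * d" for z
    proof -
      have "s z = (x\<^sup>2 + y\<^sup>2) * s z" by (simp add: xy)
      then have "drho \<theta> z - s z = (pd e\<^sub>1 (pd e\<^sub>1 \<theta>) z - x * x * s z) + (pd e\<^sub>2 (pd e\<^sub>2 \<theta>) z - y * y * s z)"
        by (simp add: drho_def algebra_simps power2_eq_square)
      then show ?thesis using E(1,2)[of z] by linarith
    qed
    have err: "norm ((drho \<theta> z, dvel \<theta> z, dmom \<theta> \<eta> z) - w (s z)) < \<delta> / 2" for z
    proof -
      have v1: "fst (dvel \<theta> z - s z *\<^sub>R (x * y, - x\<^sup>2)) = pd e\<^sub>2 (pd e\<^sub>1 \<theta>) z - y * x * s z"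
        "snd (dvel \<theta> z - s z *\<^sub>R (x * y, - x\<^sup>2)) = - (pd e\<^sub>1 (pd e\<^sub>1 \<theta>) z - x * x * s z)"
        by (simp_all add: dvel_def power2_eq_square algebra_simps)
      \<comment> \<open>As (x, y) is a unit vector, the components of \<open>p\<close> along (x, y)
        and (-y, x) reassemble \<open>p\<close>; the first comes from \<open>\<theta>\<close>, the
        second from \<open>\<eta>\<close>.\<close>
      have "s z * fst p = (x\<^sup>2 + y\<^sup>2) * (s z * fst p)" "s z * snd p = (x\<^sup>2 + y\<^sup>2) * (s z * snd p)" by (simp_all add: xy)
      then have m1: "fst (dmom \<theta> \<eta> z - s z *\<^sub>R p) = - (pd e\<^sub>1 (pd e\<^sub>t \<theta>) z - x * - (fst p * x + snd p * y) * s z) - (pd e\<^sub>2 \<eta> z - y * (b * s z))"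
        "snd (dmom \<theta> \<eta> z - s z *\<^sub>R p) = - (pd e\<^sub>2 (pd e\<^sub>t \<theta>) z - y * - (fst p * x + snd p * y) * s z) + (pd e\<^sub>1 \<eta> z - x * (b * s z))"
        by (simp_all add: dmom_def power2_eq_square b_def algebra_simps)
      have "norm ((drho \<theta> z, dvel \<theta> z, dmom \<theta> \<eta> z) - w (s z)) \<le> \<bar>drho \<theta> z - s z\<bar>
         + (\<bar>fst (dvel \<theta> z - s z *\<^sub>R (x * y, - x\<^sup>2))\<bar> + \<bar>snd (dvel \<theta> z - s z *\<^sub>R (x * y, - x\<^sup>2))\<bar>)
         + (\<bar>fst (dmom \<theta> \<eta> z - s z *\<^sub>R p)\<bar> + \<bar>snd (dmom \<theta> \<eta> z - s z *\<^sub>R p)\<bar>)"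
        unfolding w_def diff_Pair by (rule norm_triple_le)
      also have "\<dots> < 8 * d"
      proof -
        have sum: "a + (b + c) + (e + f) < 8 * d" if "a < 2 * d" "b < d" "c < d" "e < 2 * d" "f < 2 * d" for a b c e f :: real
          using that by linarith
        have two: "\<bar>- a - b\<bar> < 2 * d" "\<bar>- a + b\<bar> < 2 * d" if "\<bar>a\<bar> < d" "\<bar>b\<bar> < d" for a b :: real
          using that by linarith+
        show ?thesis
          unfolding v1 m1 abs_minus_cancel by (intro sum two dr E)
      qed
      also have "\<dots> \<le> \<delta> / 2" using d by simp
      finally show ?thesis .
    qed
    have "gap (\<rho> z + drho \<theta> z) (v z + dvel \<theta> z) (m z + dmom \<theta> \<eta> z) > 0" if z: "z \<in> cball z\<^sub>0 r" for z
    proof -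
      define q where "q = Z z + (drho \<theta> z, dvel \<theta> z, dmom \<theta> \<eta> z)"
      have "Z z\<^sub>0 + w (s z) \<in> S" unfolding S_def using sA[of z] by (intro imageI) auto
      moreover have "dist (Z z\<^sub>0 + w (s z)) q < \<delta>"
      proof -
        have "dist (Z z\<^sub>0 + w (s z)) q = norm ((Z z - Z z\<^sub>0) + ((drho \<theta> z, dvel \<theta> z, dmom \<theta> \<eta> z) - w (s z)))"
          unfolding dist_norm q_def by (subst norm_minus_commute) (simp add: algebra_simps)
        also have "\<dots> \<le> norm (Z z - Z z\<^sub>0) + norm ((drho \<theta> z, dvel \<theta> z, dmom \<theta> \<eta> z) - w (s z))"
          by (rule norm_triangle_ineq)
        also have "\<dots> < \<delta>" using near'[OF z] err[of z] by (simp add: dist_norm)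
        finally show ?thesis .
      qed
      ultimately have "q \<in> (\<Union>q\<in>S. ball q \<delta>)" by (intro UN_I) auto
      then have "q \<in> G" using \<delta>(2) by (rule subsetD[rotated])
      then show ?thesis by (simp add: q_def G_def Z_def)
    qed
    moreover have "(LINT z|lborel. (drho \<theta> z)\<^sup>2) \<ge> gain * (LINT z|lborel. indicator (cball z\<^sub>0 r) z * (1 - (\<rho> z)\<^sup>2)\<^sup>2)"
    proof -
      have ii: "integrable lborel (\<lambda>z. c * indicator (cball z\<^sub>0 r) z :: real)" for c
        using fin by (intro integrable_mult_right integrable_real_indicator) auto
      have gC: "g \<in> Cc 3 (cball z\<^sub>0 r)"
        unfolding g_def[abs_def] by (rule Cc_mult_left[OF \<beta> Ck_cos_affine])
      have ig: "integrable lborel (\<lambda>z. (g z)\<^sup>2)"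
        unfolding power2_eq_square by (rule Cc_Ck_mult_integrable[OF gC CcD[OF gC]])
      note dC = drho_Cc[OF \<theta>C]
      have id: "integrable lborel (\<lambda>z. (drho \<theta> z)\<^sup>2)"
        unfolding power2_eq_square by (rule Cc_Ck_mult_integrable[OF dC CcD[OF dC]])
      have "(LINT z|lborel. indicator (cball z\<^sub>0 r) z * (1 - (\<rho> z)\<^sup>2)\<^sup>2)
        \<le> (LINT z|lborel. (16 * A)\<^sup>2 * indicator (cball z\<^sub>0 r) z)"
      proof (rule integral_mono'[OF ii])
        show "indicator (cball z\<^sub>0 r) z * (1 - (\<rho> z)\<^sup>2)\<^sup>2 \<le> (16 * A)\<^sup>2 * indicator (cball z\<^sub>0 r) z" for z
        proof (cases "z \<in> cball z\<^sub>0 r")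
          case True
          have "(\<rho> z)\<^sup>2 \<le> 1" using r1[of z] near'[OF True] by (simp add: abs_square_le_1)
          then have "(1 - (\<rho> z)\<^sup>2)\<^sup>2 \<le> (16 * A)\<^sup>2" using near'[OF True] by (intro power_mono) auto
          then show ?thesis using True by simp
        qed simp
      qed simp
      then have "gain * (LINT z|lborel. indicator (cball z\<^sub>0 r) z * (1 - (\<rho> z)\<^sup>2)\<^sup>2) \<le> gain * ((16 * A)\<^sup>2 * V)"
        using gain_pos by (simp add: V_def)
      also have "\<dots> \<le> (A\<^sup>2 / 2) * ((3/4)^8 / 16 * V) - (A / 100)\<^sup>2 * V"
      proof -
        \<comment> \<open>Here 256 is the square of 16 from 1 - \<rho>^2 < 16 A, the 16 on the right
          is 8 for the half radius times 2 for the phase, and 1/10000 is the square of the relative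
          density error 1/100.\<close>
        have "V * A\<^sup>2 * (gain * 256) \<le> V * A\<^sup>2 * ((1/2) * ((3/4)^8 / 16) - 1/10000)"
          by (rule mult_left_mono) (auto simp: gain_def V_def power_divide)
        then show ?thesis by (simp add: algebra_simps power_mult_distrib power_divide)
      qed
      also have "\<dots> \<le> (A\<^sup>2 / 2) * (LINT z|lborel. (g z)\<^sup>2) - (A / 100)\<^sup>2 * V"
      proof -
        have "(3/4)^8 / 16 * V \<le> (LINT z|lborel. (g z)\<^sup>2)"
          using integral_bump_square[of r z\<^sub>0] \<tau> r unfolding g_def V_def by linarith
        then show ?thesis by (intro diff_right_mono mult_left_mono) auto
      qed
      also have "\<dots> = (LINT z|lborel. (A\<^sup>2 / 2) * (g z)\<^sup>2 - (A / 100)\<^sup>2 * indicator (cball z\<^sub>0 r) z)"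
        using ig ii by (simp add: V_def)
      also have "\<dots> \<le> (LINT z|lborel. (drho \<theta> z)\<^sup>2)"
      proof (rule integral_mono[OF _ id])
        show "integrable lborel (\<lambda>z. (A\<^sup>2 / 2) * (g z)\<^sup>2 - (A / 100)\<^sup>2 * indicator (cball z\<^sub>0 r) z)"
          by (intro Bochner_Integration.integrable_diff integrable_mult_right ig ii)
        show "(A\<^sup>2 / 2) * (g z)\<^sup>2 - (A / 100)\<^sup>2 * indicator (cball z\<^sub>0 r) z \<le> (drho \<theta> z)\<^sup>2" for z
        proof (cases "z \<in> cball z\<^sub>0 r")
          case True
          define e where "e = drho \<theta> z - s z"
          have "\<bar>e\<bar> \<le> A / 100" using dr[of z] d(3) by (simp add: e_def)
          then have "e\<^sup>2 \<le> (A / 100)\<^sup>2" by (rule abs_le_square_iff[THEN iffD1, OF order_trans]) auto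
          \<comment> \<open>An identity behind (s + e)^2 \<ge> s^2/2 - e^2; it is responsible for
            the remaining factor 1/2.\<close>
          moreover have "(s z + e)\<^sup>2 = (s z)\<^sup>2 / 2 - e\<^sup>2 + (s z + 2 * e)\<^sup>2 / 2"
            by (simp add: power2_eq_square field_simps)
          moreover have "(s z + 2 * e)\<^sup>2 \<ge> 0" by simp
          ultimately have "(s z)\<^sup>2 / 2 - (A / 100)\<^sup>2 \<le> (s z + e)\<^sup>2" by linarith
          then show ?thesis using True by (simp add: e_def s_def power_mult_distrib)
        next
          case False
          then show ?thesis using Cc_outside[OF gC] by simp
        qed
      qed
      finally show ?thesis .
    qed
    ultimately show "\<exists>\<theta> \<eta>. \<theta> \<in> Cc 3 (cball z\<^sub>0 r) \<and> \<eta> \<in> Cc 3 (cball z\<^sub>0 r) \<and> (\<forall>z. \<bar>\<theta> z\<bar> \<le> \<epsilon>) \<and>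
      (\<forall>z\<in>cball z\<^sub>0 r. gap (\<rho> z + drho \<theta> z) (v z + dvel \<theta> z) (m z + dmom \<theta> \<eta> z) > 0) \<and>
      (LINT z|lborel. (drho \<theta> z)\<^sup>2) \<ge> gain * (LINT z|lborel. indicator (cball z\<^sub>0 r) z * (1 - (\<rho> z)\<^sup>2)\<^sup>2)"
      using \<theta>C \<eta>C small[of \<tau>] by (intro exI[of _ \<theta>] exI[of _ \<eta>]) (auto simp: \<theta>_def less_imp_le)
  qed
qed

section \<open>Perturbation of a strict subsolution on its whole mixing zone\<close>

lemma Cc_Ck3: "\<theta> \<in> Cc 3 W \<Longrightarrow> Ck (Suc 2) \<theta>" "\<theta> \<in> Cc 3 W \<Longrightarrow> b \<in> Basis \<Longrightarrow> Ck (Suc 1) (pd b \<theta>)"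
  using CcD[of \<theta> 3 W] CcD[OF Cc_pd_numeral(1), of b \<theta> W] by (simp_all add: eval_nat_numeral)

lemma
  assumes \<theta>: "\<And>i. i \<in> F \<Longrightarrow> \<theta> i \<in> Cc 3 (W i)" and b: "b \<in> Basis"
  shows Cc_pd_sum: "pd b (\<lambda>z. \<Sum>i\<in>F. \<theta> i z) = (\<lambda>z. \<Sum>i\<in>F. pd b (\<theta> i) z)"
    and Cc_pd_pd_sum: "pd a (pd b (\<lambda>z. \<Sum>i\<in>F. \<theta> i z)) = (\<lambda>z. \<Sum>i\<in>F. pd a (pd b (\<theta> i)) z)"
proof -
  show 1: "pd b (\<lambda>z. \<Sum>i\<in>F. \<theta> i z) = (\<lambda>z. \<Sum>i\<in>F. pd b (\<theta> i) z)"
    by (rule pd_sum) (rule Cc_Ck3(1)[OF \<theta>])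
  show "pd a (pd b (\<lambda>z. \<Sum>i\<in>F. \<theta> i z)) = (\<lambda>z. \<Sum>i\<in>F. pd a (pd b (\<theta> i)) z)"
    unfolding 1 by (rule pd_sum) (rule Cc_Ck3(2)[OF \<theta> b])
qed

lemma
  assumes \<theta>: "\<theta> \<in> Cc 3 W" "\<theta>' \<in> Cc 3 W" and b: "b \<in> Basis"
  shows Cc_pd_add: "pd b (\<lambda>z. \<theta> z + \<theta>' z) = (\<lambda>z. pd b \<theta> z + pd b \<theta>' z)"
    and Cc_pd_pd_add: "pd a (pd b (\<lambda>z. \<theta> z + \<theta>' z)) = (\<lambda>z. pd a (pd b \<theta>) z + pd a (pd b \<theta>') z)"
    and Cc_pd_diff: "pd b (\<lambda>z. \<theta> z - \<theta>' z) = (\<lambda>z. pd b \<theta> z - pd b \<theta>' z)"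
    and Cc_pd_pd_diff: "pd a (pd b (\<lambda>z. \<theta> z - \<theta>' z)) = (\<lambda>z. pd a (pd b \<theta>) z - pd a (pd b \<theta>') z)"
proof -
  note c = Cc_Ck3(1)[OF \<theta>(1)] Cc_Ck3(1)[OF \<theta>(2)]
  note d = Cc_Ck3(2)[OF \<theta>(1) b] Cc_Ck3(2)[OF \<theta>(2) b]
  show 1: "pd b (\<lambda>z. \<theta> z + \<theta>' z) = (\<lambda>z. pd b \<theta> z + pd b \<theta>' z)"
    by (rule pd_add[OF c])
  show "pd a (pd b (\<lambda>z. \<theta> z + \<theta>' z)) = (\<lambda>z. pd a (pd b \<theta>) z + pd a (pd b \<theta>') z)"
    unfolding 1 by (rule pd_add[OF d])
  show 2: "pd b (\<lambda>z. \<theta> z - \<theta>' z) = (\<lambda>z. pd b \<theta> z - pd b \<theta>' z)"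
    by (rule pd_diff[OF c])
  show "pd a (pd b (\<lambda>z. \<theta> z - \<theta>' z)) = (\<lambda>z. pd a (pd b \<theta>) z - pd a (pd b \<theta>') z)"
    unfolding 2 by (rule pd_diff[OF d])
qed

lemma
  assumes \<theta>: "\<And>i. i \<in> F \<Longrightarrow> \<theta> i \<in> Cc 3 (W i)"
  shows drho_sum: "drho (\<lambda>z. \<Sum>i\<in>F. \<theta> i z) = (\<lambda>z. \<Sum>i\<in>F. drho (\<theta> i) z)"
    and dvel_sum: "dvel (\<lambda>z. \<Sum>i\<in>F. \<theta> i z) = (\<lambda>z. \<Sum>i\<in>F. dvel (\<theta> i) z)"
  unfolding drho_def dvel_def
  by (auto simp: fun_eq_iff Cc_pd_pd_sum[OF \<theta>] sum.distrib prod_eq_iff fst_sum snd_sum sum_negf)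

lemma dmom_sum:
  assumes \<theta>: "\<And>i. i \<in> F \<Longrightarrow> \<theta> i \<in> Cc 3 (W i)" and \<eta>: "\<And>i. i \<in> F \<Longrightarrow> \<eta> i \<in> Cc 3 (W i)"
  shows "dmom (\<lambda>z. \<Sum>i\<in>F. \<theta> i z) (\<lambda>z. \<Sum>i\<in>F. \<eta> i z) = (\<lambda>z. \<Sum>i\<in>F. dmom (\<theta> i) (\<eta> i) z)"
  unfolding dmom_def
  by (auto simp: fun_eq_iff Cc_pd_pd_sum[OF \<theta>] Cc_pd_sum[OF \<eta>] sum.distrib prod_eq_iff fst_sum snd_sum
      sum_negf sum_subtractf)

lemma
  assumes a: "\<theta> \<in> Cc 3 W" "\<theta>' \<in> Cc 3 W"
  shows drho_add: "drho (\<lambda>z. \<theta> z + \<theta>' z) z = drho \<theta> z + drho \<theta>' z"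
    and dvel_add: "dvel (\<lambda>z. \<theta> z + \<theta>' z) z = dvel \<theta> z + dvel \<theta>' z"
    and drho_diff: "drho (\<lambda>z. \<theta> z - \<theta>' z) z = drho \<theta> z - drho \<theta>' z"
    and dvel_diff: "dvel (\<lambda>z. \<theta> z - \<theta>' z) z = dvel \<theta> z - dvel \<theta>' z"
    and dmom_add: "\<eta> \<in> Cc 3 W \<Longrightarrow> \<eta>' \<in> Cc 3 W \<Longrightarrow>
      dmom (\<lambda>z. \<theta> z + \<theta>' z) (\<lambda>z. \<eta> z + \<eta>' z) z = dmom \<theta> \<eta> z + dmom \<theta>' \<eta>' z"
  unfolding drho_def dvel_def dmom_def
  by (auto simp: Cc_pd_pd_add[OF a] Cc_pd_pd_diff[OF a] Cc_pd_add)

lemma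
  assumes \<theta>: "\<theta> \<in> Cc 3 W" and z: "z \<notin> W"
  shows drho_outside: "drho \<theta> z = 0" and dvel_outside: "dvel \<theta> z = 0"
    and dmom_outside: "\<eta> \<in> Cc 3 W \<Longrightarrow> dmom \<theta> \<eta> z = 0"
proof -
  have 2: "pd a (pd b \<theta>) z = 0" if "a \<in> Basis" "b \<in> Basis" for a b
    using Cc_outside[OF Cc_pd_numeral(2)[OF that(1) Cc_pd_numeral(1)[OF that(2) \<theta>]] z] .
  have 1: "pd a \<eta> z = 0" if "\<eta> \<in> Cc 3 W" "a \<in> Basis" for a
    using Cc_outside[OF Cc_pd_numeral(1)[OF that(2,1)] z] .
  show "drho \<theta> z = 0" "dvel \<theta> z = 0" "\<eta> \<in> Cc 3 W \<Longrightarrow> dmom \<theta> \<eta> z = 0"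
    by (auto simp: drho_def dvel_def dmom_def 2 1 zero_prod_def)
qed

lemma continuous_on_perturbation:
  assumes \<theta>: "\<theta> \<in> Cc 3 W" and \<eta>: "\<eta> \<in> Cc 3 W"
  shows "continuous_on S (drho \<theta>)" "continuous_on S (dvel \<theta>)" "continuous_on S (dmom \<theta> \<eta>)"
proof -
  have 2: "continuous_on S (\<lambda>z. pd a (pd b \<theta>) z)" if "a \<in> Basis" "b \<in> Basis" for a b
    using Ck_continuous[OF CcD[OF Cc_pd_numeral(2)[OF that(1) Cc_pd_numeral(1)[OF that(2) \<theta>]]]]
    by (rule continuous_on_subset) simp
  have 1: "continuous_on S (\<lambda>z. pd a \<eta> z)" if "a \<in> Basis" for a
    using Ck_continuous[OF CcD[OF Cc_pd_numeral(1)[OF that \<eta>]]]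
    by (rule continuous_on_subset) simp
  show "continuous_on S (drho \<theta>)" "continuous_on S (dvel \<theta>)" "continuous_on S (dmom \<theta> \<eta>)"
    unfolding drho_def[abs_def] dvel_def[abs_def] dmom_def[abs_def]
    by (intro continuous_intros 1 2 spacetime_Basis)+
qed

lemma sum_disjoint_supports:
  fixes X :: "'i \<Rightarrow> 'b::comm_monoid_add"
  assumes F: "finite F" "i\<^sub>0 \<in> F" and X: "\<And>i. i \<in> F \<Longrightarrow> i \<noteq> i\<^sub>0 \<Longrightarrow> X i = 0"
  shows "(\<Sum>i\<in>F. X i) = X i\<^sub>0"
proof -
  have "(\<Sum>i\<in>F - {i\<^sub>0}. X i) = 0"
    by (rule sum.neutral) (use X in blast)
  then show ?thesis by (simp only: sum.remove[OF F] add_0_right)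
qed

text \<open>Only finitely many of the Vitali balls are kept, so that the potentials are finite sums
  with compact support in \<open>U\<close>. Half of the integral survives the selection, whence
  \<open>gain / 2\<close>. Strictness is a pointwise matter: on each ball a single wave acts, and
  elsewhere the state is unchanged.\<close>

lemma stage:
  fixes \<rho> :: "spacetime \<Rightarrow> real" and v m :: "spacetime \<Rightarrow> R2"
  assumes U: "open U" "bounded U"
    and cont: "continuous_on U (\<lambda>z. (\<rho> z, v z, m z))"
    and strict: "\<And>z. z \<in> U \<Longrightarrow> gap (\<rho> z) (v z) (m z) > 0"
    and \<epsilon>: "\<epsilon> > 0"
  shows "\<exists>\<theta> \<eta>. \<theta> \<in> Cc 3 U \<and> \<eta> \<in> Cc 3 U \<and> (\<forall>z. \<bar>\<theta> z\<bar> \<le> \<epsilon>) \<and>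
      (\<forall>z\<in>U. gap (\<rho> z + drho \<theta> z) (v z + dvel \<theta> z) (m z + dmom \<theta> \<eta> z) > 0) \<and>
      (LINT z|lborel. (drho \<theta> z)\<^sup>2) \<ge> gain / 2 * (LINT z|lborel. indicator U z * (1 - (\<rho> z)\<^sup>2)\<^sup>2)"
proof -
  define P where "P \<epsilon> z r \<theta> \<eta> \<longleftrightarrow> \<theta> \<in> Cc 3 (cball z r) \<and> \<eta> \<in> Cc 3 (cball z r) \<and> (\<forall>z. \<bar>\<theta> z\<bar> \<le> \<epsilon>) \<and>
      (\<forall>z\<in>cball z r. gap (\<rho> z + drho \<theta> z) (v z + dvel \<theta> z) (m z + dmom \<theta> \<eta> z) > 0) \<and>
      (LINT z|lborel. (drho \<theta> z)\<^sup>2) \<ge> gain * (LINT z'|lborel. indicator (cball z r) z' * (1 - (\<rho> z')\<^sup>2)\<^sup>2)"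
    for \<epsilon> z r \<theta> \<eta>
  define K where "K = {(z, r). z \<in> U \<and> 0 < r \<and> cball z r \<subseteq> U \<and> (\<exists>\<theta> \<eta>. P \<epsilon> z r \<theta> \<eta>)}"
  have vit: "\<exists>i. i \<in> K \<and> z \<in> cball (fst i) (snd i) \<and> snd i < d" if z: "z \<in> U" and d: "0 < d" for z d
  proof -
    obtain r\<^sub>0 where r0: "r\<^sub>0 > 0" "\<And>r. 0 < r \<Longrightarrow> r < r\<^sub>0 \<Longrightarrow> cball z r \<subseteq> U \<and> (\<exists>\<theta> \<eta>. P \<epsilon> z r \<theta> \<eta>)"
    proof -
      have "\<exists>r\<^sub>0>0. \<forall>r. 0 < r \<and> r < r\<^sub>0 \<longrightarrow> cball z r \<subseteq> U \<and> (\<forall>\<epsilon>>0. \<exists>\<theta> \<eta>. P \<epsilon> z r \<theta> \<eta>)"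
        unfolding P_def by (rule local_perturbation[OF U(1) z cont]) (rule strict)
      from this \<epsilon> show ?thesis by (elim exE conjE) (rule that, assumption, simp)
    qed
    have "0 < min r\<^sub>0 d / 2" "min r\<^sub>0 d / 2 < r\<^sub>0" "min r\<^sub>0 d / 2 < d" using r0(1) d by (auto simp: min_def)
    then show ?thesis
      using r0(2)[of "min r\<^sub>0 d / 2"] z by (intro exI[of _ "(z, min r\<^sub>0 d / 2)"]) (auto simp: K_def)
  qed
  have Kpos: "0 < snd i" if "i \<in> K" for i using that by (auto simp: K_def)
  obtain C where C: "countable C" "C \<subseteq> K"
     "pairwise (\<lambda>i j. disjnt (cball (fst i) (snd i)) (cball (fst j) (snd j))) C"
     "negligible (U - (\<Union>i\<in>C. cball (fst i) (snd i)))"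
    by (rule Vitali_covering_theorem_cballs[of K snd U fst]) (rule Kpos vit that; assumption)+
  define Q where "Q i = cball (fst i) (snd i)" for i :: "spacetime \<times> real"
  have QU: "Q i \<subseteq> U" if "i \<in> C" for i
  proof -
    have "i \<in> K" using that C(2) by blast
    then show ?thesis by (simp add: Q_def K_def case_prod_beta)
  qed
  have Qdisj: "Q i \<inter> Q j = {}" if "i \<in> C" "j \<in> C" "i \<noteq> j" for i j
    using C(3) that unfolding pairwise_def disjnt_def Q_def by blast
  have Qm [measurable]: "Q i \<in> sets borel" for i by (simp add: Q_def)
  define g where "g z = indicator U z * (1 - (\<rho> z)\<^sup>2)\<^sup>2" for z
  have "continuous_on U \<rho>" using continuous_on_fst[OF cont] by simp
  then have "(\<lambda>z. indicator U z *\<^sub>R (1 - (\<rho> z)\<^sup>2)\<^sup>2) \<in> borel_measurable borel"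
    using U(1) by (intro borel_measurable_continuous_on_indicator continuous_intros) auto
  then have gm [measurable]: "g \<in> borel_measurable borel" by (simp add: g_def[abs_def])
  have Ufin: "emeasure lborel U < \<infinity>"
    using emeasure_bounded_finite[OF U(2)] .
  have iU: "integrable lborel (indicator U :: _ \<Rightarrow> real)"
    using Ufin U(1) by (intro integrable_real_indicator) auto
  have g01: "0 \<le> g z" "g z \<le> indicator U z" for z
  proof -
    show "0 \<le> g z" by (simp add: g_def)
    show "g z \<le> indicator U z"
    proof (cases "z \<in> U")
      case True
      then have "(\<rho> z)\<^sup>2 < 1" using gap_pos_abs_less_1[OF strict] by (simp add: abs_square_less_1)
      then show ?thesis using True by (simp add: g_def power_le_one)
    qed (simp add: g_def)
  qed
  have gi: "integrable lborel g"
    by (rule Bochner_Integration.integrable_bound[OF iU]) (use g01 in auto)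
  have giI: "integrable lborel (\<lambda>z. indicator A z * g z)" if [measurable]: "A \<in> sets borel" for A
    by (rule Bochner_Integration.integrable_bound[OF gi]) (auto simp: indicator_def)
  have "\<exists>F. finite F \<and> F \<subseteq> C \<and> (LINT z|lborel. indicator (\<Union>i\<in>F. Q i) z * g z) \<ge> (LINT z|lborel. g z) / 2"
  proof (cases "(LINT z|lborel. g z) = 0")
    case True
    then show ?thesis by (intro exI[of _ "{}"]) simp
  next
    case False
    have "(LINT z|lborel. g z) \<ge> 0" by (rule integral_nonneg_AE) (simp add: g01)
    then have pos: "(LINT z|lborel. g z) > 0" using False by simp
    have Cm: "(\<Union>i\<in>C. Q i) \<in> sets borel" using C(1) by (intro sets.countable_UN'') auto
    have "U - (\<Union>i\<in>C. Q i) \<in> null_sets lebesgue"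
      using C(4) by (simp add: negligible_iff_null_sets Q_def)
    moreover have "U - (\<Union>i\<in>C. Q i) \<in> sets lborel" using U(1) Cm by auto
    ultimately have "U - (\<Union>i\<in>C. Q i) \<in> null_sets lborel"
      by (simp add: null_sets_completion_iff)
    from AE_not_in[OF this] have ae: "AE z in lborel. z \<in> U \<longrightarrow> z \<in> (\<Union>i\<in>C. Q i)"
      by eventually_elim auto
    \<comment> \<open>\<open>from_nat_into\<close> enumerates exactly \<open>C\<close> when
      \<open>C\<close> is countable and nonempty. An empty \<open>C\<close> would make
      \<open>U\<close> a null set and the integral zero.\<close>
    have "C \<noteq> {}"
    proof
      assume "C = {}"
      with ae have "AE z in lborel. g z = 0" by (auto simp: g_def elim: eventually_mono)
      then have "(LINT z|lborel. g z) = 0" using integral_cong_AE[of g lborel "\<lambda>_. 0"] by simp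
      then show False using False by simp
    qed
    then have rng: "range (from_nat_into C) = C" using C(1) by (rule range_from_nat_into)
    \<comment> \<open>Finite unions of the balls exhaust \<open>U\<close> up to a null set, so
      dominated convergence provides one that captures half of the integral.\<close>
    define S where "S n = (\<Union>k<n. Q (from_nat_into C k))" for n :: nat
    have Sm [measurable]: "S n \<in> sets borel" for n by (simp add: S_def)
    have "(\<lambda>n. LINT z|lborel. indicator (S n) z * g z) \<longlonglongrightarrow> (LINT z|lborel. g z)"
    proof (rule integral_dominated_convergence[where w=g])
      show "AE z in lborel. (\<lambda>n. indicator (S n) z * g z) \<longlonglongrightarrow> g z"
        using ae
      proof eventually_elim
        case (elim z)
        show ?case
        proof (cases "z \<in> U")
          case True
          then obtain k where "z \<in> Q (from_nat_into C k)" using elim rng by (metis UN_E imageE)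
          then have "z \<in> S n" if "n > k" for n using that by (auto simp: S_def)
          then have "\<forall>\<^sub>F n in sequentially. indicator (S n) z * g z = g z"
            by (intro eventually_mono[OF eventually_gt_at_top[of k]]) simp
          then show ?thesis by (rule tendsto_eventually)
        qed (simp add: g_def)
      qed
      show "AE z in lborel. norm (indicator (S n) z * g z) \<le> g z" for n
        using g01 by (auto simp: indicator_def)
    qed (auto simp: gi)
    moreover have "(LINT z|lborel. g z) / 2 < (LINT z|lborel. g z)" using pos by simp
    ultimately have "\<forall>\<^sub>F n in sequentially. (LINT z|lborel. g z) / 2 < (LINT z|lborel. indicator (S n) z * g z)"
      by (rule order_tendstoD(1))
    from eventually_happens'[OF sequentially_bot this] obtain n where
      n: "(LINT z|lborel. g z) / 2 < (LINT z|lborel. indicator (S n) z * g z)" by blast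
    have "S n = (\<Union>i\<in>from_nat_into C ` {..<n}. Q i)" by (auto simp: S_def)
    then show ?thesis
      using n rng by (intro exI[of _ "from_nat_into C ` {..<n}"]) (auto simp: from_nat_into[OF \<open>C \<noteq> {}\<close>])
  qed
  then obtain F where F: "finite F" "F \<subseteq> C"
    and Fg: "(LINT z|lborel. indicator (\<Union>i\<in>F. Q i) z * g z) \<ge> (LINT z|lborel. g z) / 2" by blast
  have "\<forall>i\<in>F. \<exists>\<theta> \<eta>. P \<epsilon> (fst i) (snd i) \<theta> \<eta>"
  proof
    fix i assume "i \<in> F"
    then have "i \<in> K" using F(2) C(2) by blast
    then show "\<exists>\<theta> \<eta>. P \<epsilon> (fst i) (snd i) \<theta> \<eta>" by (simp add: K_def case_prod_beta)
  qed
  then obtain \<theta> \<eta> where "\<And>i. i \<in> F \<Longrightarrow> P \<epsilon> (fst i) (snd i) (\<theta> i) (\<eta> i)" by metis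
  then have \<theta>C: "\<And>i. i \<in> F \<Longrightarrow> \<theta> i \<in> Cc 3 (Q i)" and \<eta>C: "\<And>i. i \<in> F \<Longrightarrow> \<eta> i \<in> Cc 3 (Q i)"
    and \<theta>s: "\<And>i z. i \<in> F \<Longrightarrow> \<bar>\<theta> i z\<bar> \<le> \<epsilon>"
    and str: "\<And>i z. i \<in> F \<Longrightarrow> z \<in> Q i \<Longrightarrow> gap (\<rho> z + drho (\<theta> i) z) (v z + dvel (\<theta> i) z) (m z + dmom (\<theta> i) (\<eta> i) z) > 0"
    and gn: "\<And>i. i \<in> F \<Longrightarrow> gain * (LINT z|lborel. indicator (Q i) z * (1 - (\<rho> z)\<^sup>2)\<^sup>2) \<le> (LINT z|lborel. (drho (\<theta> i) z)\<^sup>2)"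
    unfolding P_def Q_def by blast+
  define \<Theta> where "\<Theta> = (\<lambda>z. \<Sum>i\<in>F. \<theta> i z)"
  define H where "H = (\<lambda>z. \<Sum>i\<in>F. \<eta> i z)"
  have sums: "drho \<Theta> z = (\<Sum>i\<in>F. drho (\<theta> i) z)" "dvel \<Theta> z = (\<Sum>i\<in>F. dvel (\<theta> i) z)"
    "dmom \<Theta> H z = (\<Sum>i\<in>F. dmom (\<theta> i) (\<eta> i) z)" for z
    unfolding \<Theta>_def H_def
    using fun_cong[OF drho_sum[of F \<theta> Q], of z] fun_cong[OF dvel_sum[of F \<theta> Q], of z]
      fun_cong[OF dmom_sum[of F \<theta> Q \<eta>], of z] \<theta>C \<eta>C by blast+
  have out: "\<theta> i z = 0 \<and> drho (\<theta> i) z = 0 \<and> dvel (\<theta> i) z = 0 \<and> dmom (\<theta> i) (\<eta> i) z = 0" if "i \<in> F" "z \<notin> Q i" for i z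
    using Cc_outside[OF \<theta>C] drho_outside[OF \<theta>C] dvel_outside[OF \<theta>C] dmom_outside[OF \<theta>C _ \<eta>C] that by blast
  \<comment> \<open>At most one of the disjoint balls contains \<open>z\<close>. Hence every sum
    over \<open>F\<close> is zero or a single term, and the square of the sum equals the sum of the
    squares.\<close>
  have cases: "(z \<notin> (\<Union>i\<in>F. Q i) \<and> \<Theta> z = 0 \<and> drho \<Theta> z = 0 \<and> dvel \<Theta> z = 0 \<and> dmom \<Theta> H z = 0 \<and> (\<Sum>i\<in>F. (drho (\<theta> i) z)\<^sup>2) = 0) \<or>
     (\<exists>i\<in>F. z \<in> Q i \<and> \<Theta> z = \<theta> i z \<and> drho \<Theta> z = drho (\<theta> i) z \<and> dvel \<Theta> z = dvel (\<theta> i) z \<and> dmom \<Theta> H z = dmom (\<theta> i) (\<eta> i) z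
       \<and> (\<Sum>i\<in>F. (drho (\<theta> i) z)\<^sup>2) = (drho (\<theta> i) z)\<^sup>2)" for z
  proof (cases "z \<in> (\<Union>i\<in>F. Q i)")
    case False
    then have o: "\<theta> i z = 0" "drho (\<theta> i) z = 0" "dvel (\<theta> i) z = 0" "dmom (\<theta> i) (\<eta> i) z = 0"
      if "i \<in> F" for i using out[OF that, of z] that by auto
    have "\<Theta> z = 0" using o(1) by (simp add: \<Theta>_def)
    moreover have "drho \<Theta> z = 0" "dvel \<Theta> z = 0" "dmom \<Theta> H z = 0"
      unfolding sums using o(2-4) by simp_all
    ultimately show ?thesis using False o(2) by simp
  next
    case True
    then obtain i where i: "i \<in> F" "z \<in> Q i" by blast
    have oi: "z \<notin> Q j" if "j \<in> F" "j \<noteq> i" for j using Qdisj[of i j] that i F(2) by blast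
    have "\<Theta> z = \<theta> i z" unfolding \<Theta>_def
      by (rule sum_disjoint_supports[OF F(1) i(1)]) (use oi out in blast)
    moreover have "drho \<Theta> z = drho (\<theta> i) z" unfolding sums
      by (rule sum_disjoint_supports[OF F(1) i(1)]) (use oi out in blast)
    moreover have "dvel \<Theta> z = dvel (\<theta> i) z" unfolding sums
      by (rule sum_disjoint_supports[OF F(1) i(1)]) (use oi out in blast)
    moreover have "dmom \<Theta> H z = dmom (\<theta> i) (\<eta> i) z" unfolding sums
      by (rule sum_disjoint_supports[OF F(1) i(1)]) (use oi out in blast)
    moreover have "(\<Sum>i\<in>F. (drho (\<theta> i) z)\<^sup>2) = (drho (\<theta> i) z)\<^sup>2"
      by (rule sum_disjoint_supports[OF F(1) i(1)]) (use oi out in simp)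
    ultimately show ?thesis using i by blast
  qed
  show ?thesis
  proof (rule exI[of _ \<Theta>], rule exI[of _ H], intro conjI allI ballI)
    show "\<Theta> \<in> Cc 3 U" unfolding \<Theta>_def using \<theta>C QU F(2) by (intro Cc_sum) (blast intro: Cc_mono)
    show "H \<in> Cc 3 U" unfolding H_def using \<eta>C QU F(2) by (intro Cc_sum) (blast intro: Cc_mono)
    show "\<bar>\<Theta> z\<bar> \<le> \<epsilon>" for z
    proof -
      consider "\<Theta> z = 0" | i where "i \<in> F" "\<Theta> z = \<theta> i z" using cases[of z] by blast
      then show ?thesis using \<theta>s \<epsilon> by cases auto
    qed
    show "0 < gap (\<rho> z + drho \<Theta> z) (v z + dvel \<Theta> z) (m z + dmom \<Theta> H z)" if "z \<in> U" for z
    proof -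
      consider "drho \<Theta> z = 0" "dvel \<Theta> z = 0" "dmom \<Theta> H z = 0"
        | i where "i \<in> F" "z \<in> Q i" "drho \<Theta> z = drho (\<theta> i) z" "dvel \<Theta> z = dvel (\<theta> i) z"
          "dmom \<Theta> H z = dmom (\<theta> i) (\<eta> i) z"
        using cases[of z] by blast
      then show ?thesis
      proof cases
        case 1
        show ?thesis unfolding 1 using strict[OF that] by simp
      next
        case 2
        show ?thesis unfolding 2(3-5) using str[OF 2(1,2)] .
      qed
    qed
    have id: "integrable lborel (\<lambda>z. (drho (\<theta> i) z)\<^sup>2)" if "i \<in> F" for i
      unfolding power2_eq_square
      by (rule Cc_Ck_mult_integrable[OF drho_Cc[OF \<theta>C[OF that]] CcD[OF drho_Cc[OF \<theta>C[OF that]]]])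
    have "gain / 2 * (LINT z|lborel. g z) \<le> gain * (LINT z|lborel. indicator (\<Union>i\<in>F. Q i) z * g z)"
      using mult_left_mono[OF Fg, of gain] gain_pos by simp
    also have "(LINT z|lborel. indicator (\<Union>i\<in>F. Q i) z * g z) = (LINT z|lborel. (\<Sum>i\<in>F. indicator (Q i) z * g z))"
    proof -
      have "disjoint_family_on Q F" unfolding disjoint_family_on_def using Qdisj F(2) by blast
      then show ?thesis by (simp only: indicator_UN_disjoint[OF F(1)] sum_distrib_right)
    qed
    also have "\<dots> = (\<Sum>i\<in>F. LINT z|lborel. indicator (Q i) z * g z)"
      by (intro Bochner_Integration.integral_sum giI Qm)
    also have "gain * \<dots> = (\<Sum>i\<in>F. gain * (LINT z|lborel. indicator (Q i) z * (1 - (\<rho> z)\<^sup>2)\<^sup>2))"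
      unfolding sum_distrib_left
    proof (intro sum.cong refl arg_cong[of _ _ "\<lambda>x. gain * x"] Bochner_Integration.integral_cong)
      fix i z assume "i \<in> F"
      then have "Q i \<subseteq> U" using QU F(2) by blast
      then show "indicator (Q i) z * g z = indicator (Q i) z * (1 - (\<rho> z)\<^sup>2)\<^sup>2"
        by (auto simp: g_def indicator_def)
    qed
    also have "\<dots> \<le> (\<Sum>i\<in>F. LINT z|lborel. (drho (\<theta> i) z)\<^sup>2)"
      by (intro sum_mono gn)
    also have "\<dots> = (LINT z|lborel. (\<Sum>i\<in>F. (drho (\<theta> i) z)\<^sup>2))"
      by (intro Bochner_Integration.integral_sum[symmetric] id)
    also have "\<dots> = (LINT z|lborel. (drho \<Theta> z)\<^sup>2)"
    proof (intro Bochner_Integration.integral_cong refl)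
      fix z
      show "(\<Sum>i\<in>F. (drho (\<theta> i) z)\<^sup>2) = (drho \<Theta> z)\<^sup>2"
        using cases[of z] by (elim disjE conjE bexE) simp_all
    qed
    finally show "gain / 2 * (LINT z|lborel. indicator U z * (1 - (\<rho> z)\<^sup>2)\<^sup>2) \<le> (LINT z|lborel. (drho \<Theta> z)\<^sup>2)"
      unfolding g_def .
  qed
qed

section \<open>Weak smallness and the iteration\<close>

lemma integrable_bounded_lebesgue_on:
  fixes f :: "'a::euclidean_space \<Rightarrow> 'b::euclidean_space"
  assumes "f \<in> borel_measurable (lebesgue_on U)" "U \<in> lmeasurable" "\<And>z. z \<in> U \<Longrightarrow> norm (f z) \<le> B"
  shows "integrable (lebesgue_on U) f"
proof -
  have fm: "finite_measure (lebesgue_on U)" using assms(2) by (rule finite_measure_lebesgue_on)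
  show ?thesis
    by (rule finite_measure.integrable_const_bound[OF fm, of f B]) (use assms in auto)
qed

lemma L1_tendsto_of_bounded:
  fixes f :: "'a::euclidean_space \<Rightarrow> real"
  assumes "U \<in> lmeasurable" "\<And>n. F n \<in> borel_measurable (lebesgue_on U)" "f \<in> borel_measurable (lebesgue_on U)"
    "\<And>n z. z \<in> U \<Longrightarrow> \<bar>F n z\<bar> \<le> B" "AE z in lebesgue_on U. (\<lambda>n. F n z) \<longlonglongrightarrow> f z"
    "\<And>z. z \<in> U \<Longrightarrow> \<bar>f z\<bar> \<le> B"
  shows "(\<lambda>n. LINT z|lebesgue_on U. \<bar>f z - F n z\<bar>) \<longlonglongrightarrow> 0"
proof -
  have "(\<lambda>n. LINT z|lebesgue_on U. \<bar>f z - F n z\<bar>) \<longlonglongrightarrow> (LINT z|lebesgue_on U. 0)"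
  proof (rule integral_dominated_convergence[where w="\<lambda>_. 2 * B"])
    show "integrable (lebesgue_on U) (\<lambda>_. 2 * B)"
      by (rule integrable_bounded_lebesgue_on[where B="\<bar>2 * B\<bar>"]) (use assms(1) in auto)
    show "AE z in lebesgue_on U. (\<lambda>n. \<bar>f z - F n z\<bar>) \<longlonglongrightarrow> 0"
      using assms(5)
    proof eventually_elim
      case (elim z)
      have "(\<lambda>n. f z - F n z) \<longlonglongrightarrow> f z - f z" by (intro tendsto_diff tendsto_const elim)
      then show ?case by (simp add: tendsto_rabs_zero)
    qed
    show "AE z in lebesgue_on U. norm \<bar>f z - F n z\<bar> \<le> 2 * B" for n
    proof (rule AE_I2)
      fix z assume "z \<in> space (lebesgue_on U)"
      then have "z \<in> U" by simp
      then show "norm \<bar>f z - F n z\<bar> \<le> 2 * B" using assms(4)[of z n] assms(6)[of z] by simp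
    qed
    show "(\<lambda>z. \<bar>f z - F n z\<bar>) \<in> borel_measurable (lebesgue_on U)" for n
      using assms(2,3) by measurable
  qed auto
  then show ?thesis by simp
qed

lemma L1_triangle:
  fixes f g h :: "'a \<Rightarrow> real"
  assumes "integrable M (\<lambda>z. \<bar>f z - g z\<bar>)" "integrable M (\<lambda>z. \<bar>g z - h z\<bar>)" 
    "f \<in> borel_measurable M" "h \<in> borel_measurable M"
  shows "(LINT z|M. \<bar>f z - h z\<bar>) \<le> (LINT z|M. \<bar>f z - g z\<bar>) + (LINT z|M. \<bar>g z - h z\<bar>)"
proof -
  have i: "integrable M (\<lambda>z. \<bar>f z - g z\<bar> + \<bar>g z - h z\<bar>)" using assms by simp
  have "(LINT z|M. \<bar>f z - h z\<bar>) \<le> (LINT z|M. \<bar>f z - g z\<bar> + \<bar>g z - h z\<bar>)"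
    by (rule integral_mono'[OF i]) auto
  then show ?thesis using assms by simp
qed

text \<open>Polynomials are smooth on the whole space, so a Laplacian can be moved onto them without
  boundary terms. Truncation, approximation by continuous functions and Stone-Weierstrass on the
  compact closure cost less than e/3 each.\<close>

lemma L1_polynomial_approximation:
  fixes f :: "'a::euclidean_space \<Rightarrow> real"
  assumes U: "U \<in> lmeasurable" "bounded U" and f: "integrable (lebesgue_on U) f" and e: "e > 0"
  obtains p where "real_polynomial_function p" "(LINT z|lebesgue_on U. \<bar>f z - p z\<bar>) < e"
proof -
  have Um: "U \<in> sets lebesgue" using U(1) by blast
  have fm [measurable]: "f \<in> borel_measurable (lebesgue_on U)" using f by simp
  define tr where "tr K x = max (- K) (min K x)" for K x :: real
  have trb: "\<bar>tr K x\<bar> \<le> K" if "K \<ge> 0" for K x using that by (auto simp: tr_def)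
  have "(\<lambda>n. LINT z|lebesgue_on U. \<bar>f z - tr (real n) (f z)\<bar>) \<longlonglongrightarrow> (LINT z|lebesgue_on U. 0)"
  proof (rule integral_dominated_convergence[where w="\<lambda>z. \<bar>f z\<bar>"])
    show "AE z in lebesgue_on U. (\<lambda>n. \<bar>f z - tr (real n) (f z)\<bar>) \<longlonglongrightarrow> 0"
    proof (rule AE_I2, rule tendsto_eventually)
      fix z
      show "\<forall>\<^sub>F n in sequentially. \<bar>f z - tr (real n) (f z)\<bar> = 0"
        using eventually_ge_at_top[of "nat \<lceil>\<bar>f z\<bar>\<rceil>"]
      proof eventually_elim
        case (elim n)
        then have "\<bar>f z\<bar> \<le> real n" by linarith
        then show ?case by (auto simp: tr_def)
      qed
    qed
    show "AE z in lebesgue_on U. norm \<bar>f z - tr (real n) (f z)\<bar> \<le> \<bar>f z\<bar>" for n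
      by (rule AE_I2) (auto simp: tr_def)
    show "(\<lambda>z. \<bar>f z - tr (real n) (f z)\<bar>) \<in> borel_measurable (lebesgue_on U)" for n
      unfolding tr_def by measurable
  qed (use f in auto)
  then have "\<forall>\<^sub>F n in sequentially. (LINT z|lebesgue_on U. \<bar>f z - tr (real n) (f z)\<bar>) < e / 3"
    using e by (intro order_tendstoD(2)) auto
  from eventually_happens'[OF sequentially_bot this] obtain N where
    N: "(LINT z|lebesgue_on U. \<bar>f z - tr (real N) (f z)\<bar>) < e / 3" by blast
  define K where "K = real N"
  define f1 where "f1 z = tr K (f z)" for z
  have f1m [measurable]: "f1 \<in> borel_measurable (lebesgue_on U)" unfolding f1_def tr_def by measurable
  have K0: "K \<ge> 0" by (simp add: K_def)
  have f1b: "\<bar>f1 z\<bar> \<le> K" for z unfolding f1_def by (rule trb[OF K0])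
  have "f1 measurable_on U" using f1m measurable_on_iff_borel_measurable[OF Um] by blast
  then obtain Ng g where Ng: "negligible Ng" and gc: "\<And>n. continuous_on UNIV (g n)"
    and gl: "\<And>z. z \<notin> Ng \<Longrightarrow> (\<lambda>n. g n z) \<longlonglongrightarrow> (if z \<in> U then f1 z else 0)"
    unfolding measurable_on_def by blast
  \<comment> \<open>Truncating the approximants as well gives the common bound required for
    dominated convergence, and it does not move the limit, which already lies in [-K, K].\<close>
  define G where "G n z = tr K (g n z)" for n :: nat and z
  have Gc: "continuous_on S (G n)" for n S
    unfolding G_def tr_def by (intro continuous_intros continuous_on_subset[OF gc]) auto
  have Gm [measurable]: "G n \<in> borel_measurable (lebesgue_on U)" for n
    using continuous_imp_measurable_on_sets_lebesgue[OF Gc Um] .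
  have Gb: "\<bar>G n z\<bar> \<le> K" for n z unfolding G_def by (rule trb[OF K0])
  have "AE z in lebesgue_on U. (\<lambda>n. G n z) \<longlonglongrightarrow> f1 z"
  proof -
    have "AE z in lebesgue. z \<notin> Ng" using Ng by (intro AE_not_in) (simp add: negligible_iff_null_sets)
    then have "AE z in lebesgue. z \<in> U \<longrightarrow> (\<lambda>n. G n z) \<longlonglongrightarrow> f1 z"
    proof eventually_elim
      case (elim z)
      show ?case
      proof
        assume "z \<in> U"
        then have "(\<lambda>n. g n z) \<longlonglongrightarrow> f1 z" using gl[OF elim] by simp
        then have "(\<lambda>n. tr K (g n z)) \<longlonglongrightarrow> tr K (f1 z)" unfolding tr_def by (intro tendsto_intros)
        moreover have "tr K (f1 z) = f1 z" using f1b[of z] by (auto simp: tr_def)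
        ultimately show "(\<lambda>n. G n z) \<longlonglongrightarrow> f1 z" by (simp add: G_def)
      qed
    qed
    then show ?thesis using Um by (simp add: AE_restrict_space_iff)
  qed
  then have "(\<lambda>n. LINT z|lebesgue_on U. \<bar>f1 z - G n z\<bar>) \<longlonglongrightarrow> 0"
    by (intro L1_tendsto_of_bounded[OF U(1), where B=K] Gm f1m Gb f1b)
  then have "\<forall>\<^sub>F n in sequentially. (LINT z|lebesgue_on U. \<bar>f1 z - G n z\<bar>) < e / 3"
    using e by (intro order_tendstoD(2)) auto
  from eventually_happens'[OF sequentially_bot this] obtain k where
    k: "(LINT z|lebesgue_on U. \<bar>f1 z - G k z\<bar>) < e / 3" by blast
  define V where "V = measure lebesgue U"
  have V0: "V \<ge> 0" by (simp add: V_def)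
  \<comment> \<open>\<open>V + 1\<close> keeps the quotient meaningful when \<open>U\<close> is null
    and makes d V strictly smaller than e/3.\<close>
  define d where "d = e / (3 * (V + 1))"
  have d: "d > 0" using e V0 by (simp add: d_def)
  obtain p where p: "real_polynomial_function p" "\<And>z. z \<in> closure U \<Longrightarrow> \<bar>G k z - p z\<bar> < d"
    using Stone_Weierstrass_real_polynomial_function[of "closure U" "G k" d] U(2) Gc d
    by (metis compact_closure)
  have pc: "continuous_on S p" for S
    using p(1) continuous_on_polymonial_function[of p] by (simp add: real_polynomial_function_eq)
  have pm [measurable]: "p \<in> borel_measurable (lebesgue_on U)"
    using continuous_imp_measurable_on_sets_lebesgue[OF pc Um] .
  have pd: "\<bar>G k z - p z\<bar> \<le> d" if "z \<in> U" for z
    using p(2)[of z] that closure_subset[of U] by fastforce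
  have i1: "integrable (lebesgue_on U) (\<lambda>z. \<bar>f z - f1 z\<bar>)"
    by (rule Bochner_Integration.integrable_bound[OF f]) (auto simp: f1_def tr_def K_def)
  have i2: "integrable (lebesgue_on U) (\<lambda>z. \<bar>f1 z - G k z\<bar>)"
  proof (rule integrable_bounded_lebesgue_on[OF _ U(1)])
    show "norm \<bar>f1 z - G k z\<bar> \<le> 2 * K" for z
      using f1b[of z] Gb[of k z] by simp
  qed measurable
  have i3: "integrable (lebesgue_on U) (\<lambda>z. \<bar>G k z - p z\<bar>)"
    by (rule integrable_bounded_lebesgue_on[OF _ U(1), where B=d]) (use pd in auto)
  have i4: "integrable (lebesgue_on U) (\<lambda>z. \<bar>f1 z - p z\<bar>)"
    by (rule Bochner_Integration.integrable_bound[OF Bochner_Integration.integrable_add[OF i2 i3]]) auto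
  have "(LINT z|lebesgue_on U. \<bar>G k z - p z\<bar>) \<le> (LINT z|lebesgue_on U. d)"
  proof (rule integral_mono'[OF _ _])
    show "integrable (lebesgue_on U) (\<lambda>z. d)"
      by (rule integrable_bounded_lebesgue_on[OF _ U(1), of _ "\<bar>d\<bar>"]) auto
    show "\<bar>G k z - p z\<bar> \<le> d" if "z \<in> space (lebesgue_on U)" for z
      using pd that by simp
  qed (use d in simp)
  also have "\<dots> = d * V"
    using Um by (simp add: V_def measure_restrict_space)
  also have "\<dots> < e / 3" 
  proof -
    have "d * V < d * (V + 1)" using d by simp
    also have "\<dots> = e / 3" using V0 by (simp add: d_def field_simps)
    finally show ?thesis .
  qed
  finally have "(LINT z|lebesgue_on U. \<bar>G k z - p z\<bar>) < e / 3" .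
  moreover have "(LINT z|lebesgue_on U. \<bar>f z - p z\<bar>) \<le> (LINT z|lebesgue_on U. \<bar>f z - f1 z\<bar>) + (LINT z|lebesgue_on U. \<bar>f1 z - p z\<bar>)"
    by (rule L1_triangle[OF i1 i4]) auto
  moreover have "(LINT z|lebesgue_on U. \<bar>f1 z - p z\<bar>) \<le> (LINT z|lebesgue_on U. \<bar>f1 z - G k z\<bar>) + (LINT z|lebesgue_on U. \<bar>G k z - p z\<bar>)"
    by (rule L1_triangle[OF i2 i3]) auto
  ultimately have "(LINT z|lebesgue_on U. \<bar>f z - p z\<bar>) < e"
    using N k unfolding f1_def K_def by linarith
  then show ?thesis using that p(1) by blast
qed

text \<open>Against a polynomial, integration by parts exchanges the second derivatives of
  \<open>\<theta>\<close> for \<open>\<theta>\<close> itself. The bound 2 on the density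
  perturbation pays for replacing \<open>f\<close> by the polynomial; increments between two
  densities in (-1, 1) always satisfy it.\<close>

lemma drho_weakly_small:
  assumes U: "open U" "bounded U" and f: "integrable (lebesgue_on U) f" and e: "e > 0"
  shows "\<exists>\<delta>>0. \<forall>\<theta>. \<theta> \<in> Cc 3 U \<and> (\<forall>z\<in>U. \<bar>drho \<theta> z\<bar> \<le> 2) \<and> (\<forall>z. \<bar>\<theta> z\<bar> \<le> \<delta>) \<longrightarrow>
    \<bar>LINT z|lebesgue_on U. drho \<theta> z * f z\<bar> \<le> e"
proof -
  have Ul: "U \<in> lmeasurable" by (rule lmeasurable_open[OF U(2,1)])
  have Um: "U \<in> sets lebesgue" using Ul by blast
  obtain p where p: "real_polynomial_function p" "(LINT z|lebesgue_on U. \<bar>f z - p z\<bar>) < e / 4"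
    using L1_polynomial_approximation[OF Ul U(2) f, of "e/4"] e by auto
  have pC: "Ck n p" for n by (rule Ck_real_polynomial_function[OF p(1)])
  define q where "q = drho p"
  have qC: "continuous_on UNIV q"
    unfolding q_def drho_def[abs_def]
    by (intro continuous_intros Ck_continuous[of 0] Ck_pd pC) auto
  have "bounded (q ` closure U)"
    using U(2) by (intro compact_imp_bounded compact_continuous_image continuous_on_subset[OF qC]) auto
  then obtain B where B: "B > 0" "\<And>z. z \<in> U \<Longrightarrow> \<bar>q z\<bar> \<le> B"
    unfolding bounded_pos using closure_subset[of U] by fastforce
  define V where "V = measure lebesgue U"
  have V0: "V \<ge> 0" by (simp add: V_def)
  define \<delta> where "\<delta> = e / (2 * (B * (V + 1)))"
  have \<delta>: "\<delta> > 0" using e V0 B by (simp add: \<delta>_def)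
  have pm: "p \<in> borel_measurable (lebesgue_on U)"
    using continuous_imp_measurable_on_sets_lebesgue[OF continuous_on_subset[OF Ck_continuous[OF pC]] Um] by simp
  have "bounded (p ` closure U)"
    using U(2) by (intro compact_imp_bounded compact_continuous_image continuous_on_subset[OF Ck_continuous[OF pC]]) auto
  then obtain Bp where Bp: "\<And>z. z \<in> U \<Longrightarrow> \<bar>p z\<bar> \<le> Bp"
    unfolding bounded_pos using closure_subset[of U] by fastforce
  have pi: "integrable (lebesgue_on U) p"
    by (rule integrable_bounded_lebesgue_on[OF pm Ul, of Bp]) (simp add: Bp)
  show ?thesis
  proof (intro exI[of _ \<delta>] conjI \<delta> allI impI)
    fix \<theta> assume "\<theta> \<in> Cc 3 U \<and> (\<forall>z\<in>U. \<bar>drho \<theta> z\<bar> \<le> 2) \<and> (\<forall>z. \<bar>\<theta> z\<bar> \<le> \<delta>)"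
    then have \<theta>: "\<theta> \<in> Cc 3 U" "\<And>z. z \<in> U \<Longrightarrow> \<bar>drho \<theta> z\<bar> \<le> 2" "\<And>z. \<bar>\<theta> z\<bar> \<le> \<delta>" by auto
    note dC = drho_Cc[OF \<theta>(1)]
    have dm: "drho \<theta> \<in> borel_measurable (lebesgue_on U)"
      using continuous_imp_measurable_on_sets_lebesgue[OF continuous_on_subset[OF Ck_continuous[OF CcD[OF dC]]] Um] by simp
    have bi: "integrable (lebesgue_on U) (\<lambda>z. drho \<theta> z * h z)" if h: "integrable (lebesgue_on U) h" for h
    proof (rule Bochner_Integration.integrable_bound[of _ "\<lambda>z. 2 * h z"])
      show "AE z in lebesgue_on U. norm (drho \<theta> z * h z) \<le> norm (2 * h z)"
      proof (rule AE_I2)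
        fix z assume "z \<in> space (lebesgue_on U)"
        then show "norm (drho \<theta> z * h z) \<le> norm (2 * h z)"
          using mult_right_mono[OF \<theta>(2), of z "\<bar>h z\<bar>"] by (simp add: abs_mult)
      qed
    qed (use h dm in auto)
    have "(LINT z|lebesgue_on U. drho \<theta> z * f z) = (LINT z|lebesgue_on U. drho \<theta> z * (f z - p z)) + (LINT z|lebesgue_on U. drho \<theta> z * p z)"
      using bi[OF f] bi[OF pi] by (simp add: right_diff_distrib)
    moreover have "\<bar>LINT z|lebesgue_on U. drho \<theta> z * (f z - p z)\<bar> \<le> e / 2"
    proof -
      have ii: "integrable (lebesgue_on U) (\<lambda>z. 2 * \<bar>f z - p z\<bar>)" using f pi by auto
      have "\<bar>LINT z|lebesgue_on U. drho \<theta> z * (f z - p z)\<bar> \<le> (LINT z|lebesgue_on U. \<bar>drho \<theta> z * (f z - p z)\<bar>)"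
        by (rule integral_abs_bound)
      also have "\<dots> \<le> (LINT z|lebesgue_on U. 2 * \<bar>f z - p z\<bar>)"
      proof (rule integral_mono'[OF ii])
        fix z assume "z \<in> space (lebesgue_on U)"
        then show "\<bar>drho \<theta> z * (f z - p z)\<bar> \<le> 2 * \<bar>f z - p z\<bar>"
          unfolding abs_mult by (intro mult_right_mono \<theta>(2)) auto
      qed simp
      also have "\<dots> \<le> e / 2" using p(2) by simp
      finally show ?thesis .
    qed
    moreover have "\<bar>LINT z|lebesgue_on U. drho \<theta> z * p z\<bar> \<le> e / 2"
    proof -
      have \<theta>2: "\<theta> \<in> Cc 2 U" by (rule Cc_mono[OF \<theta>(1)]) auto
      have qk: "Ck 0 q" using qC by simp
      note \<theta>q = Cc_mult_left[OF Cc_mono[OF \<theta>(1), of 0 U] qk]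
      have "(LINT z|lebesgue_on U. drho \<theta> z * p z) = (LINT z|lborel. drho \<theta> z * p z)"
        by (rule integral_lebesgue_on_supported)
          (use Um Cc_outside[OF dC] Ck_borel_measurable[OF Ck_mult[OF CcD[OF dC] pC]] in auto)
      also have "\<dots> = (LINT z|lborel. \<theta> z * q z)"
        using integral_laplace_mult[OF \<theta>2 pC, of e\<^sub>1 e\<^sub>2] by (simp add: drho_def q_def)
      also have "\<dots> = (LINT z|lebesgue_on U. \<theta> z * q z)"
        by (rule integral_lebesgue_on_supported[symmetric])
          (use Um Cc_outside[OF \<theta>q] Ck_borel_measurable[OF CcD[OF \<theta>q]] in auto)
      finally have "\<bar>LINT z|lebesgue_on U. drho \<theta> z * p z\<bar> \<le> (LINT z|lebesgue_on U. \<bar>\<theta> z * q z\<bar>)"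
        by simp
      also have "\<dots> \<le> (LINT z|lebesgue_on U. \<delta> * B)"
      proof (rule integral_mono')
        show "integrable (lebesgue_on U) (\<lambda>z. \<delta> * B)"
          by (rule integrable_bounded_lebesgue_on[OF _ Ul, of _ "\<bar>\<delta> * B\<bar>"]) auto
        show "\<bar>\<theta> z * q z\<bar> \<le> \<delta> * B" if "z \<in> space (lebesgue_on U)" for z
          unfolding abs_mult using that \<delta> by (intro mult_mono \<theta> B) auto
      qed (use \<delta> B in simp)
      also have "\<dots> = \<delta> * B * V"
        using Um by (simp add: V_def measure_restrict_space)
      also have "\<dots> \<le> \<delta> * B * (V + 1)" using \<delta> B by simp
      also have "\<dots> = e / 2"
      proof -
        have "e / (2 * X) * X = e / 2" if "X > 0" for X :: real using that by simp
        from this[of "B * (V + 1)"] show ?thesis using B(1) V0 by (simp only: \<delta>_def mult.assoc) simp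
      qed
      finally show ?thesis .
    qed
    ultimately show "\<bar>LINT z|lebesgue_on U. drho \<theta> z * f z\<bar> \<le> e" by linarith
  qed
qed

lemma integral_indicator_lebesgue_on:
  fixes h :: "'a::euclidean_space \<Rightarrow> real"
  assumes "open U" "continuous_on U h"
  shows "(LINT z|lborel. indicator U z * h z) = (LINT z|lebesgue_on U. h z)"
proof -
  have "(\<lambda>z. indicator U z *\<^sub>R h z) \<in> borel_measurable borel"
    using assms by (intro borel_measurable_continuous_on_indicator) auto
  then have "(LINT z|lborel. indicator U z *\<^sub>R h z) = (LINT z|lebesgue. indicator U z *\<^sub>R h z)"
    by (rule integral_lebesgue_lborel[symmetric])
  also have "\<dots> = (LINT z|lebesgue_on U. h z)"
    using assms(1) by (subst integral_restrict_space) auto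
  finally show ?thesis by simp
qed

section \<open>The iteration on a strict state\<close>

locale strict_state =
  fixes U :: "spacetime set" and \<rho> :: "spacetime \<Rightarrow> real" and v m :: "spacetime \<Rightarrow> R2"
  assumes U: "open U" "bounded U"
    and cont: "continuous_on U (\<lambda>z. (\<rho> z, v z, m z))"
    and strict: "\<And>z. z \<in> U \<Longrightarrow> gap (\<rho> z) (v z) (m z) > 0"
begin

text \<open>Potentials are always measured from the base state. A further stage is then an addition
  of potentials, and the difference of any two iterates is again generated by a potential.\<close>

definition adm :: "(spacetime \<Rightarrow> real) \<Rightarrow> (spacetime \<Rightarrow> real) \<Rightarrow> bool" where
  "adm \<theta> \<eta> \<longleftrightarrow> \<theta> \<in> Cc 3 U \<and> \<eta> \<in> Cc 3 U \<and>
     (\<forall>z\<in>U. gap (\<rho> z + drho \<theta> z) (v z + dvel \<theta> z) (m z + dmom \<theta> \<eta> z) > 0)"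

lemma U_lmeasurable: "U \<in> lmeasurable" by (rule lmeasurable_open[OF U(2,1)])

lemma U_sets: "U \<in> sets lebesgue" using U_lmeasurable by blast

lemma integrable_cont:
  fixes h :: "spacetime \<Rightarrow> real"
  assumes "continuous_on U h" "\<And>z. z \<in> U \<Longrightarrow> \<bar>h z\<bar> \<le> B"
  shows "integrable (lebesgue_on U) h"
  by (rule integrable_bounded_lebesgue_on[OF continuous_imp_measurable_on_sets_lebesgue[OF assms(1) U_sets] U_lmeasurable, of B])
     (use assms(2) in simp)

lemma adm_rho:
  assumes "adm \<theta> \<eta>"
  shows "continuous_on U (\<lambda>z. \<rho> z + drho \<theta> z)" "\<And>z. z \<in> U \<Longrightarrow> \<bar>\<rho> z + drho \<theta> z\<bar> < 1"
proof -
  have "continuous_on U \<rho>" using continuous_on_fst[OF cont] by simp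
  then show "continuous_on U (\<lambda>z. \<rho> z + drho \<theta> z)"
    using assms unfolding adm_def by (intro continuous_on_add continuous_on_perturbation(1)) auto
  show "\<And>z. z \<in> U \<Longrightarrow> \<bar>\<rho> z + drho \<theta> z\<bar> < 1"
    using assms gap_pos_abs_less_1 unfolding adm_def by blast
qed

lemma adm_zero: "adm (\<lambda>_. 0) (\<lambda>_. 0)"
  unfolding adm_def drho_def dvel_def dmom_def using strict by (simp add: zero_prod_def[symmetric])

lemma adm_stage:
  assumes a: "adm \<theta> \<eta>" and \<epsilon>: "\<epsilon> > 0"
  shows "\<exists>\<theta>' \<eta>'. adm \<theta>' \<eta>' \<and> (\<forall>z. \<bar>\<theta>' z - \<theta> z\<bar> \<le> \<epsilon>) \<and>
    (LINT z|lebesgue_on U. (drho \<theta>' z - drho \<theta> z)\<^sup>2) \<ge> gain / 2 * (LINT z|lebesgue_on U. (1 - (\<rho> z + drho \<theta> z)\<^sup>2)\<^sup>2)"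
proof -
  have \<theta>: "\<theta> \<in> Cc 3 U" and \<eta>: "\<eta> \<in> Cc 3 U" and g: "\<And>z. z \<in> U \<Longrightarrow> gap (\<rho> z + drho \<theta> z) (v z + dvel \<theta> z) (m z + dmom \<theta> \<eta> z) > 0"
    using a unfolding adm_def by auto
  have c: "continuous_on U \<rho>" "continuous_on U v" "continuous_on U m"
    using continuous_on_fst[OF cont] continuous_on_fst[OF continuous_on_snd[OF cont]] continuous_on_snd[OF continuous_on_snd[OF cont]] by simp_all
  have cont': "continuous_on U (\<lambda>z. (\<rho> z + drho \<theta> z, v z + dvel \<theta> z, m z + dmom \<theta> \<eta> z))"
    by (intro continuous_on_Pair continuous_on_add c continuous_on_perturbation[OF \<theta> \<eta>])
  have "\<exists>\<theta>' \<eta>'. \<theta>' \<in> Cc 3 U \<and> \<eta>' \<in> Cc 3 U \<and> (\<forall>z. \<bar>\<theta>' z\<bar> \<le> \<epsilon>) \<and>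
      (\<forall>z\<in>U. gap (\<rho> z + drho \<theta> z + drho \<theta>' z) (v z + dvel \<theta> z + dvel \<theta>' z) (m z + dmom \<theta> \<eta> z + dmom \<theta>' \<eta>' z) > 0) \<and>
      (LINT z|lborel. (drho \<theta>' z)\<^sup>2) \<ge> gain / 2 * (LINT z|lborel. indicator U z * (1 - (\<rho> z + drho \<theta> z)\<^sup>2)\<^sup>2)"
    by (rule stage[OF U cont' _ \<epsilon>]) (rule g)
  then obtain \<theta>' \<eta>' where \<theta>': "\<theta>' \<in> Cc 3 U" "\<eta>' \<in> Cc 3 U" "\<And>z. \<bar>\<theta>' z\<bar> \<le> \<epsilon>"
    and g': "\<And>z. z \<in> U \<Longrightarrow> gap (\<rho> z + drho \<theta> z + drho \<theta>' z) (v z + dvel \<theta> z + dvel \<theta>' z) (m z + dmom \<theta> \<eta> z + dmom \<theta>' \<eta>' z) > 0"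
    and gn: "(LINT z|lborel. (drho \<theta>' z)\<^sup>2) \<ge> gain / 2 * (LINT z|lborel. indicator U z * (1 - (\<rho> z + drho \<theta> z)\<^sup>2)\<^sup>2)"
    by blast
  have "adm (\<lambda>z. \<theta> z + \<theta>' z) (\<lambda>z. \<eta> z + \<eta>' z)"
    unfolding adm_def using g' \<theta>' \<theta> \<eta>
    by (auto simp: drho_add[OF \<theta> \<theta>'(1)] dvel_add[OF \<theta> \<theta>'(1)] dmom_add[OF \<theta> \<theta>'(1) \<eta> \<theta>'(2)] add.assoc)
  moreover have "(LINT z|lborel. indicator U z * (1 - (\<rho> z + drho \<theta> z)\<^sup>2)\<^sup>2) = (LINT z|lebesgue_on U. (1 - (\<rho> z + drho \<theta> z)\<^sup>2)\<^sup>2)"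
    by (rule integral_indicator_lebesgue_on[OF U(1)]) (intro continuous_intros adm_rho(1)[OF a])
  moreover have "(LINT z|lborel. (drho \<theta>' z)\<^sup>2) = (LINT z|lebesgue_on U. (drho \<theta>' z)\<^sup>2)"
    using Ck_borel_measurable[OF CcD[OF drho_Cc[OF \<theta>'(1)]]] U_sets Cc_outside[OF drho_Cc[OF \<theta>'(1)]]
    by (intro integral_lebesgue_on_supported[symmetric]) auto
  ultimately show ?thesis
    using gn \<theta>'(3) by (intro exI[of _ "\<lambda>z. \<theta> z + \<theta>' z"] exI[of _ "\<lambda>z. \<eta> z + \<eta>' z"]) (auto simp: drho_add[OF \<theta> \<theta>'(1)])
qed

text \<open>The bound is demanded for all increments below the threshold at once, so a threshold
  chosen at stage \<open>j\<close> controls the products with every later increment. The geometric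
  bound keeps the total loss finite.\<close>

definition good :: "nat \<Rightarrow> (spacetime \<Rightarrow> real) \<Rightarrow> real \<Rightarrow> bool" where
  "good j \<theta> \<delta> \<longleftrightarrow> (\<forall>\<zeta>. \<zeta> \<in> Cc 3 U \<and> (\<forall>z\<in>U. \<bar>drho \<zeta> z\<bar> \<le> 2) \<and> (\<forall>z. \<bar>\<zeta> z\<bar> \<le> \<delta>) \<longrightarrow>
    \<bar>LINT z|lebesgue_on U. drho \<zeta> z * (\<rho> z + drho \<theta> z)\<bar> \<le> (1/2)^j)"

lemma good_ex:
  assumes "adm \<theta> \<eta>"
  shows "\<exists>\<delta>>0. good j \<theta> \<delta>"
  unfolding good_def
  by (rule drho_weakly_small[OF U]) (use integrable_cont[OF adm_rho(1)[OF assms] less_imp_le[OF adm_rho(2)[OF assms]]] in auto)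

lemma good_mono: "good j \<theta> \<delta> \<Longrightarrow> \<delta>' \<le> \<delta> \<Longrightarrow> good j \<theta> \<delta>'"
  unfolding good_def using order_trans by blast

text \<open>The smallness of the potentials makes each increment of the densities nearly orthogonal to
  all earlier densities, so that the \<open>L\<^sup>2\<close> norms almost increase and the increments are summable.\<close>

lemma iteration:
  assumes \<delta>\<^sub>0: "\<delta>\<^sub>0 > 0"
  obtains \<theta> \<eta> :: "nat \<Rightarrow> spacetime \<Rightarrow> real" where
    "\<And>j. adm (\<theta> j) (\<eta> j)" "\<And>j z. \<bar>\<theta> j z\<bar> \<le> \<delta>\<^sub>0"
    "\<And>e. e > 0 \<Longrightarrow> \<exists>N. \<forall>i\<ge>N. \<forall>j\<ge>N. (LINT z|lebesgue_on U. (drho (\<theta> i) z - drho (\<theta> j) z)\<^sup>2) < e"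
    "(\<lambda>j. LINT z|lebesgue_on U. (1 - (\<rho> z + drho (\<theta> j) z)\<^sup>2)\<^sup>2) \<longlonglongrightarrow> 0"
proof -
  \<comment> \<open>The number \<open>\<delta>\<close> plays two roles: it is the threshold in
    \<open>good\<close>, and it is the budget left for all later changes of the potential. The last
    condition keeps the whole sequence below \<open>\<delta>\<^sub>0\<close>.\<close>
  define P where "P j = (\<lambda>(\<theta>, \<eta>, \<delta>). adm \<theta> \<eta> \<and> \<delta> > 0 \<and> good j \<theta> \<delta> \<and> (\<forall>z. \<bar>\<theta> z\<bar> + \<delta> \<le> \<delta>\<^sub>0))" for j
  define Q where "Q = (\<lambda>(\<theta>, \<eta> :: spacetime \<Rightarrow> real, \<delta>) (\<theta>', \<eta>' :: spacetime \<Rightarrow> real, \<delta>'). (\<forall>z. \<bar>\<theta>' z - \<theta> z\<bar> \<le> \<delta> / 2) \<and> \<delta>' \<le> \<delta> / 2 \<and>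
    (LINT z|lebesgue_on U. (drho \<theta>' z - drho \<theta> z)\<^sup>2) \<ge> gain / 2 * (LINT z|lebesgue_on U. (1 - (\<rho> z + drho \<theta> z)\<^sup>2)\<^sup>2))"
  have "\<exists>f. \<forall>n. P n (f n) \<and> Q (f n) (f (Suc n))"
  proof (rule dependent_nat_choice)
    obtain \<delta> where "\<delta> > 0" "good 0 (\<lambda>_. 0) \<delta>" using good_ex[OF adm_zero] by blast
    then have "P 0 (\<lambda>_. 0, \<lambda>_. 0, min \<delta> \<delta>\<^sub>0)"
      using \<delta>\<^sub>0 adm_zero by (auto simp: P_def intro: good_mono)
    then show "\<exists>x. P 0 x" by blast
  next
    fix x n assume "P n x"
    obtain \<theta> \<eta> \<delta> where x: "x = (\<theta>, \<eta>, \<delta>)" by (cases x)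
    have Pn: "adm \<theta> \<eta>" "\<delta> > 0" "\<And>z. \<bar>\<theta> z\<bar> + \<delta> \<le> \<delta>\<^sub>0" using \<open>P n x\<close> by (auto simp: P_def x)
    obtain \<theta>' \<eta>' where s: "adm \<theta>' \<eta>'" "\<And>z. \<bar>\<theta>' z - \<theta> z\<bar> \<le> \<delta> / 2"
      "(LINT z|lebesgue_on U. (drho \<theta>' z - drho \<theta> z)\<^sup>2) \<ge> gain / 2 * (LINT z|lebesgue_on U. (1 - (\<rho> z + drho \<theta> z)\<^sup>2)\<^sup>2)"
      using adm_stage[OF Pn(1), of "\<delta> / 2"] Pn(2) by auto
    obtain \<delta>' where d: "\<delta>' > 0" "good (Suc n) \<theta>' \<delta>'" using good_ex[OF s(1)] by blast
    have b: "\<bar>\<theta>' z\<bar> + min \<delta>' (\<delta> / 2) \<le> \<delta>\<^sub>0" for z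
      using s(2)[of z] Pn(3)[of z] by linarith
    have "P (Suc n) (\<theta>', \<eta>', min \<delta>' (\<delta> / 2))"
      using s(1) d Pn(2) b by (auto simp: P_def intro: good_mono)
    moreover have "Q x (\<theta>', \<eta>', min \<delta>' (\<delta> / 2))"
      using s by (simp add: Q_def x)
    ultimately show "\<exists>y. P (Suc n) y \<and> Q x y" by blast
  qed
  then obtain f where f: "\<And>n. P n (f n)" "\<And>n. Q (f n) (f (Suc n))" by blast
  define \<theta> \<eta> \<delta> where "\<theta> n = fst (f n)" and "\<eta> n = fst (snd (f n))" and "\<delta> n = snd (snd (f n))" for n
  have P: "adm (\<theta> n) (\<eta> n)" "\<delta> n > 0" "good n (\<theta> n) (\<delta> n)" "\<bar>\<theta> n z\<bar> + \<delta> n \<le> \<delta>\<^sub>0" for n z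
    using f(1)[of n] unfolding P_def \<theta>_def \<eta>_def \<delta>_def case_prod_beta by blast+
  have Q: "\<bar>\<theta> (Suc n) z - \<theta> n z\<bar> \<le> \<delta> n / 2" "\<delta> (Suc n) \<le> \<delta> n / 2"
    "(LINT z|lebesgue_on U. (drho (\<theta> (Suc n)) z - drho (\<theta> n) z)\<^sup>2) \<ge> gain / 2 * (LINT z|lebesgue_on U. (1 - (\<rho> z + drho (\<theta> n) z)\<^sup>2)\<^sup>2)" for n z
    using f(2)[of n] unfolding Q_def \<theta>_def \<delta>_def case_prod_beta by blast+
  \<comment> \<open>A step spends at most half of the current budget and then reduces the budget by
    at least that half, so the drift telescopes.\<close>
  have tel: "\<bar>\<theta> k z - \<theta> j z\<bar> \<le> \<delta> j - \<delta> k" if "j \<le> k" for j k z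
    using that
  proof (induction k rule: dec_induct)
    case (step n)
    then show ?case using Q(1)[of n z] Q(2)[of n] by linarith
  qed simp
  have \<theta>C: "\<theta> n \<in> Cc 3 U" for n using P(1)[of n] by (simp add: adm_def)
  define R where "R n z = \<rho> z + drho (\<theta> n) z" for n z
  have Rc: "continuous_on U (R n)" and Rb: "z \<in> U \<Longrightarrow> \<bar>R n z\<bar> \<le> 1" for n z
    using adm_rho(1)[OF P(1)[of n]] less_imp_le[OF adm_rho(2)[OF P(1)[of n]]] unfolding R_def by blast+
  have iR: "integrable (lebesgue_on U) (\<lambda>z. R n z * R k z)" for n k
    by (rule integrable_cont[of _ 1]) (auto intro!: continuous_intros Rc mult_le_one Rb simp: abs_mult)
  define a where "a n = (LINT z|lebesgue_on U. (R n z)\<^sup>2)" for n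
  define D where "D j k = (LINT z|lebesgue_on U. (drho (\<theta> k) z - drho (\<theta> j) z)\<^sup>2)" for j k
  have D0: "D j k \<ge> 0" for j k unfolding D_def by (rule integral_nonneg_AE) simp
  have Dle: "D j k \<le> a k - a j + 2 * (1/2)^j" if "j \<le> k" for j k
  proof -
    have dd: "drho (\<theta> k) z - drho (\<theta> j) z = drho (\<lambda>z. \<theta> k z - \<theta> j z) z" for z
      by (rule drho_diff[OF \<theta>C \<theta>C, symmetric])
    have "\<bar>LINT z|lebesgue_on U. drho (\<lambda>z. \<theta> k z - \<theta> j z) z * (\<rho> z + drho (\<theta> j) z)\<bar> \<le> (1/2)^j"
    proof (rule P(3)[of j, unfolded good_def, rule_format], intro conjI ballI allI)
      show "(\<lambda>z. \<theta> k z - \<theta> j z) \<in> Cc 3 U" by (intro Cc_diff \<theta>C)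
      show "\<bar>drho (\<lambda>z. \<theta> k z - \<theta> j z) z\<bar> \<le> 2" if "z \<in> U" for z
        using Rb[OF that, of k] Rb[OF that, of j] unfolding dd[symmetric] R_def by linarith
      show "\<bar>\<theta> k z - \<theta> j z\<bar> \<le> \<delta> j" for z
        using tel[OF \<open>j \<le> k\<close>, of z] P(2)[of k] by linarith
    qed
    then have cr: "\<bar>LINT z|lebesgue_on U. (R k z - R j z) * R j z\<bar> \<le> (1/2)^j"
      by (simp add: dd[symmetric] R_def)
    \<comment> \<open>Polarisation at the earlier density: the squared distance is the difference of
      the squared norms minus twice a product that \<open>good\<close> makes small.\<close>
    have "D j k = (LINT z|lebesgue_on U. R k z * R k z - R j z * R j z - 2 * (R k z * R j z - R j z * R j z))"
      unfolding D_def R_def by (intro Bochner_Integration.integral_cong refl) (simp add: power2_eq_square algebra_simps)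
    also have "\<dots> = a k - a j - 2 * ((LINT z|lebesgue_on U. R k z * R j z) - a j)"
      by (simp add: iR a_def power2_eq_square)
    also have "(LINT z|lebesgue_on U. R k z * R j z) - a j = (LINT z|lebesgue_on U. (R k z - R j z) * R j z)"
      by (simp add: iR a_def power2_eq_square left_diff_distrib)
    finally show ?thesis using cr by linarith
  qed
  \<comment> \<open>At step n the squared norm \<open>a\<close> may drop by 2 (1/2)^n. The
    correction 4 (1/2)^n falls by exactly this amount, so \<open>b\<close> is monotone.\<close>
  define b where "b n = a n - 4 * (1/2)^n" for n
  have "incseq b"
  proof (rule incseq_SucI)
    fix n show "b n \<le> b (Suc n)"
      using Dle[of n "Suc n"] D0[of n "Suc n"] by (simp add: b_def)
  qed
  moreover have "b n \<le> measure lebesgue U" for n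
  proof -
    have "a n \<le> (LINT z|lebesgue_on U. 1)"
      unfolding a_def
    proof (rule integral_mono')
      show "integrable (lebesgue_on U) (\<lambda>z. 1::real)" by (rule integrable_cont[of _ 1]) auto
      show "(R n z)\<^sup>2 \<le> 1" if "z \<in> space (lebesgue_on U)" for z
        using Rb[of z n] that by (simp add: abs_square_le_1)
    qed simp
    then have "a n \<le> measure lebesgue U" using U_sets by (simp add: measure_restrict_space)
    then show ?thesis by (simp add: b_def) (smt (verit) zero_le_power zero_le_divide_1_iff)
  qed
  ultimately obtain L where "b \<longlonglongrightarrow> L" using incseq_convergent by blast
  moreover have h: "(\<lambda>n. 4 * (1/2::real)^n) \<longlonglongrightarrow> 0"
    by (intro tendsto_mult_right_zero LIMSEQ_power_zero) simp
  ultimately have "(\<lambda>n. b n + 4 * (1/2)^n) \<longlonglongrightarrow> L + 0" by (intro tendsto_add)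
  then have aL: "a \<longlonglongrightarrow> L" by (simp add: b_def)
  have h2: "(\<lambda>n. 2 * (1/2::real)^n) \<longlonglongrightarrow> 0"
    by (intro tendsto_mult_right_zero LIMSEQ_power_zero) simp
  show ?thesis
  proof (rule that[of \<theta> \<eta>])
    show "adm (\<theta> j) (\<eta> j)" for j by (rule P)
    show "\<bar>\<theta> j z\<bar> \<le> \<delta>\<^sub>0" for j z using P(2)[of j] P(4)[of j z] by linarith
    show "\<exists>N. \<forall>i\<ge>N. \<forall>j\<ge>N. (LINT z|lebesgue_on U. (drho (\<theta> i) z - drho (\<theta> j) z)\<^sup>2) < e" if e: "e > 0" for e
    proof -
      obtain N1 where N1: "\<And>m n. m \<ge> N1 \<Longrightarrow> n \<ge> N1 \<Longrightarrow> \<bar>a m - a n\<bar> < e / 2"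
        using LIMSEQ_imp_Cauchy[OF aL] e unfolding Cauchy_def dist_real_def by (meson half_gt_zero)
      have "\<forall>\<^sub>F n in sequentially. 2 * (1/2::real)^n < e / 2"
        using e by (intro order_tendstoD(2)[OF h2]) simp
      then obtain N2 where N2: "\<And>n. n \<ge> N2 \<Longrightarrow> 2 * (1/2::real)^n < e / 2"
        unfolding eventually_sequentially by blast
      have lt: "D j k < e" if "j \<ge> max N1 N2" "j \<le> k" for j k
      proof -
        have "\<bar>a k - a j\<bar> < e / 2" by (rule N1) (use that in auto)
        moreover have "2 * (1/2::real)^j < e / 2" by (rule N2) (use that in auto)
        ultimately show ?thesis using Dle[OF that(2)] by linarith
      qed
      have sym: "D j k = D k j" for j k unfolding D_def by (simp add: power2_commute)
      have "D j k < e" if "j \<ge> max N1 N2" "k \<ge> max N1 N2" for j k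
        using lt[of j k] lt[of k j] sym[of j k] that by linarith
      then show ?thesis unfolding D_def by blast
    qed
    show "(\<lambda>j. LINT z|lebesgue_on U. (1 - (\<rho> z + drho (\<theta> j) z)\<^sup>2)\<^sup>2) \<longlonglongrightarrow> 0"
    proof (rule tendsto_sandwich)
      show "(\<lambda>_. 0::real) \<longlonglongrightarrow> 0" by simp
      show "\<forall>\<^sub>F n in sequentially. 0 \<le> (LINT z|lebesgue_on U. (1 - (\<rho> z + drho (\<theta> n) z)\<^sup>2)\<^sup>2)"
        by (intro always_eventually allI integral_nonneg_AE) simp
      show "\<forall>\<^sub>F n in sequentially. (LINT z|lebesgue_on U. (1 - (\<rho> z + drho (\<theta> n) z)\<^sup>2)\<^sup>2)
          \<le> (2 / gain) * (a (Suc n) - a n + 2 * (1/2)^n)"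
      proof (intro always_eventually allI)
        fix n
        \<comment> \<open>The defect at stage n is paid for by the squared increment to stage n + 1,
          and that tends to zero because \<open>a\<close> converges.\<close>
        have "gain / 2 * (LINT z|lebesgue_on U. (1 - (\<rho> z + drho (\<theta> n) z)\<^sup>2)\<^sup>2) \<le> a (Suc n) - a n + 2 * (1/2)^n"
          using Q(3)[of n] Dle[of n "Suc n"] unfolding D_def by simp
        from mult_left_mono[OF this, of "2 / gain"] show "(LINT z|lebesgue_on U. (1 - (\<rho> z + drho (\<theta> n) z)\<^sup>2)\<^sup>2)
          \<le> (2 / gain) * (a (Suc n) - a n + 2 * (1/2)^n)"
          using gain_pos by simp
      qed
      have "(\<lambda>n. (2 / gain) * (a (Suc n) - a n + 2 * (1/2)^n)) \<longlonglongrightarrow> (2 / gain) * (L - L + 0)"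
        by (intro tendsto_intros LIMSEQ_Suc[OF aL] aL h2)
      then show "(\<lambda>n. (2 / gain) * (a (Suc n) - a n + 2 * (1/2)^n)) \<longlonglongrightarrow> 0" by simp
    qed
  qed
qed

end

section \<open>Fubini on slices and the strong limit\<close>

text \<open>Fatou's lemma with integrability of the limit as a conclusion and a bound needed only
  eventually. It serves the L^1 limit of the iterates, the defect, and the velocities on time
  slices.\<close>

lemma fatou_bound:
  fixes f :: "nat \<Rightarrow> 'a \<Rightarrow> real"
  assumes f: "\<And>k. integrable M (f k)" and f0: "\<And>k x. 0 \<le> f k x"
    and g [measurable]: "g \<in> borel_measurable M" and lim: "AE x in M. (\<lambda>k. f k x) \<longlonglongrightarrow> g x"
    and C: "\<forall>\<^sub>F k in sequentially. integral\<^sup>L M (f k) \<le> C"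
  shows "integrable M g" "integral\<^sup>L M g \<le> C"
proof -
  have [measurable]: "f k \<in> borel_measurable M" for k using f by (rule borel_measurable_integrable)
  have g0: "AE x in M. 0 \<le> g x"
    using lim by eventually_elim (rule LIMSEQ_le_const, use f0 in auto)
  obtain k where "integral\<^sup>L M (f k) \<le> C" using eventually_happens'[OF sequentially_bot C] by blast
  moreover have "0 \<le> integral\<^sup>L M (f k)" by (rule integral_nonneg_AE) (simp add: f0)
  ultimately have C0: "0 \<le> C" by linarith
  have "(\<integral>\<^sup>+x. ennreal (g x) \<partial>M) = (\<integral>\<^sup>+x. liminf (\<lambda>k. ennreal (f k x)) \<partial>M)"
  proof (rule nn_integral_cong_AE)
    show "AE x in M. ennreal (g x) = liminf (\<lambda>k. ennreal (f k x))"
      using lim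
    proof eventually_elim
      case (elim x)
      then show ?case using lim_imp_Liminf[OF sequentially_bot tendsto_ennrealI[OF elim]] by simp
    qed
  qed
  also have "\<dots> \<le> liminf (\<lambda>k. \<integral>\<^sup>+x. ennreal (f k x) \<partial>M)"
    by (rule nn_integral_liminf) measurable
  also have "\<dots> \<le> liminf (\<lambda>k. ennreal C)"
  proof (rule Liminf_mono)
    show "\<forall>\<^sub>F k in sequentially. (\<integral>\<^sup>+x. ennreal (f k x) \<partial>M) \<le> ennreal C"
      using C
    proof eventually_elim
      case (elim k)
      then show ?case using nn_integral_eq_integral[OF f, of k] f0 by (simp add: ennreal_leI)
    qed
  qed
  also have "\<dots> = ennreal C" by (simp add: Liminf_const)
  finally have le: "(\<integral>\<^sup>+x. ennreal (g x) \<partial>M) \<le> ennreal C" .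
  show i: "integrable M g"
  proof (rule integrableI_nonneg[OF g g0])
    show "(\<integral>\<^sup>+x. ennreal (g x) \<partial>M) < \<infinity>" using le by (simp add: order_le_less_trans)
  qed
  have "ennreal (integral\<^sup>L M g) \<le> ennreal C" using nn_integral_eq_integral[OF i g0] le by simp
  then show "integral\<^sup>L M g \<le> C" using C0 by simp
qed

section \<open>Slices of Lebesgue measurable functions\<close>

lemma AE_lebesgue_on_iff:
  fixes S :: "'a::euclidean_space set"
  assumes "S \<in> sets lebesgue"
  shows "(AE x in lebesgue_on S. P x) \<longleftrightarrow> (AE x in lborel. x \<in> S \<longrightarrow> P x)"
  using assms by (simp add: AE_restrict_space_iff AE_completion_iff)

text \<open>The exceptional set itself may fail to be Borel. It is enclosed in a Borel null set,
  whose sections are measurable and null for almost every \<open>t\<close>.\<close>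

lemma AE_slices:
  fixes P :: "'a::euclidean_space \<times> 'b::euclidean_space \<Rightarrow> bool"
  assumes "AE z in lborel. P z"
  shows "AE t in lborel. AE x in lborel. P (x, t)"
proof -
  from assms obtain N where N: "N \<in> null_sets lborel" "{z \<in> space lborel. \<not> P z} \<subseteq> N"
    unfolding eventually_ae_filter by auto
  have "AE z in (lborel \<Otimes>\<^sub>M lborel). z \<notin> N"
    unfolding lborel_prod using N(1) by (rule AE_not_in)
  then have 1: "AE x in lborel. AE t in lborel. (x, t) \<notin> N"
    by (rule lborel_pair.AE_pair)
  have m: "{z \<in> space (lborel \<Otimes>\<^sub>M lborel). (fst z, snd z) \<notin> N} \<in> sets (lborel \<Otimes>\<^sub>M lborel)"
  proof -
    have "{z \<in> space (lborel \<Otimes>\<^sub>M lborel). (fst z, snd z) \<notin> N} = space (lborel \<Otimes>\<^sub>M lborel) - N" by auto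
    then show ?thesis using N(1) unfolding lborel_prod by (auto simp: null_sets_def)
  qed
  have "AE t in lborel. AE x in lborel. (x, t) \<notin> N"
    using lborel_pair.AE_commute[OF m] 1 by simp
  then show ?thesis
  proof (eventually_elim)
    case (elim t)
    then show ?case by eventually_elim (use N(2) in auto)
  qed
qed

lemma
  fixes f :: "'a::euclidean_space \<times> 'b::euclidean_space \<Rightarrow> 'c::euclidean_space"
  assumes f: "integrable lborel f"
  shows AE_integrable_slices: "AE t in lborel. integrable lborel (\<lambda>x. f (x, t))"
    and integrable_integral_slices: "integrable lborel (\<lambda>t. LINT x|lborel. f (x, t))"
    and integral_integral_slices: "(LINT t|lborel. LINT x|lborel. f (x, t)) = (LINT z|lborel. f z)"
proof -
  have i: "integrable (lborel \<Otimes>\<^sub>M lborel) (case_prod (\<lambda>x t. f (x, t)))"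
    using f by (simp add: lborel_prod)
  show "AE t in lborel. integrable lborel (\<lambda>x. f (x, t))" by (rule lborel_pair.AE_integrable_snd[OF i])
  show "integrable lborel (\<lambda>t. LINT x|lborel. f (x, t))" by (rule lborel_pair.integrable_snd[OF i])
  show "(LINT t|lborel. LINT x|lborel. f (x, t)) = (LINT z|lborel. f z)"
    using lborel_pair.integral_snd[OF i] by (simp add: lborel_prod)
qed

text \<open>A section of a Lebesgue measurable function may fail to be measurable for exceptional
  parameters. Fubini is therefore applied to a Borel representative, all of whose sections are
  Borel.\<close>

lemma lebesgue_on_borel_version:
  fixes f :: "'a::euclidean_space \<Rightarrow> real"
  assumes S: "S \<in> sets lebesgue" and f: "f \<in> borel_measurable (lebesgue_on S)"
  shows "\<exists>g\<in>borel_measurable borel. AE x in lborel. x \<in> S \<longrightarrow> f x = g x"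
proof -
  have "(\<lambda>x. indicator S x *\<^sub>R f x) \<in> borel_measurable lebesgue"
    using f S borel_measurable_restrict_space_iff[of S lebesgue f] by auto
  from completion_ex_borel_measurable_real[OF this] obtain g where
    g: "g \<in> borel_measurable borel" "AE x in lborel. indicator S x *\<^sub>R f x = g x" by auto
  then show ?thesis
    by (intro bexI[of _ g]) (auto elim!: eventually_mono)
qed

lemma borel_measurable_lebesgue_onI:
  fixes f g :: "'a::euclidean_space \<Rightarrow> 'b::euclidean_space"
  assumes S: "S \<in> sets lebesgue" and g: "g \<in> borel_measurable borel" and ae: "AE x in lborel. x \<in> S \<longrightarrow> f x = g x"
  shows "f \<in> borel_measurable (lebesgue_on S)"
proof -
  have g': "(\<lambda>x. if x \<in> S then g x else 0) \<in> borel_measurable lebesgue"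
    using S g by (intro measurable_If_set) (auto simp: measurable_completion)
  have "(\<lambda>x. if x \<in> S then f x else 0) \<in> borel_measurable lebesgue"
  proof (rule borel_measurable_AE[OF g'])
    show "AE x in lebesgue. (if x \<in> S then g x else 0) = (if x \<in> S then f x else 0)"
      unfolding AE_completion_iff using ae by eventually_elim auto
  qed
  also have "(\<lambda>x. if x \<in> S then f x else 0) = (\<lambda>x. indicator S x *\<^sub>R f x)"
    by (auto simp: indicator_def fun_eq_iff)
  finally show ?thesis
    using S borel_measurable_restrict_space_iff[of S lebesgue f] by auto
qed

lemma Times_sets_lebesgue_slice:
  assumes "open (\<Omega> :: 'a::euclidean_space set)" "open (I :: 'b::euclidean_space set)"
  shows "\<Omega> \<times> I \<in> sets lebesgue" "\<Omega> \<in> sets lebesgue" "I \<in> sets lebesgue"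
  using borel_open[OF open_Times[OF assms]] assms by (auto intro: sets_completionI_sets)

lemma slice_measurable_real:
  fixes f :: "'a::euclidean_space \<times> 'b::euclidean_space \<Rightarrow> real"
  assumes o: "open \<Omega>" "open I" and f: "f \<in> borel_measurable (lebesgue_on (\<Omega> \<times> I))"
  shows "AE t in lebesgue_on I. (\<lambda>x. f (x, t)) \<in> borel_measurable (lebesgue_on \<Omega>)"
proof -
  note S = Times_sets_lebesgue_slice[OF o]
  obtain g where g [measurable]: "g \<in> borel_measurable borel" and ae: "AE z in lborel. z \<in> \<Omega> \<times> I \<longrightarrow> f z = g z"
    using lebesgue_on_borel_version[OF S(1) f] by blast
  have gs: "(\<lambda>x. g (x, t)) \<in> borel_measurable borel" for t
    by (rule measurable_compose[OF _ g]) (auto intro: borel_measurable_continuous_onI continuous_intros)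
  show ?thesis
    unfolding AE_lebesgue_on_iff[OF S(3)] using AE_slices[OF ae]
  proof eventually_elim
    case (elim t)
    show ?case
    proof
      assume "t \<in> I"
      then have "AE x in lborel. x \<in> \<Omega> \<longrightarrow> f (x, t) = g (x, t)"
        using elim by (auto elim: eventually_mono)
      then show "(\<lambda>x. f (x, t)) \<in> borel_measurable (lebesgue_on \<Omega>)"
        by (rule borel_measurable_lebesgue_onI[OF S(2) gs])
    qed
  qed
qed

lemma slice_measurable_R2:
  fixes f :: "'a::euclidean_space \<times> 'b::euclidean_space \<Rightarrow> R2"
  assumes o: "open \<Omega>" "open I" and f: "f \<in> borel_measurable (lebesgue_on (\<Omega> \<times> I))"
  shows "AE t in lebesgue_on I. (\<lambda>x. f (x, t)) \<in> borel_measurable (lebesgue_on \<Omega>)"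
proof -
  have "(\<lambda>z. fst (f z)) \<in> borel_measurable (lebesgue_on (\<Omega> \<times> I))" "(\<lambda>z. snd (f z)) \<in> borel_measurable (lebesgue_on (\<Omega> \<times> I))"
    by (rule borel_measurable_continuous_on[OF _ f], intro continuous_intros)+
  from slice_measurable_real[OF o this(1)] slice_measurable_real[OF o this(2)]
  show ?thesis
  proof eventually_elim
    case (elim t)
    then have "(\<lambda>x. (fst (f (x, t)), snd (f (x, t)))) \<in> borel_measurable (lebesgue_on \<Omega>)"
      by (rule borel_measurable_Pair)
    then show ?case by simp
  qed
qed

lemma slice_AE:
  fixes P :: "'a::euclidean_space \<times> 'b::euclidean_space \<Rightarrow> bool"
  assumes o: "open \<Omega>" "open I" and P: "AE z in lebesgue_on (\<Omega> \<times> I). P z"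
  shows "AE t in lebesgue_on I. AE x in lebesgue_on \<Omega>. P (x, t)"
proof -
  note S = Times_sets_lebesgue_slice[OF o]
  have "AE z in lborel. z \<in> \<Omega> \<times> I \<longrightarrow> P z" using P unfolding AE_lebesgue_on_iff[OF S(1)] .
  from AE_slices[OF this] show ?thesis
    unfolding AE_lebesgue_on_iff[OF S(2)] AE_lebesgue_on_iff[OF S(3)]
    by eventually_elim (auto elim: eventually_mono)
qed

text \<open>Turns condition (ii), which is stated on time slices, into the space-time form of the
  divergence constraint. On almost every slice \<open>f\<close> agrees with its Borel
  representative, and there the two integrals are compared.\<close>

lemma slice_integral_zero:
  fixes f :: "'a::euclidean_space \<times> 'b::euclidean_space \<Rightarrow> real"
  assumes o: "open \<Omega>" "open I" and f: "integrable (lebesgue_on (\<Omega> \<times> I)) f"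
    and z: "AE t in lebesgue_on I. (LINT x|lebesgue_on \<Omega>. f (x, t)) = 0"
  shows "(LINT z|lebesgue_on (\<Omega> \<times> I). f z) = 0"
proof -
  note S = Times_sets_lebesgue_slice[OF o]
  obtain g where g [measurable]: "g \<in> borel_measurable borel" and ae: "AE z in lborel. z \<in> \<Omega> \<times> I \<longrightarrow> f z = g z"
    using lebesgue_on_borel_version[OF S(1) borel_measurable_integrable[OF f]] by blast
  define h where "h z = indicator (\<Omega> \<times> I) z * g z" for z
  have OI: "\<Omega> \<times> I \<in> sets borel" using o by (simp add: open_Times)
  have h [measurable]: "h \<in> borel_measurable borel" using OI unfolding h_def[abs_def] by measurable
  have gs: "(\<lambda>x. g (x, t)) \<in> borel_measurable borel" for t
    by (rule measurable_compose[OF _ g]) (auto intro: borel_measurable_continuous_onI continuous_intros)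
  have "integrable lebesgue (\<lambda>z. indicator (\<Omega> \<times> I) z *\<^sub>R f z)"
    using f S(1) by (simp add: integrable_restrict_space)
  note i = this
  have aeh: "AE z in lebesgue. indicator (\<Omega> \<times> I) z *\<^sub>R f z = h z"
    unfolding AE_completion_iff using ae by eventually_elim (auto simp: h_def indicator_def)
  have "h \<in> borel_measurable lebesgue" using h by (intro measurable_completion) simp
  then have "integrable lebesgue h"
    by (rule integrable_cong_AE_imp[OF i _ aeh])
  then have ih: "integrable lborel h" using integrable_completion[of h lborel] by simp
  have "(LINT z|lebesgue_on (\<Omega> \<times> I). f z) = (LINT z|lebesgue. indicator (\<Omega> \<times> I) z *\<^sub>R f z)"
    using S(1) by (simp add: integral_restrict_space)
  also have "\<dots> = (LINT z|lebesgue. h z)"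
    by (rule integral_cong_AE) (use aeh borel_measurable_integrable[OF i]
         measurable_completion[of h lborel borel] in auto)
  also have "\<dots> = (LINT z|lborel. h z)" using integral_completion[of h lborel] by simp
  also have "\<dots> = (LINT t|lborel. LINT x|lborel. h (x, t))" by (rule integral_integral_slices[OF ih, symmetric])
  also have "\<dots> = (LINT (t::'b)|lborel. 0)"
  proof (rule integral_cong_AE)
    show "(\<lambda>t. LINT x|lborel. h (x, t)) \<in> borel_measurable lborel"
      using integrable_integral_slices[OF ih] by (rule borel_measurable_integrable)
    have "AE t in lborel. t \<in> I \<longrightarrow> (LINT x|lebesgue_on \<Omega>. f (x, t)) = 0"
      using z unfolding AE_lebesgue_on_iff[OF S(3)] .
    with AE_slices[OF ae] show "AE t in lborel. (LINT x|lborel. h (x, t)) = 0"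
    proof eventually_elim
      case (elim t)
      show ?case
      proof (cases "t \<in> I")
        case True
        have e: "AE x in lborel. x \<in> \<Omega> \<longrightarrow> f (x, t) = g (x, t)" using elim(1) True by (auto elim: eventually_mono)
        have fm: "(\<lambda>x. f (x, t)) \<in> borel_measurable (lebesgue_on \<Omega>)"
          by (rule borel_measurable_lebesgue_onI[OF S(2) gs e])
        have gm: "(\<lambda>x. g (x, t)) \<in> borel_measurable (lebesgue_on \<Omega>)"
          by (rule borel_measurable_lebesgue_onI[OF S(2) gs[of t]]) simp
        have hs: "(\<lambda>x. indicator \<Omega> x *\<^sub>R g (x, t)) \<in> borel_measurable borel"
          using gs o(1) by (intro borel_measurable_scaleR borel_measurable_indicator) auto
        have "(LINT x|lborel. h (x, t)) = (LINT x|lborel. indicator \<Omega> x *\<^sub>R g (x, t))"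
          using True by (simp add: h_def indicator_times)
        also have "\<dots> = (LINT x|lebesgue. indicator \<Omega> x *\<^sub>R g (x, t))"
          by (rule integral_lebesgue_lborel[OF hs, symmetric])
        also have "\<dots> = (LINT x|lebesgue_on \<Omega>. g (x, t))"
          using S(2) by (simp add: integral_restrict_space)
        also have "\<dots> = (LINT x|lebesgue_on \<Omega>. f (x, t))"
          by (rule integral_cong_AE[OF gm fm]) (use e in \<open>auto simp: AE_lebesgue_on_iff[OF S(2)] elim: eventually_mono\<close>)
        finally show ?thesis using elim(2) True by simp
      next
        case False
        then show ?thesis by (simp add: h_def indicator_times)
      qed
    qed
  qed simp
  finally show ?thesis by simp
qed

lemma norm_Pair_square: "(norm (a, b))\<^sup>2 = (norm a)\<^sup>2 + (norm b)\<^sup>2"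
  by (simp add: norm_prod_def)

context strict_state
begin

text \<open>Density and velocity are treated as one vector-valued function, so that a single
  subsequence serves both. The momenta are left out: no convergence of them is available or
  required.\<close>

lemma limit:
  assumes \<delta>\<^sub>0: "\<delta>\<^sub>0 > 0"
  obtains \<theta> \<eta> :: "nat \<Rightarrow> spacetime \<Rightarrow> real" and A :: "spacetime \<Rightarrow> real" and B :: "spacetime \<Rightarrow> R2" where
    "\<And>j. adm (\<theta> j) (\<eta> j)" "\<And>j z. \<bar>\<theta> j z\<bar> \<le> \<delta>\<^sub>0"
    "(\<lambda>j. LINT z|lebesgue_on U. (1 - (\<rho> z + drho (\<theta> j) z)\<^sup>2)\<^sup>2) \<longlonglongrightarrow> 0"
    "integrable lborel (\<lambda>z. (A z, B z))" "\<And>z. z \<notin> U \<Longrightarrow> A z = 0" "\<And>z. z \<notin> U \<Longrightarrow> B z = 0"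
    "\<And>j. integrable lborel (\<lambda>z. (drho (\<theta> j) z, dvel (\<theta> j) z))"
    "AE z in lborel. (\<lambda>j. (drho (\<theta> j) z, dvel (\<theta> j) z)) \<longlonglongrightarrow> (A z, B z)"
    "(\<lambda>j. LINT z|lborel. norm ((drho (\<theta> j) z, dvel (\<theta> j) z) - (A z, B z))) \<longlonglongrightarrow> 0"
proof -
  obtain \<theta> \<eta> :: "nat \<Rightarrow> spacetime \<Rightarrow> real" where ad: "\<And>j. adm (\<theta> j) (\<eta> j)" and small: "\<And>j z. \<bar>\<theta> j z\<bar> \<le> \<delta>\<^sub>0"
    and cau: "\<And>e. e > 0 \<Longrightarrow> \<exists>N. \<forall>i\<ge>N. \<forall>j\<ge>N. (LINT z|lebesgue_on U. (drho (\<theta> i) z - drho (\<theta> j) z)\<^sup>2) < e"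
    and def: "(\<lambda>j. LINT z|lebesgue_on U. (1 - (\<rho> z + drho (\<theta> j) z)\<^sup>2)\<^sup>2) \<longlonglongrightarrow> 0"
    using iteration[OF \<delta>\<^sub>0] by blast
  have \<theta>C: "\<theta> j \<in> Cc 3 U" for j using ad[of j] by (simp add: adm_def)
  define F where "F j z = (drho (\<theta> j) z, dvel (\<theta> j) z)" for j z
  have Fout: "F j z = 0" if "z \<notin> U" for j z
    using drho_outside[OF \<theta>C that] dvel_outside[OF \<theta>C that] by (simp add: F_def zero_prod_def)
  have c2: "pd a (pd b \<zeta>) \<in> Cc 1 U" if "\<zeta> \<in> Cc 3 U" "a \<in> Basis" "b \<in> Basis" for a b \<zeta>
    using Cc_pd_numeral(2)[OF that(2) Cc_pd_numeral(1)[OF that(3,1)]] .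
  have mR: "(\<lambda>z. (drho \<zeta> z, dvel \<zeta> z)) \<in> borel_measurable borel" if "\<zeta> \<in> Cc 3 U" for \<zeta>
    by (intro borel_measurable_continuous_onI continuous_on_Pair continuous_on_perturbation[OF that that])
  have Fm [measurable]: "F j \<in> borel_measurable borel" for j
    unfolding F_def[abs_def] by (rule mR[OF \<theta>C])
  have Fi: "integrable lborel (F j)" for j
  proof (rule Bochner_Integration.integrable_bound)
    show "integrable lborel (\<lambda>z. \<bar>drho (\<theta> j) z\<bar> + (\<bar>pd e\<^sub>2 (pd e\<^sub>1 (\<theta> j)) z\<bar> + \<bar>pd e\<^sub>1 (pd e\<^sub>1 (\<theta> j)) z\<bar>) + (\<bar>0\<bar> + \<bar>0\<bar>) :: real)"
      by (intro Bochner_Integration.integrable_add integrable_abs Cc_integrable[OF drho_Cc[OF \<theta>C]] Cc_integrable[OF c2[OF \<theta>C]]) auto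
    show "AE z in lborel. norm (F j z) \<le> norm (\<bar>drho (\<theta> j) z\<bar> + (\<bar>pd e\<^sub>2 (pd e\<^sub>1 (\<theta> j)) z\<bar> + \<bar>pd e\<^sub>1 (pd e\<^sub>1 (\<theta> j)) z\<bar>) + (\<bar>0\<bar> + \<bar>0\<bar>) :: real)"
    proof (rule AE_I2)
      fix z
      show "norm (F j z) \<le> norm (\<bar>drho (\<theta> j) z\<bar> + (\<bar>pd e\<^sub>2 (pd e\<^sub>1 (\<theta> j)) z\<bar> + \<bar>pd e\<^sub>1 (pd e\<^sub>1 (\<theta> j)) z\<bar>) + (\<bar>0\<bar> + \<bar>0\<bar>) :: real)"
        using norm_triple_le[of "drho (\<theta> j) z" "dvel (\<theta> j) z" 0]
        by (simp add: F_def dvel_def norm_prod_def zero_prod_def)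
    qed
  qed measurable
  define \<mu> where "\<mu> = measure lborel U"
  have Ufin: "emeasure lborel U < \<infinity>" using emeasure_bounded_finite[OF U(2)] .
  have iU: "integrable lborel (indicator U :: _ \<Rightarrow> real)"
    using Ufin U(1) by (intro integrable_real_indicator) auto
  have \<mu>0: "\<mu> \<ge> 0" by (simp add: \<mu>_def)
  \<comment> \<open>Young's inequality y \<le> \<kappa> + y^2/\<kappa> on the bounded set
    \<open>U\<close> replaces the Cauchy-Schwarz inequality. The factor 2 counts the density and the
    velocity, the latter estimated by the former.\<close>
  have L1: "(LINT z|lborel. norm (F i z - F j z)) \<le> \<kappa> * \<mu> + (2 / \<kappa>) * (LINT z|lebesgue_on U. (drho (\<theta> i) z - drho (\<theta> j) z)\<^sup>2)"
    if \<kappa>: "\<kappa> > 0" for i j \<kappa>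
  proof -
    define d where "d = (\<lambda>z. \<theta> i z - \<theta> j z)"
    have dC: "d \<in> Cc 3 U" unfolding d_def by (intro Cc_diff \<theta>C)
    have Fd: "F i z - F j z = (drho d z, dvel d z)" for z
      unfolding F_def d_def by (simp add: drho_diff[OF \<theta>C \<theta>C] dvel_diff[OF \<theta>C \<theta>C])
    have i1: "integrable lborel (\<lambda>z. (drho d z)\<^sup>2)"
      unfolding power2_eq_square by (rule Cc_Ck_mult_integrable[OF drho_Cc[OF dC] CcD[OF drho_Cc[OF dC]]])
    have i2: "integrable lborel (\<lambda>z. (norm (dvel d z))\<^sup>2)"
    proof -
      have sq: "integrable lborel (\<lambda>z. (pd a (pd b d) z)\<^sup>2)" if "a \<in> Basis" "b \<in> Basis" for a b
        unfolding power2_eq_square by (rule Cc_Ck_mult_integrable[OF c2[OF dC that] CcD[OF c2[OF dC that]]])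
      have "(norm (dvel d z))\<^sup>2 = (pd e\<^sub>2 (pd e\<^sub>1 d) z)\<^sup>2 + (pd e\<^sub>1 (pd e\<^sub>1 d) z)\<^sup>2" for z
        by (simp add: dvel_def norm_prod_def)
      then show ?thesis by (simp add: sq)
    qed
    have ii: "integrable lborel (\<lambda>z. \<kappa> * indicator U z + (1 / \<kappa>) * ((drho d z)\<^sup>2 + (norm (dvel d z))\<^sup>2))"
      by (intro Bochner_Integration.integrable_add integrable_mult_right iU i1 i2)
    have "(LINT z|lborel. norm (F i z - F j z)) \<le> (LINT z|lborel. \<kappa> * indicator U z + (1 / \<kappa>) * ((drho d z)\<^sup>2 + (norm (dvel d z))\<^sup>2))"
    proof (rule integral_mono'[OF ii])
      fix z
      define y where "y = norm (F i z - F j z)"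
      have y2: "y\<^sup>2 = (drho d z)\<^sup>2 + (norm (dvel d z))\<^sup>2"
        unfolding y_def Fd norm_Pair_square by simp
      have "y \<le> \<kappa> * indicator U z + (1 / \<kappa>) * y\<^sup>2"
      proof (cases "z \<in> U")
        case True
        have "2 * (\<kappa> * y) \<le> \<kappa>\<^sup>2 + y\<^sup>2" using sum_squares_bound[of \<kappa> y] by (simp add: mult.assoc)
        moreover have "\<kappa> * y \<ge> 0" using \<kappa> by (simp add: y_def)
        ultimately have "\<kappa> * y \<le> \<kappa>\<^sup>2 + y\<^sup>2" by linarith
        then have "y \<le> (\<kappa>\<^sup>2 + y\<^sup>2) / \<kappa>" using \<kappa> by (simp add: pos_le_divide_eq mult.commute)
        also have "\<dots> = \<kappa> + (1 / \<kappa>) * y\<^sup>2" using \<kappa> by (simp add: add_divide_distrib power2_eq_square)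
        finally show ?thesis using True by simp
      next
        case False
        then show ?thesis using \<kappa> by (simp add: y_def Fout)
      qed
      then show "norm (F i z - F j z) \<le> \<kappa> * indicator U z + (1 / \<kappa>) * ((drho d z)\<^sup>2 + (norm (dvel d z))\<^sup>2)"
        unfolding y2 unfolding y_def .
      show "0 \<le> \<kappa> * indicator U z + (1 / \<kappa>) * ((drho d z)\<^sup>2 + (norm (dvel d z))\<^sup>2)"
        using \<kappa> by (intro add_nonneg_nonneg mult_nonneg_nonneg) auto
    qed
    also have "\<dots> = \<kappa> * \<mu> + (1 / \<kappa>) * ((LINT z|lborel. (drho d z)\<^sup>2) + (LINT z|lborel. (norm (dvel d z))\<^sup>2))"
      using iU i1 i2 by (simp add: \<mu>_def)
    also have "\<dots> \<le> \<kappa> * \<mu> + (1 / \<kappa>) * (2 * (LINT z|lborel. (drho d z)\<^sup>2))"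
      using integral_dvel_le[OF dC] \<kappa> by (intro add_left_mono mult_left_mono) auto
    also have "(LINT z|lborel. (drho d z)\<^sup>2) = (LINT z|lebesgue_on U. (drho d z)\<^sup>2)"
      by (rule integral_lebesgue_on_supported[symmetric])
        (use U_sets drho_outside[OF dC] Ck_borel_measurable[OF CcD[OF drho_Cc[OF dC]]] in auto)
    finally show ?thesis unfolding d_def drho_diff[OF \<theta>C \<theta>C] by simp
  qed
  have cauF: "\<exists>N. \<forall>i\<ge>N. \<forall>j\<ge>N. (LINT z|lborel. norm (F i z - F j z)) < e" if e: "e > 0" for e
  proof -
    define \<kappa> where "\<kappa> = e / (2 * (\<mu> + 1))"
    have \<kappa>: "\<kappa> > 0" using e \<mu>0 by (simp add: \<kappa>_def)
    have k1: "\<kappa> * \<mu> \<le> e / 2"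
    proof -
      have "\<kappa> * \<mu> \<le> \<kappa> * (\<mu> + 1)" using \<kappa> by simp
      also have "\<dots> = e / 2"
      proof -
        have "e / (2 * X) * X = e / 2" if "X > 0" for X :: real using that by simp
        from this[of "\<mu> + 1"] show ?thesis using \<mu>0 by (simp only: \<kappa>_def)
      qed
      finally show ?thesis .
    qed
    have "\<kappa> * e / 4 > 0" using \<kappa> e by simp
    from cau[OF this] obtain N where N: "\<And>i j. i \<ge> N \<Longrightarrow> j \<ge> N \<Longrightarrow>
      (LINT z|lebesgue_on U. (drho (\<theta> i) z - drho (\<theta> j) z)\<^sup>2) < \<kappa> * e / 4" by blast
    have "(LINT z|lborel. norm (F i z - F j z)) < e" if "i \<ge> N" "j \<ge> N" for i j
    proof -
      have "(2 / \<kappa>) * (LINT z|lebesgue_on U. (drho (\<theta> i) z - drho (\<theta> j) z)\<^sup>2) < (2 / \<kappa>) * (\<kappa> * e / 4)"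
        using N[OF that] \<kappa> by (intro mult_strict_left_mono) auto
      also have "\<dots> = e / 2" using \<kappa> by simp
      finally show ?thesis using L1[OF \<kappa>, of i j] k1 by linarith
    qed
    then show ?thesis by blast
  qed
  obtain r where r: "strict_mono r" "AE z in lborel. Cauchy (\<lambda>j. F (r j) z)"
    using cauchy_L1_AE_cauchy_subseq[of lborel F, OF Fi cauF] by blast
  have rge: "r j \<ge> j" for j using seq_suble[OF r(1)] .
  \<comment> \<open>Where the subsequence diverges, \<open>lim\<close> has an arbitrary value, but
    this is a null set. Off \<open>U\<close> every term is 0, so \<open>G\<close> vanishes there
    without exception.\<close>
  define G where "G z = lim (\<lambda>j. F (r j) z)" for z
  have Gm [measurable]: "G \<in> borel_measurable borel" unfolding G_def[abs_def] by measurable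
  have Gl: "AE z in lborel. (\<lambda>j. F (r j) z) \<longlonglongrightarrow> G z"
    using r(2) by eventually_elim (simp add: G_def Cauchy_convergent_iff convergent_LIMSEQ_iff)
  have Gout: "G z = 0" if "z \<notin> U" for z
    unfolding G_def using Fout[OF that] by (simp add: limI)
  \<comment> \<open>Fatou in the second index turns the Cauchy estimate into an estimate of the
    distance to the limit.\<close>
  have Gd: "integrable lborel (\<lambda>z. norm (F (r i) z - G z)) \<and> (LINT z|lborel. norm (F (r i) z - G z)) \<le> e"
    if N: "\<And>i j. i \<ge> N \<Longrightarrow> j \<ge> N \<Longrightarrow> (LINT z|lborel. norm (F i z - F j z)) < e" and "i \<ge> N" for N i e
  proof -
    have "AE z in lborel. (\<lambda>k. norm (F (r i) z - F (r k) z)) \<longlonglongrightarrow> norm (F (r i) z - G z)"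
      using Gl by eventually_elim (intro tendsto_intros)
    moreover have "\<forall>\<^sub>F k in sequentially. (LINT z|lborel. norm (F (r i) z - F (r k) z)) \<le> e"
      using eventually_ge_at_top[of N]
    proof eventually_elim
      case (elim k)
      show ?case
        by (rule less_imp_le, rule N) (use rge[of k] rge[of i] elim that(2) in linarith)+
    qed
    moreover have "integrable lborel (\<lambda>z. norm (F (r i) z - F (r k) z))" for k
      by (intro integrable_norm Bochner_Integration.integrable_diff Fi)
    ultimately show ?thesis
      using fatou_bound[of lborel "\<lambda>k z. norm (F (r i) z - F (r k) z)" "\<lambda>z. norm (F (r i) z - G z)" e] by auto
  qed
  have Gi: "integrable lborel G"
  proof -
    obtain N where "\<And>i j. i \<ge> N \<Longrightarrow> j \<ge> N \<Longrightarrow> (LINT z|lborel. norm (F i z - F j z)) < 1"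
      using cauF[OF zero_less_one] by blast
    then have "integrable lborel (\<lambda>z. norm (F (r N) z - G z))" using Gd by blast
    then have "integrable lborel (\<lambda>z. F (r N) z - G z)"
      by (rule integrable_norm_cancel) measurable
    from Bochner_Integration.integrable_diff[OF Fi this, of "r N"] show ?thesis by simp
  qed
  have GL: "(\<lambda>i. LINT z|lborel. norm (F (r i) z - G z)) \<longlonglongrightarrow> 0"
  proof (rule LIMSEQ_I)
    fix e :: real assume e: "0 < e"
    obtain N where N: "\<And>i j. i \<ge> N \<Longrightarrow> j \<ge> N \<Longrightarrow> (LINT z|lborel. norm (F i z - F j z)) < e / 2"
      using cauF[OF half_gt_zero[OF e]] by blast
    have "norm ((LINT z|lborel. norm (F (r i) z - G z)) - 0) < e" if "i \<ge> N" for i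
    proof -
      have "(LINT z|lborel. norm (F (r i) z - G z)) \<le> e / 2" using Gd[OF N that] by blast
      moreover have "0 \<le> (LINT z|lborel. norm (F (r i) z - G z))" by (rule integral_nonneg_AE) simp
      ultimately show ?thesis using e by simp
    qed
    then show "\<exists>N. \<forall>i\<ge>N. norm ((LINT z|lborel. norm (F (r i) z - G z)) - 0) < e" by blast
  qed
  show ?thesis
  proof (rule that[of "\<lambda>j. \<theta> (r j)" "\<lambda>j. \<eta> (r j)" "\<lambda>z. fst (G z)" "\<lambda>z. snd (G z)"])
    show "(\<lambda>j. LINT z|lebesgue_on U. (1 - (\<rho> z + drho (\<theta> (r j)) z)\<^sup>2)\<^sup>2) \<longlonglongrightarrow> 0"
      using LIMSEQ_subseq_LIMSEQ[OF def r(1)] by (simp add: o_def)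
    show "integrable lborel (\<lambda>z. (fst (G z), snd (G z)))" using Gi by simp
    show "integrable lborel (\<lambda>z. (drho (\<theta> (r j)) z, dvel (\<theta> (r j)) z))" for j
      using Fi[of "r j"] unfolding F_def[abs_def] .
    show "AE z in lborel. (\<lambda>j. (drho (\<theta> (r j)) z, dvel (\<theta> (r j)) z)) \<longlonglongrightarrow> (fst (G z), snd (G z))"
      using Gl by (simp add: F_def)
    show "(\<lambda>j. LINT z|lborel. norm ((drho (\<theta> (r j)) z, dvel (\<theta> (r j)) z) - (fst (G z), snd (G z)))) \<longlonglongrightarrow> 0"
      using GL by (simp add: F_def)
  qed (use ad small Gout in auto)
qed

end

section \<open>The limit is a weak solution\<close>

lemma test_functions_smooth: "\<phi> \<in> test_functions W \<Longrightarrow> smooth \<phi>"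
  by (simp add: test_functions_def)

lemma test_functions_Cc: "\<phi> \<in> test_functions W \<Longrightarrow> \<phi> \<in> Cc n W"
  by (simp add: test_functions_def Cc_def smooth_Ck)

lemma smooth_pd_continuous: "smooth \<phi> \<Longrightarrow> b \<in> Basis \<Longrightarrow> continuous_on S (pd b \<phi>)"
  by (rule continuous_on_subset[OF Ck_continuous[OF Ck_pd[OF smooth_Ck[of _ "Suc 0"]]]]) auto

lemma grad_pd:
  "grad \<psi> = (\<lambda>x. (pd (1, 0) \<psi> x, pd (0, 1) \<psi> x))" "grad_perp \<psi> = (\<lambda>x. (- pd (0, 1) \<psi> x, pd (1, 0) \<psi> x))"
  by (auto simp: grad_def grad_perp_def pd_def)

lemma smooth_continuous_gradients:
  "smooth \<phi> \<Longrightarrow> continuous_on S (dt \<phi>)" "smooth \<phi> \<Longrightarrow> continuous_on S (grad_x \<phi>)"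
  "smooth \<psi> \<Longrightarrow> continuous_on S' (grad_perp \<psi>)"
  unfolding grad_pd dt_grad_x_pd(1) dt_grad_x_pd(2)[abs_def]
  by (intro continuous_intros smooth_pd_continuous; simp)+

lemma test_functions_bounds:
  assumes "\<phi> \<in> test_functions W"
  obtains B where "B > 0" "\<And>z. \<bar>dt \<phi> z\<bar> \<le> B" "\<And>z. norm (grad_x \<phi> z) \<le> B"
proof -
  have c: "pd b \<phi> \<in> Cc 2 W" if "b \<in> Basis" for b
    using Cc_pd_numeral(1)[OF that test_functions_Cc[OF assms]] .
  obtain B0 where B0: "B0 > 0" "\<And>z. \<bar>pd e\<^sub>t \<phi> z\<bar> \<le> B0" using Cc_bounded[OF c] by (metis spacetime_Basis(3))
  obtain B1 where B1: "B1 > 0" "\<And>z. \<bar>pd e\<^sub>1 \<phi> z\<bar> \<le> B1" using Cc_bounded[OF c] by (metis spacetime_Basis(1))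
  obtain B2 where B2: "B2 > 0" "\<And>z. \<bar>pd e\<^sub>2 \<phi> z\<bar> \<le> B2" using Cc_bounded[OF c] by (metis spacetime_Basis(2))
  show ?thesis
  proof (rule that[of "B0 + B1 + B2"])
    show "\<bar>dt \<phi> z\<bar> \<le> B0 + B1 + B2" for z using B0(2)[of z] B1(1) B2(1) by (simp add: dt_grad_x_pd)
    show "norm (grad_x \<phi> z) \<le> B0 + B1 + B2" for z
      using norm_Pair_le[of "pd e\<^sub>1 \<phi> z" "pd e\<^sub>2 \<phi> z"] B0(1) B1(2)[of z] B2(2)[of z] by (simp add: dt_grad_x_pd)
  qed (use B0 B1 B2 in simp)
qed

lemma grad_perp_bounded:
  assumes "\<psi> \<in> test_functions W"
  obtains B where "B > 0" "\<And>x. norm (grad_perp \<psi> x) \<le> B"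
proof -
  have c: "pd b \<psi> \<in> Cc 2 W" if "b \<in> Basis" for b
    using Cc_pd_numeral(1)[OF that test_functions_Cc[OF assms]] .
  obtain B1 where B1: "B1 > 0" "\<And>z. \<bar>pd (1, 0) \<psi> z\<bar> \<le> B1" using Cc_bounded[OF c] by (metis R2_Basis(1))
  obtain B2 where B2: "B2 > 0" "\<And>z. \<bar>pd (0, 1) \<psi> z\<bar> \<le> B2" using Cc_bounded[OF c] by (metis R2_Basis(2))
  show ?thesis
  proof (rule that[of "B1 + B2"])
    show "norm (grad_perp \<psi> x) \<le> B1 + B2" for x
      using norm_Pair_le[of "- pd (0, 1) \<psi> x" "pd (1, 0) \<psi> x"] B1(2)[of x] B2(2)[of x] by (simp add: grad_pd)
  qed (use B1 B2 in simp)
qed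

lemma smooth_slice:
  fixes \<phi> :: "spacetime \<Rightarrow> real"
  assumes "smooth \<phi>"
  shows "smooth (\<lambda>x. \<phi> (x, t))" "grad (\<lambda>x. \<phi> (x, t)) x = grad_x \<phi> (x, t)"
proof -
  have L: "bounded_linear (\<lambda>x::R2. (x, 0::real))"
    by (intro bounded_linear_Pair bounded_linear_ident bounded_linear_zero)
  have "Ck n (\<lambda>x. \<phi> (x, t))" for n
    using Ck_affine_compose[OF L _ smooth_Ck[OF assms], where c="(0, t)" and n=n] by (auto simp: Basis_prod_def)
  then show "smooth (\<lambda>x. \<phi> (x, t))" by (simp add: smooth_def)
  show "grad (\<lambda>x. \<phi> (x, t)) x = grad_x \<phi> (x, t)"
    by (simp add: grad_pd dt_grad_x_pd pd_slice[OF smooth_Ck[OF assms]])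
qed

text \<open>Stands in for dominated convergence when the majorant varies with \<open>j\<close> and
  is known only to have integrals tending to zero.\<close>

lemma integral_tendsto_of_dist:
  fixes f :: "nat \<Rightarrow> 'a \<Rightarrow> real"
  assumes f: "\<And>j. integrable M (f j)" "integrable M h" and g: "\<And>j. integrable M (g j)"
    and le: "\<And>j. AE x in M. \<bar>f j x - h x\<bar> \<le> g j x" and g0: "(\<lambda>j. integral\<^sup>L M (g j)) \<longlonglongrightarrow> 0"
  shows "(\<lambda>j. integral\<^sup>L M (f j)) \<longlonglongrightarrow> integral\<^sup>L M h"
proof (rule LIM_zero_cancel, rule Lim_null_comparison[OF always_eventually g0], rule allI)
  fix j
  have "norm (integral\<^sup>L M (f j) - integral\<^sup>L M h) = \<bar>LINT x|M. f j x - h x\<bar>"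
    using f by simp
  also have "\<dots> \<le> (LINT x|M. \<bar>f j x - h x\<bar>)" by (rule integral_abs_bound)
  also have "\<dots> \<le> integral\<^sup>L M (g j)"
    by (rule integral_mono_AE[OF _ g le]) (use f in simp)
  finally show "norm (integral\<^sup>L M (f j) - integral\<^sup>L M h) \<le> integral\<^sup>L M (g j)" .
qed

lemma slice_dvel_square_integrable:
  assumes "\<theta> \<in> Cc 3 W"
  shows "integrable lborel (\<lambda>x. (norm (dvel \<theta> (x, t)))\<^sup>2)" "integrable lborel (\<lambda>x. (drho \<theta> (x, t))\<^sup>2)"
proof -
  have sq: "integrable lborel (\<lambda>x. (f (x, t))\<^sup>2)" if "f \<in> Cc 1 W" for f
    unfolding power2_eq_square by (rule Cc_Ck_mult_integrable[OF slice_Cc[OF that] CcD[OF slice_Cc[OF that]]])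
  have c2: "pd a (pd b \<theta>) \<in> Cc 1 W" if "a \<in> Basis" "b \<in> Basis" for a b
    using Cc_pd_numeral(2)[OF that(1) Cc_pd_numeral(1)[OF that(2) assms]] .
  have "(norm (dvel \<theta> z))\<^sup>2 = (pd e\<^sub>2 (pd e\<^sub>1 \<theta>) z)\<^sup>2 + (pd e\<^sub>1 (pd e\<^sub>1 \<theta>) z)\<^sup>2" for z
    by (simp add: dvel_def norm_prod_def)
  then show "integrable lborel (\<lambda>x. (norm (dvel \<theta> (x, t)))\<^sup>2)"
    by (simp add: sq[OF c2])
  show "integrable lborel (\<lambda>x. (drho \<theta> (x, t))\<^sup>2)" by (rule sq[OF drho_Cc[OF assms]])
qed

text \<open>The shift (0, 1 - r^2)/2 has the same norm as the radius in (iv), so the triangle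
  inequality doubles the radius. The bound vanishes together with 1 - r^2, which is how the flux is
  identified without convergence of the momenta.\<close>

lemma gap_pos_momentum:
  assumes "gap r v m > 0"
  shows "norm (m - r *\<^sub>R v) \<le> 1 - r\<^sup>2"
proof -
  have r: "0 < 1 - r\<^sup>2" using gap_pos_abs_less_1[OF assms] by (simp add: abs_square_less_1)
  have n: "norm ((1/2) *\<^sub>R (0::real, 1 - r\<^sup>2)) = (1/2) * (1 - r\<^sup>2)"
    using r by (simp add: norm_prod_def)
  have "norm (m - r *\<^sub>R v) = norm ((m - r *\<^sub>R v + (1/2) *\<^sub>R (0, 1 - r\<^sup>2)) - (1/2) *\<^sub>R (0, 1 - r\<^sup>2))"
    by simp
  also have "\<dots> \<le> norm (m - r *\<^sub>R v + (1/2) *\<^sub>R (0, 1 - r\<^sup>2)) + norm ((1/2) *\<^sub>R (0::real, 1 - r\<^sup>2))"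
    by (rule norm_triangle_ineq4)
  also have "\<dots> \<le> (1/2) * (1 - r\<^sup>2) + (1/2) * (1 - r\<^sup>2)"
    unfolding n by (rule add_right_mono[OF less_imp_le]) (use assms in \<open>simp only: gap_def diff_gt_0_iff_gt\<close>)
  also have "\<dots> = 1 - r\<^sup>2" by simp
  finally show ?thesis .
qed

section \<open>From an admissible subsolution to one weak solution\<close>

locale ipm =
  fixes T :: real and \<Omega> :: "R2 set" and \<rho>\<^sub>0 :: "R2 \<Rightarrow> real"
    and \<rho> :: "spacetime \<Rightarrow> real" and v m :: "spacetime \<Rightarrow> R2" and U :: "spacetime set"
  assumes \<Omega>: "open \<Omega>" "bounded \<Omega>" and T: "T > 0"
    and \<rho>\<^sub>0: "\<rho>\<^sub>0 \<in> Linf \<Omega>"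
    and sub: "admissible_subsolution \<Omega> T \<rho>\<^sub>0 \<rho> v m U"
begin

abbreviation "\<Omega>\<^sub>T \<equiv> \<Omega> \<times> {0<..<T}"

lemma domain: "open \<Omega>\<^sub>T" "bounded \<Omega>\<^sub>T" "\<Omega>\<^sub>T \<in> lmeasurable" "\<Omega>\<^sub>T \<in> sets lebesgue"
  "\<Omega> \<in> lmeasurable" "\<Omega> \<in> sets lebesgue"
proof -
  show 1: "open \<Omega>\<^sub>T" using \<Omega>(1) by (intro open_Times) auto
  have "bounded {0<..<T}" by (rule bounded_subset[OF bounded_closed_interval[of 0 T]]) auto
  then show 2: "bounded \<Omega>\<^sub>T" using \<Omega>(2) by (rule bounded_Times[rotated])
  show "\<Omega>\<^sub>T \<in> lmeasurable" by (rule lmeasurable_open[OF 2 1])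
  then show "\<Omega>\<^sub>T \<in> sets lebesgue" by blast
  show "\<Omega> \<in> lmeasurable" by (rule lmeasurable_open[OF \<Omega>(2,1)])
  then show "\<Omega> \<in> sets lebesgue" by blast
qed

lemma U_facts: "open U" "U \<subseteq> \<Omega>\<^sub>T" "U \<in> sets lebesgue" "\<Omega>\<^sub>T - U \<in> sets lebesgue"
proof -
  show 1: "open U" "U \<subseteq> \<Omega>\<^sub>T" using sub by (auto simp: admissible_subsolution_def)
  then show 2: "U \<in> sets lebesgue" by simp
  then show "\<Omega>\<^sub>T - U \<in> sets lebesgue" using domain(4) by (rule sets.Diff[rotated])
qed

sublocale strict_state U \<rho> v m
proof
  show "open U" by (rule U_facts)
  show "bounded U" using domain(2) U_facts(2) by (rule bounded_subset)
  show "continuous_on U (\<lambda>z. (\<rho> z, v z, m z))" using sub by (simp add: admissible_subsolution_def)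
  show "gap (\<rho> z) (v z) (m z) > 0" if "z \<in> U" for z
    using sub that by (simp add: admissible_subsolution_def gap_def)
qed

lemma measurable_components:
  "\<rho> \<in> borel_measurable (lebesgue_on \<Omega>\<^sub>T)" "v \<in> borel_measurable (lebesgue_on \<Omega>\<^sub>T)" "m \<in> borel_measurable (lebesgue_on \<Omega>\<^sub>T)"
proof -
  have f: "(\<lambda>z. (\<rho> z, v z, m z)) \<in> borel_measurable (lebesgue_on \<Omega>\<^sub>T)"
    using sub by (simp add: admissible_subsolution_def Linf_def)
  have "(\<lambda>z. fst (\<rho> z, v z, m z)) \<in> borel_measurable (lebesgue_on \<Omega>\<^sub>T)"
    "(\<lambda>z. fst (snd (\<rho> z, v z, m z))) \<in> borel_measurable (lebesgue_on \<Omega>\<^sub>T)"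
    "(\<lambda>z. snd (snd (\<rho> z, v z, m z))) \<in> borel_measurable (lebesgue_on \<Omega>\<^sub>T)"
    by (rule borel_measurable_continuous_on[OF _ f], intro continuous_intros)+
  then show "\<rho> \<in> borel_measurable (lebesgue_on \<Omega>\<^sub>T)" "v \<in> borel_measurable (lebesgue_on \<Omega>\<^sub>T)" "m \<in> borel_measurable (lebesgue_on \<Omega>\<^sub>T)"
    by simp_all
qed

lemma bounded_components:
  obtains C where "C > 0" "AE z in lebesgue_on \<Omega>\<^sub>T. \<bar>\<rho> z\<bar> \<le> C \<and> norm (v z) \<le> C \<and> norm (m z) \<le> C"
proof -
  obtain C where C: "AE z in lebesgue_on \<Omega>\<^sub>T. norm (\<rho> z, v z, m z) \<le> C"
    using sub by (auto simp: admissible_subsolution_def Linf_def)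
  have "AE z in lebesgue_on \<Omega>\<^sub>T. \<bar>\<rho> z\<bar> \<le> max C 1 \<and> norm (v z) \<le> max C 1 \<and> norm (m z) \<le> max C 1"
    using C
  proof eventually_elim
    case (elim z)
    have "norm (\<rho> z) \<le> norm (\<rho> z, v z, m z)" "norm (v z, m z) \<le> norm (\<rho> z, v z, m z)"
      "norm (v z) \<le> norm (v z, m z)" "norm (m z) \<le> norm (v z, m z)"
      by (rule norm_fst_le norm_snd_le)+
    then have "\<bar>\<rho> z\<bar> \<le> C" "norm (v z) \<le> C" "norm (m z) \<le> C" using elim by simp_all
    then show ?case by (simp add: le_max_iff_disj)
  qed
  then show ?thesis using that[of "max C 1"] by simp
qed

text \<open>Where |\<rho>| = 1, both the radius and the shift in (iv) are zero, so (iv) becomes an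
  equation.\<close>

lemma outside_U: "AE z in lebesgue_on \<Omega>\<^sub>T. z \<notin> U \<longrightarrow> \<bar>\<rho> z\<bar> = 1 \<and> m z = \<rho> z *\<^sub>R v z"
proof -
  have 1: "AE z in lborel. z \<in> \<Omega>\<^sub>T - U \<longrightarrow> \<bar>\<rho> z\<bar> = 1"
    using sub AE_lebesgue_on_iff[OF U_facts(4)] by (simp add: admissible_subsolution_def)
  have 2: "AE z in lborel. z \<in> \<Omega>\<^sub>T \<longrightarrow> norm (m z - \<rho> z *\<^sub>R v z + (1/2) *\<^sub>R (0, 1 - (\<rho> z)\<^sup>2)) \<le> (1/2) * (1 - (\<rho> z)\<^sup>2)"
    using sub AE_lebesgue_on_iff[OF domain(4)] by (simp add: admissible_subsolution_def)
  show ?thesis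
    unfolding AE_lebesgue_on_iff[OF domain(4)] using 1 2
  proof eventually_elim
    case (elim z)
    show ?case
    proof (intro impI conjI)
      assume z: "z \<in> \<Omega>\<^sub>T" "z \<notin> U"
      then show r: "\<bar>\<rho> z\<bar> = 1" using elim(1) by simp
      then have "(\<rho> z)\<^sup>2 = 1" by (metis one_power2 power2_abs)
      then show "m z = \<rho> z *\<^sub>R v z" using elim(2) z(1) by (simp add: zero_prod_def[symmetric])
    qed
  qed
qed

lemma integrable_continuous:
  fixes h :: "spacetime \<Rightarrow> real"
  assumes "continuous_on UNIV h"
  shows "integrable (lebesgue_on \<Omega>\<^sub>T) h"
proof -
  have "bounded (h ` closure \<Omega>\<^sub>T)"
    using domain(2) by (intro compact_imp_bounded compact_continuous_image continuous_on_subset[OF assms]) auto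
  then obtain B where B: "\<And>z. z \<in> closure \<Omega>\<^sub>T \<Longrightarrow> \<bar>h z\<bar> \<le> B"
    unfolding bounded_pos by auto
  show ?thesis
  proof (rule integrable_bounded_lebesgue_on[OF _ domain(3)])
    show "h \<in> borel_measurable (lebesgue_on \<Omega>\<^sub>T)"
      by (rule continuous_imp_measurable_on_sets_lebesgue[OF continuous_on_subset[OF assms] domain(4)]) simp
    show "norm (h z) \<le> B" if "z \<in> \<Omega>\<^sub>T" for z using B[of z] closure_subset[of \<Omega>\<^sub>T] that by auto
  qed
qed

lemma integrable_AE_bounded:
  fixes h :: "'a::euclidean_space \<Rightarrow> 'b::euclidean_space"
  assumes "h \<in> borel_measurable (lebesgue_on S)" "S \<in> lmeasurable" "AE z in lebesgue_on S. norm (h z) \<le> B"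
  shows "integrable (lebesgue_on S) h"
proof -
  have fm: "finite_measure (lebesgue_on S)" using assms(2) by (rule finite_measure_lebesgue_on)
  show ?thesis by (rule finite_measure.integrable_const_bound[OF fm assms(3,1)])
qed

lemma borel_imp_measurable: "g \<in> borel_measurable borel \<Longrightarrow> g \<in> borel_measurable (lebesgue_on \<Omega>\<^sub>T)"
  for g :: "spacetime \<Rightarrow> 'b::euclidean_space"
  by (rule borel_measurable_lebesgue_onI[OF domain(4)]) auto

end

context ipm
begin

text \<open>The last clause expresses weak closeness without fixing a test function: any bound that
  holds for all potentials below \<open>\<delta>\<^sub>0\<close> is inherited by the limit. Hence
  \<open>\<delta>\<^sub>0\<close> can be chosen before the test function is known.\<close>

lemma exists_solution:
  assumes \<delta>\<^sub>0: "\<delta>\<^sub>0 > 0"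
  shows "\<exists>R V. weak_solution \<Omega> T \<rho>\<^sub>0 R V \<and> (AE z in lebesgue_on \<Omega>\<^sub>T. \<bar>R z\<bar> = 1) \<and>
    (AE z in lebesgue_on (\<Omega>\<^sub>T - U). R z = \<rho> z) \<and>
    (\<forall>f e. integrable (lebesgue_on U) f \<and>
       (\<forall>\<theta>. \<theta> \<in> Cc 3 U \<and> (\<forall>z\<in>U. \<bar>drho \<theta> z\<bar> \<le> 2) \<and> (\<forall>z. \<bar>\<theta> z\<bar> \<le> \<delta>\<^sub>0) \<longrightarrow>
          \<bar>LINT z|lebesgue_on U. drho \<theta> z * f z\<bar> \<le> e) \<longrightarrow>
       \<bar>LINT z|lebesgue_on U. (R z - \<rho> z) * f z\<bar> \<le> e)"
proof -
  obtain \<theta> \<eta> :: "nat \<Rightarrow> spacetime \<Rightarrow> real" and A :: "spacetime \<Rightarrow> real" and B :: "spacetime \<Rightarrow> R2" where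
    ad: "\<And>j. adm (\<theta> j) (\<eta> j)" and small: "\<And>j z. \<bar>\<theta> j z\<bar> \<le> \<delta>\<^sub>0"
    and defect: "(\<lambda>j. LINT z|lebesgue_on U. (1 - (\<rho> z + drho (\<theta> j) z)\<^sup>2)\<^sup>2) \<longlonglongrightarrow> 0"
    and iG: "integrable lborel (\<lambda>z. (A z, B z))"
    and Aout: "\<And>z. z \<notin> U \<Longrightarrow> A z = 0" and Bout: "\<And>z. z \<notin> U \<Longrightarrow> B z = 0"
    and iF: "\<And>j. integrable lborel (\<lambda>z. (drho (\<theta> j) z, dvel (\<theta> j) z))"
    and lim: "AE z in lborel. (\<lambda>j. (drho (\<theta> j) z, dvel (\<theta> j) z)) \<longlonglongrightarrow> (A z, B z)"
    and L1: "(\<lambda>j. LINT z|lborel. norm ((drho (\<theta> j) z, dvel (\<theta> j) z) - (A z, B z))) \<longlonglongrightarrow> 0"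
    by (rule limit[OF \<delta>\<^sub>0]) (rule that; assumption)
  have \<theta>C: "\<theta> j \<in> Cc 3 U" and \<eta>C: "\<eta> j \<in> Cc 3 U"
    and gj: "z \<in> U \<Longrightarrow> gap (\<rho> z + drho (\<theta> j) z) (v z + dvel (\<theta> j) z) (m z + dmom (\<theta> j) (\<eta> j) z) > 0" for j z
    using ad[of j] unfolding adm_def by blast+
  have \<eta>C2: "\<eta> j \<in> Cc 2 U" for j by (rule Cc_mono[OF \<eta>C]) auto
  note out = drho_outside[OF \<theta>C] dvel_outside[OF \<theta>C] dmom_outside[OF \<theta>C _ \<eta>C]
  \<comment> \<open>The joint error of density and velocity. It vanishes off \<open>U\<close> and
    tends to zero in L^1, and it dominates each of the two errors.\<close>
  define n where "n j z = norm ((drho (\<theta> j) z, dvel (\<theta> j) z) - (A z, B z))" for j z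
  have nA: "\<bar>drho (\<theta> j) z - A z\<bar> \<le> n j z" and nB: "norm (dvel (\<theta> j) z - B z) \<le> n j z" for j z
  proof -
    have "norm (drho (\<theta> j) z - A z) \<le> norm (drho (\<theta> j) z - A z, dvel (\<theta> j) z - B z)"
      by (rule norm_fst_le)
    then show "\<bar>drho (\<theta> j) z - A z\<bar> \<le> n j z" by (simp add: n_def)
    have "norm (dvel (\<theta> j) z - B z) \<le> norm (drho (\<theta> j) z - A z, dvel (\<theta> j) z - B z)"
      by (rule norm_snd_le)
    then show "norm (dvel (\<theta> j) z - B z) \<le> n j z" by (simp add: n_def)
  qed
  have in_lborel: "integrable lborel (n j)" for j
    unfolding n_def[abs_def] by (intro integrable_norm Bochner_Integration.integrable_diff iF iG)
  have nout: "n j z = 0" if "z \<notin> U" for j z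
    using that by (simp add: n_def out Aout Bout norm_prod_def)
  have in_D: "integrable (lebesgue_on \<Omega>\<^sub>T) (n j)" for j
    by (rule integrable_lebesgue_on_supported[OF in_lborel domain(4)])
  have n0: "(\<lambda>j. LINT z|lebesgue_on \<Omega>\<^sub>T. n j z) \<longlonglongrightarrow> 0"
  proof -
    have "(LINT z|lebesgue_on \<Omega>\<^sub>T. n j z) = (LINT z|lborel. n j z)" for j
    proof (rule integral_lebesgue_on_supported[OF _ domain(4)])
      show "n j \<in> borel_measurable borel" using borel_measurable_integrable[OF in_lborel] by simp
      show "n j z = 0" if "z \<notin> \<Omega>\<^sub>T" for z using nout U_facts(2) that by blast
    qed
    then show ?thesis using L1 by (simp add: n_def)
  qed
  have Gm: "(\<lambda>z. (A z, B z)) \<in> borel_measurable borel"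
    using borel_measurable_integrable[OF iG] by simp
  have "(\<lambda>z. fst (A z, B z)) \<in> borel_measurable borel" "(\<lambda>z. snd (A z, B z)) \<in> borel_measurable borel"
    by (rule borel_measurable_continuous_on[OF _ Gm], intro continuous_intros)+
  then have Am: "A \<in> borel_measurable borel" and Bm: "B \<in> borel_measurable borel" by simp_all
  have iB: "integrable lborel B"
    by (rule Bochner_Integration.integrable_bound[OF iG]) (use Bm in \<open>auto simp: norm_snd_le\<close>)
  have lims: "AE z in lborel. (\<lambda>j. drho (\<theta> j) z) \<longlonglongrightarrow> A z \<and> (\<lambda>j. dvel (\<theta> j) z) \<longlonglongrightarrow> B z"
    using lim
  proof eventually_elim
    case (elim z)
    then show ?case using tendsto_fst[OF elim] tendsto_snd[OF elim] by simp
  qed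
  define R where "R z = \<rho> z + A z" for z
  define V where "V z = v z + B z" for z
  define Rj where "Rj j z = \<rho> z + drho (\<theta> j) z" for j z
  have Rm: "R \<in> borel_measurable (lebesgue_on \<Omega>\<^sub>T)" and Vm: "V \<in> borel_measurable (lebesgue_on \<Omega>\<^sub>T)"
    unfolding R_def[abs_def] V_def[abs_def]
    by (intro borel_measurable_add measurable_components borel_imp_measurable Am Bm)+
  have dm: "drho (\<theta> j) \<in> borel_measurable (lebesgue_on \<Omega>\<^sub>T)" for j
    by (intro borel_imp_measurable borel_measurable_continuous_onI continuous_on_perturbation[OF \<theta>C \<eta>C])
  have Rjm: "Rj j \<in> borel_measurable (lebesgue_on \<Omega>\<^sub>T)" for j
    unfolding Rj_def[abs_def] by (intro borel_measurable_add measurable_components dm)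
  have Rj1: "\<bar>Rj j z\<bar> < 1" if "z \<in> U" for j z
    unfolding Rj_def by (rule gap_pos_abs_less_1[OF gj[OF that]])
  have outU: "AE z in lborel. z \<in> \<Omega>\<^sub>T \<longrightarrow> z \<notin> U \<longrightarrow> \<bar>\<rho> z\<bar> = 1 \<and> m z = \<rho> z *\<^sub>R v z"
    using outside_U unfolding AE_lebesgue_on_iff[OF domain(4)] .

  \<comment> \<open>By Fatou the limiting defect is integrable with integral at most every positive
    e, hence it is zero almost everywhere.\<close>
  have inU: "AE z in lborel. z \<in> U \<longrightarrow> \<bar>R z\<bar> = 1"
  proof -
    have \<rho>c: "continuous_on U \<rho>" using continuous_on_fst[OF cont] by simp
    have g: "(\<lambda>z. (1 - (R z)\<^sup>2)\<^sup>2) \<in> borel_measurable (lebesgue_on U)"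
    proof -
      have "A \<in> borel_measurable (lebesgue_on U)" by (rule borel_measurable_lebesgue_onI[OF U_facts(3) Am]) simp
      moreover have "\<rho> \<in> borel_measurable (lebesgue_on U)"
        by (rule continuous_imp_measurable_on_sets_lebesgue[OF \<rho>c U_facts(3)])
      ultimately show ?thesis unfolding R_def by measurable
    qed
    have f: "integrable (lebesgue_on U) (\<lambda>z. (1 - (Rj k z)\<^sup>2)\<^sup>2)" for k
    proof (rule integrable_cont[of _ 1])
      show "continuous_on U (\<lambda>z. (1 - (Rj k z)\<^sup>2)\<^sup>2)"
        unfolding Rj_def by (intro continuous_intros adm_rho(1)[OF ad])
      show "\<bar>(1 - (Rj k z)\<^sup>2)\<^sup>2\<bar> \<le> 1" if "z \<in> U" for z
        using Rj1[OF that, of k] by (simp add: abs_square_less_1 power_le_one less_imp_le)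
    qed
    have l: "AE z in lebesgue_on U. (\<lambda>k. (1 - (Rj k z)\<^sup>2)\<^sup>2) \<longlonglongrightarrow> (1 - (R z)\<^sup>2)\<^sup>2"
      unfolding AE_lebesgue_on_iff[OF U_facts(3)] using lims
    proof eventually_elim
      case (elim z)
      then show ?case unfolding Rj_def R_def by (intro impI tendsto_intros) blast
    qed
    have fb: "integrable (lebesgue_on U) (\<lambda>z. (1 - (R z)\<^sup>2)\<^sup>2) \<and> (LINT z|lebesgue_on U. (1 - (R z)\<^sup>2)\<^sup>2) \<le> e"
      if e: "e > 0" for e
    proof -
      have "\<forall>\<^sub>F k in sequentially. (LINT z|lebesgue_on U. (1 - (Rj k z)\<^sup>2)\<^sup>2) \<le> e"
        using order_tendstoD(2)[OF defect e] unfolding Rj_def by eventually_elim (rule less_imp_le)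
      from fatou_bound[OF f _ g l this] show ?thesis by simp
    qed
    have i: "integrable (lebesgue_on U) (\<lambda>z. (1 - (R z)\<^sup>2)\<^sup>2)" using fb[of 1] by simp
    have "(LINT z|lebesgue_on U. (1 - (R z)\<^sup>2)\<^sup>2) \<le> 0"
      by (rule field_le_epsilon) (use fb in simp)
    moreover have "(LINT z|lebesgue_on U. (1 - (R z)\<^sup>2)\<^sup>2) \<ge> 0" by (rule integral_nonneg_AE) simp
    ultimately have "AE z in lebesgue_on U. (1 - (R z)\<^sup>2)\<^sup>2 = 0"
      using integral_nonneg_eq_0_iff_AE[OF i] by simp
    then show ?thesis
      unfolding AE_lebesgue_on_iff[OF U_facts(3)]
    proof eventually_elim
      case (elim z)
      show ?case
      proof
        assume "z \<in> U"
        then have "(R z)\<^sup>2 = 1" using elim by simp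
        then show "\<bar>R z\<bar> = 1" by (simp add: abs_square_eq_1)
      qed
    qed
  qed
  have R1: "AE z in lborel. z \<in> \<Omega>\<^sub>T \<longrightarrow> \<bar>R z\<bar> = 1"
    using inU outU by eventually_elim (auto simp: R_def Aout)
  have R1': "AE z in lebesgue_on \<Omega>\<^sub>T. \<bar>R z\<bar> = 1"
    using R1 unfolding AE_lebesgue_on_iff[OF domain(4)] .
  have Rj1': "AE z in lborel. z \<in> \<Omega>\<^sub>T \<longrightarrow> (\<forall>j. \<bar>Rj j z\<bar> \<le> 1)"
    using outU
  proof eventually_elim
    case (elim z)
    show ?case
    proof (intro impI allI)
      fix j assume z: "z \<in> \<Omega>\<^sub>T"
      show "\<bar>Rj j z\<bar> \<le> 1"
      proof (cases "z \<in> U")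
        case True then show ?thesis using Rj1[of z j] by simp
      next
        case False then show ?thesis using elim z by (simp add: Rj_def out)
      qed
    qed
  qed
  \<comment> \<open>Inside \<open>U\<close> this is \<open>gap_pos_momentum\<close>; outside, the
    perturbation vanishes and both sides are 0. One null set serves all \<open>j\<close>.\<close>
  have mom: "AE z in lborel. z \<in> \<Omega>\<^sub>T \<longrightarrow> (\<forall>j. norm ((m z + dmom (\<theta> j) (\<eta> j) z) - Rj j z *\<^sub>R (v z + dvel (\<theta> j) z)) \<le> 1 - (Rj j z)\<^sup>2)"
    using outU
  proof eventually_elim
    case (elim z)
    show ?case
    proof (intro impI allI)
      fix j assume z: "z \<in> \<Omega>\<^sub>T"
      show "norm ((m z + dmom (\<theta> j) (\<eta> j) z) - Rj j z *\<^sub>R (v z + dvel (\<theta> j) z)) \<le> 1 - (Rj j z)\<^sup>2"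
      proof (cases "z \<in> U")
        case True then show ?thesis unfolding Rj_def by (rule gap_pos_momentum[OF gj])
      next
        case False
        then have "\<bar>\<rho> z\<bar> = 1" "m z = \<rho> z *\<^sub>R v z" using elim z by auto
        moreover from this(1) have "(\<rho> z)\<^sup>2 = 1" by (metis one_power2 power2_abs)
        ultimately show ?thesis using False by (simp add: Rj_def out)
      qed
    qed
  qed
  obtain C where C: "C > 0" "AE z in lebesgue_on \<Omega>\<^sub>T. \<bar>\<rho> z\<bar> \<le> C \<and> norm (v z) \<le> C \<and> norm (m z) \<le> C"
    by (rule bounded_components)
  have iv: "integrable (lebesgue_on \<Omega>\<^sub>T) v"
    by (rule integrable_AE_bounded[OF measurable_components(2) domain(3), of C])
      (use C(2) in \<open>auto elim: eventually_mono\<close>)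
  have iV: "integrable (lebesgue_on \<Omega>\<^sub>T) V"
    unfolding V_def[abs_def]
    by (rule Bochner_Integration.integrable_add[OF iv integrable_lebesgue_on_supported[OF iB domain(4)]])

  \<comment> \<open>Every iterate solves the linear transport equation exactly, with its momentum as
    flux and the original initial term. What must be shown is that in the limit the flux may be
    replaced by R V.\<close>
  have transport: "(LINT z|lebesgue_on \<Omega>\<^sub>T. R z * (dt \<phi> z + V z \<bullet> grad_x \<phi> z)) + (LINT x|lebesgue_on \<Omega>. \<rho>\<^sub>0 x * \<phi> (x, 0)) = 0"
    if \<phi>: "\<phi> \<in> test_functions (UNIV \<times> {..<T})" for \<phi>
  proof -
    note s\<phi> = test_functions_smooth[OF \<phi>]
    obtain b where b: "b > 0" "\<And>z. \<bar>dt \<phi> z\<bar> \<le> b" "\<And>z. norm (grad_x \<phi> z) \<le> b"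
      using test_functions_bounds[OF \<phi>] by blast
    note cg = smooth_continuous_gradients(1,2)[OF s\<phi>]
    have tm: "dt \<phi> \<in> borel_measurable (lebesgue_on \<Omega>\<^sub>T)" "grad_x \<phi> \<in> borel_measurable (lebesgue_on \<Omega>\<^sub>T)"
      by (intro borel_imp_measurable borel_measurable_continuous_onI cg)+
    define E where "E j z = Rj j z * dt \<phi> z + (m z + dmom (\<theta> j) (\<eta> j) z) \<bullet> grad_x \<phi> z" for j z
    define H where "H z = R z * (dt \<phi> z + V z \<bullet> grad_x \<phi> z)" for z
    define p where "p j z = drho (\<theta> j) z * dt \<phi> z + dmom (\<theta> j) (\<eta> j) z \<bullet> grad_x \<phi> z" for j z
    define q where "q z = \<rho> z * dt \<phi> z + m z \<bullet> grad_x \<phi> z" for z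
    have pc: "continuous_on UNIV (p j)" for j
      unfolding p_def[abs_def] by (intro continuous_intros continuous_on_perturbation[OF \<theta>C \<eta>C] cg)
    have ip: "integrable (lebesgue_on \<Omega>\<^sub>T) (p j)" for j by (rule integrable_continuous[OF pc])
    have iq: "integrable (lebesgue_on \<Omega>\<^sub>T) q"
    proof (rule integrable_AE_bounded[OF _ domain(3), of _ "C * b + C * b"])
      show "q \<in> borel_measurable (lebesgue_on \<Omega>\<^sub>T)"
        unfolding q_def[abs_def] by (intro borel_measurable_add borel_measurable_times borel_measurable_inner measurable_components tm)
      show "AE z in lebesgue_on \<Omega>\<^sub>T. norm (q z) \<le> C * b + C * b"
        using C(2)
      proof eventually_elim
        case (elim z)
        have "norm (q z) \<le> \<bar>\<rho> z\<bar> * \<bar>dt \<phi> z\<bar> + norm (m z) * norm (grad_x \<phi> z)"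
          unfolding q_def real_norm_def
          by (rule order_trans[OF abs_triangle_ineq]) (simp add: abs_mult Cauchy_Schwarz_ineq2)
        also have "\<dots> \<le> C * b + C * b"
          using elim b C(1) by (intro add_mono mult_mono) auto
        finally show ?case .
      qed
    qed
    have Epq: "E j z = q z + p j z" for j z by (simp add: E_def p_def q_def Rj_def algebra_simps inner_add_left)
    have iE: "integrable (lebesgue_on \<Omega>\<^sub>T) (E j)" for j
      unfolding Epq[abs_def] by (intro Bochner_Integration.integrable_add ip iq)
    have p0: "(LINT z|lebesgue_on \<Omega>\<^sub>T. p j z) = 0" for j
    proof -
      have "(LINT z|lebesgue_on \<Omega>\<^sub>T. p j z) = (LINT z|lborel. p j z)"
      proof (rule integral_lebesgue_on_supported[OF borel_measurable_continuous_onI[OF pc] domain(4)])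
        fix z assume "z \<notin> \<Omega>\<^sub>T"
        then have "z \<notin> U" using U_facts(2) by blast
        then show "p j z = 0" by (simp add: p_def out)
      qed
      also have "\<dots> = 0" unfolding p_def by (rule integral_transport_zero[OF \<theta>C \<eta>C2 s\<phi>])
      finally show ?thesis .
    qed
    have "(LINT z|lebesgue_on \<Omega>\<^sub>T. q z) + (LINT x|lebesgue_on \<Omega>. \<phi> (x, 0) * \<rho>\<^sub>0 x) = 0"
      using sub \<phi> by (simp add: admissible_subsolution_def q_def)
    then have Ec: "(LINT z|lebesgue_on \<Omega>\<^sub>T. E j z) = - (LINT x|lebesgue_on \<Omega>. \<rho>\<^sub>0 x * \<phi> (x, 0))" for j
      using ip[of j] iq p0[of j] by (simp add: Epq mult.commute)
    have iH: "integrable (lebesgue_on \<Omega>\<^sub>T) H"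
    proof (rule Bochner_Integration.integrable_bound)
      show "integrable (lebesgue_on \<Omega>\<^sub>T) (\<lambda>z. b * (1 + norm (V z)))"
        using iV integrable_continuous[of "\<lambda>_. 1"] by (intro integrable_mult_right Bochner_Integration.integrable_add integrable_norm) auto
      show "H \<in> borel_measurable (lebesgue_on \<Omega>\<^sub>T)"
        unfolding H_def[abs_def] by (intro borel_measurable_add borel_measurable_times borel_measurable_inner Rm Vm tm)
      show "AE z in lebesgue_on \<Omega>\<^sub>T. norm (H z) \<le> norm (b * (1 + norm (V z)))"
        using R1'
      proof eventually_elim
        case (elim z)
        have "norm (H z) \<le> \<bar>dt \<phi> z\<bar> + \<bar>V z \<bullet> grad_x \<phi> z\<bar>"
          unfolding H_def real_norm_def abs_mult elim by simp
        also have "\<dots> \<le> b + norm (V z) * b"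
          using b by (intro add_mono order_trans[OF Cauchy_Schwarz_ineq2] mult_left_mono) auto
        also have "\<dots> = b * (1 + norm (V z))" by (simp add: algebra_simps)
        finally show ?case using b(1) by simp
      qed
    qed
    \<comment> \<open>\<open>h\<close> collects the errors that converge pointwise. Multiplying |R_j
      - R| by the fixed integrable |V|, and not by the velocity of the iterate, gives the majorant 3
      + 2 |V|. The velocity error, known to vanish only in L^1, is left to \<open>n\<close>.\<close>
    define h where "h j z = \<bar>Rj j z - R z\<bar> + (1 - (Rj j z)\<^sup>2) + \<bar>Rj j z - R z\<bar> * norm (V z)" for j z
    have hm: "h j \<in> borel_measurable (lebesgue_on \<Omega>\<^sub>T)" for j
      unfolding h_def[abs_def] using Rjm[of j] Rm Vm by measurable
    have iw: "integrable (lebesgue_on \<Omega>\<^sub>T) (\<lambda>z. 3 + 2 * norm (V z))"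
      using iV integrable_continuous[of "\<lambda>_. 3"] by (intro Bochner_Integration.integrable_add integrable_mult_right integrable_norm) auto
    have hb: "AE z in lebesgue_on \<Omega>\<^sub>T. norm (h j z) \<le> 3 + 2 * norm (V z)" for j
      unfolding AE_lebesgue_on_iff[OF domain(4)] using R1 Rj1'
    proof eventually_elim
      case (elim z)
      show ?case
      proof
        assume z: "z \<in> \<Omega>\<^sub>T"
        have "\<bar>R z\<bar> = 1" "\<bar>Rj j z\<bar> \<le> 1" using elim z by blast+
        then have a: "\<bar>Rj j z - R z\<bar> \<le> 2" by linarith
        have "(Rj j z)\<^sup>2 \<le> 1" using elim z by (simp add: abs_square_le_1)
        moreover have "\<bar>Rj j z - R z\<bar> * norm (V z) \<le> 2 * norm (V z)" using a by (rule mult_right_mono) simp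
        moreover have "0 \<le> \<bar>Rj j z - R z\<bar> * norm (V z)" by simp
        ultimately show "norm (h j z) \<le> 3 + 2 * norm (V z)"
          unfolding h_def real_norm_def using a zero_le_power2[of "Rj j z"] by linarith
      qed
    qed
    have ih: "integrable (lebesgue_on \<Omega>\<^sub>T) (h j)" for j
      by (rule Bochner_Integration.integrable_bound[OF iw hm]) (use hb in \<open>auto elim: eventually_mono\<close>)
    have h0: "(\<lambda>j. LINT z|lebesgue_on \<Omega>\<^sub>T. h j z) \<longlonglongrightarrow> (LINT z|lebesgue_on \<Omega>\<^sub>T. 0)"
    proof (rule integral_dominated_convergence[OF _ hm iw _ hb])
      show "AE z in lebesgue_on \<Omega>\<^sub>T. (\<lambda>j. h j z) \<longlonglongrightarrow> 0"
        unfolding AE_lebesgue_on_iff[OF domain(4)] using R1 lims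
      proof eventually_elim
        case (elim z)
        show ?case
        proof
          assume z: "z \<in> \<Omega>\<^sub>T"
          have l: "(\<lambda>j. Rj j z) \<longlonglongrightarrow> R z" unfolding Rj_def R_def using elim by (intro tendsto_intros) blast
          have "(\<lambda>j. h j z) \<longlonglongrightarrow> \<bar>R z - R z\<bar> + (1 - (R z)\<^sup>2) + \<bar>R z - R z\<bar> * norm (V z)"
            unfolding h_def by (intro tendsto_intros l)
          moreover have "(R z)\<^sup>2 = 1" using elim(1) z by (metis one_power2 power2_abs)
          ultimately show "(\<lambda>j. h j z) \<longlonglongrightarrow> 0" by simp
        qed
      qed
    qed simp
    have "(\<lambda>j. LINT z|lebesgue_on \<Omega>\<^sub>T. E j z) \<longlonglongrightarrow> (LINT z|lebesgue_on \<Omega>\<^sub>T. H z)"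
    proof (rule integral_tendsto_of_dist[OF iE iH])
      show "integrable (lebesgue_on \<Omega>\<^sub>T) (\<lambda>z. b * (h j z + n j z))" for j
        by (intro integrable_mult_right Bochner_Integration.integrable_add ih in_D)
      have "(\<lambda>j. b * ((LINT z|lebesgue_on \<Omega>\<^sub>T. h j z) + (LINT z|lebesgue_on \<Omega>\<^sub>T. n j z))) \<longlonglongrightarrow> b * (0 + 0)"
        using h0 by (intro tendsto_intros n0) simp
      then show "(\<lambda>j. LINT z|lebesgue_on \<Omega>\<^sub>T. b * (h j z + n j z)) \<longlonglongrightarrow> 0"
        using ih in_D by simp
      show "AE z in lebesgue_on \<Omega>\<^sub>T. \<bar>E j z - H z\<bar> \<le> b * (h j z + n j z)" for j
        unfolding AE_lebesgue_on_iff[OF domain(4)] using mom Rj1'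
      proof eventually_elim
        case (elim z)
        show ?case
        proof
          assume z: "z \<in> \<Omega>\<^sub>T"
          define M where "M = m z + dmom (\<theta> j) (\<eta> j) z"
          define W where "W = v z + dvel (\<theta> j) z"
          have EH: "E j z - H z = (Rj j z - R z) * dt \<phi> z + (M - R z *\<^sub>R V z) \<bullet> grad_x \<phi> z"
            by (simp add: E_def H_def M_def algebra_simps inner_diff_left)
          \<comment> \<open>The flux error splits into the distance of the momentum from the product
            of the iterate's fields, the velocity error times a density bounded by 1, and the
            density error times \<open>V\<close>.\<close>
          have "norm (M - R z *\<^sub>R V z) = norm ((M - Rj j z *\<^sub>R W) + (Rj j z *\<^sub>R (W - V z) + (Rj j z - R z) *\<^sub>R V z))"
            by (simp add: algebra_simps)
          also have "\<dots> \<le> norm (M - Rj j z *\<^sub>R W) + (norm (Rj j z *\<^sub>R (W - V z)) + norm ((Rj j z - R z) *\<^sub>R V z))"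
            by (intro order_trans[OF norm_triangle_ineq] add_left_mono norm_triangle_ineq)
          also have "\<dots> \<le> (1 - (Rj j z)\<^sup>2) + (1 * n j z + \<bar>Rj j z - R z\<bar> * norm (V z))"
          proof (intro add_mono)
            show "norm (M - Rj j z *\<^sub>R W) \<le> 1 - (Rj j z)\<^sup>2" using elim(1) z unfolding M_def W_def by blast
            have "W - V z = dvel (\<theta> j) z - B z" by (simp add: W_def V_def)
            then show "norm (Rj j z *\<^sub>R (W - V z)) \<le> 1 * n j z"
              unfolding norm_scaleR using elim(2) z nB[of j z] by (intro mult_mono) auto
            show "norm ((Rj j z - R z) *\<^sub>R V z) \<le> \<bar>Rj j z - R z\<bar> * norm (V z)" by simp
          qed
          finally have MN: "norm (M - R z *\<^sub>R V z) \<le> (1 - (Rj j z)\<^sup>2) + (1 * n j z + \<bar>Rj j z - R z\<bar> * norm (V z))" .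
          have "\<bar>E j z - H z\<bar> \<le> \<bar>Rj j z - R z\<bar> * \<bar>dt \<phi> z\<bar> + norm (M - R z *\<^sub>R V z) * norm (grad_x \<phi> z)"
            unfolding EH by (rule order_trans[OF abs_triangle_ineq]) (simp add: abs_mult Cauchy_Schwarz_ineq2)
          also have "\<dots> \<le> \<bar>Rj j z - R z\<bar> * b + ((1 - (Rj j z)\<^sup>2) + (1 * n j z + \<bar>Rj j z - R z\<bar> * norm (V z))) * b"
            using b MN order_trans[OF norm_ge_zero MN] by (intro add_mono mult_mono) auto
          also have "\<dots> = b * (h j z + n j z)" by (simp add: h_def algebra_simps)
          finally show "\<bar>E j z - H z\<bar> \<le> b * (h j z + n j z)" .
        qed
      qed
    qed
    then have "(LINT z|lebesgue_on \<Omega>\<^sub>T. H z) = - (LINT x|lebesgue_on \<Omega>. \<rho>\<^sub>0 x * \<phi> (x, 0))"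
      unfolding Ec by (simp add: LIMSEQ_const_iff)
    then show ?thesis by (simp add: H_def)
  qed

  \<comment> \<open>The base velocity is handled on slices through (ii) and Fubini, the perturbation
    directly in space-time.\<close>
  have divfree: "(LINT z|lebesgue_on \<Omega>\<^sub>T. V z \<bullet> grad_x \<phi> z) = 0"
    if \<phi>: "\<phi> \<in> test_functions (UNIV \<times> {..<T})" for \<phi>
  proof -
    note s\<phi> = test_functions_smooth[OF \<phi>]
    obtain b where b: "b > 0" "\<And>z. \<bar>dt \<phi> z\<bar> \<le> b" "\<And>z. norm (grad_x \<phi> z) \<le> b"
      using test_functions_bounds[OF \<phi>] by blast
    note cg = smooth_continuous_gradients(2)[OF s\<phi>]
    have tm: "grad_x \<phi> \<in> borel_measurable (lebesgue_on \<Omega>\<^sub>T)"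
      by (intro borel_imp_measurable borel_measurable_continuous_onI cg)
    have inn: "integrable (lebesgue_on \<Omega>\<^sub>T) (\<lambda>z. w z \<bullet> grad_x \<phi> z)" if w: "integrable (lebesgue_on \<Omega>\<^sub>T) w" for w
    proof (rule Bochner_Integration.integrable_bound)
      show "integrable (lebesgue_on \<Omega>\<^sub>T) (\<lambda>z. b * norm (w z))" using w by simp
      show "(\<lambda>z. w z \<bullet> grad_x \<phi> z) \<in> borel_measurable (lebesgue_on \<Omega>\<^sub>T)"
        by (rule borel_measurable_inner[OF borel_measurable_integrable[OF w] tm])
      show "AE z in lebesgue_on \<Omega>\<^sub>T. norm (w z \<bullet> grad_x \<phi> z) \<le> norm (b * norm (w z))"
      proof (rule AE_I2)
        fix z
        have "\<bar>w z \<bullet> grad_x \<phi> z\<bar> \<le> norm (w z) * norm (grad_x \<phi> z)" by (rule Cauchy_Schwarz_ineq2)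
        also have "\<dots> \<le> norm (w z) * b" using b by (intro mult_left_mono) auto
        finally show "norm (w z \<bullet> grad_x \<phi> z) \<le> norm (b * norm (w z))" using b(1) by (simp add: mult.commute)
      qed
    qed
    have iBD: "integrable (lebesgue_on \<Omega>\<^sub>T) B" by (rule integrable_lebesgue_on_supported[OF iB domain(4)])
    have "AE t in lebesgue_on {0<..<T}. \<forall>\<psi>. smooth \<psi> \<longrightarrow> (LINT x|lebesgue_on \<Omega>. v (x, t) \<bullet> grad \<psi> x) = 0"
      using sub by (simp add: admissible_subsolution_def)
    then have "AE t in lebesgue_on {0<..<T}. (LINT x|lebesgue_on \<Omega>. v (x, t) \<bullet> grad_x \<phi> (x, t)) = 0"
    proof eventually_elim
      case (elim t)
      show ?case using elim[rule_format, OF smooth_slice(1)[OF s\<phi>, of t]] by (simp add: smooth_slice(2)[OF s\<phi>])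
    qed
    then have v0: "(LINT z|lebesgue_on \<Omega>\<^sub>T. v z \<bullet> grad_x \<phi> z) = 0"
      by (intro slice_integral_zero[OF \<Omega>(1) _ inn[OF iv]]) auto
    have dc: "continuous_on UNIV (\<lambda>z. dvel (\<theta> j) z \<bullet> grad_x \<phi> z)" for j
      by (intro continuous_intros continuous_on_perturbation[OF \<theta>C \<eta>C] cg)
    have d0: "(LINT z|lebesgue_on \<Omega>\<^sub>T. dvel (\<theta> j) z \<bullet> grad_x \<phi> z) = 0" for j
    proof -
      have "(LINT z|lebesgue_on \<Omega>\<^sub>T. dvel (\<theta> j) z \<bullet> grad_x \<phi> z) = (LINT z|lborel. dvel (\<theta> j) z \<bullet> grad_x \<phi> z)"
      proof (rule integral_lebesgue_on_supported[OF borel_measurable_continuous_onI[OF dc] domain(4)])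
        fix z assume "z \<notin> \<Omega>\<^sub>T"
        then have "z \<notin> U" using U_facts(2) by blast
        then show "dvel (\<theta> j) z \<bullet> grad_x \<phi> z = 0" by (simp add: out)
      qed
      also have "\<dots> = 0" by (rule integral_dvel_grad_x[OF \<theta>C s\<phi>])
      finally show ?thesis .
    qed
    have "(\<lambda>j. LINT z|lebesgue_on \<Omega>\<^sub>T. dvel (\<theta> j) z \<bullet> grad_x \<phi> z) \<longlonglongrightarrow> (LINT z|lebesgue_on \<Omega>\<^sub>T. B z \<bullet> grad_x \<phi> z)"
    proof (rule integral_tendsto_of_dist[OF integrable_continuous[OF dc] inn[OF iBD]])
      show "integrable (lebesgue_on \<Omega>\<^sub>T) (\<lambda>z. b * n j z)" for j by (intro integrable_mult_right in_D)
      show "(\<lambda>j. LINT z|lebesgue_on \<Omega>\<^sub>T. b * n j z) \<longlonglongrightarrow> 0"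
        using tendsto_mult_right_zero[OF n0, of b] in_D by simp
      show "AE z in lebesgue_on \<Omega>\<^sub>T. \<bar>dvel (\<theta> j) z \<bullet> grad_x \<phi> z - B z \<bullet> grad_x \<phi> z\<bar> \<le> b * n j z" for j
      proof (rule AE_I2)
        fix z
        have "\<bar>(dvel (\<theta> j) z - B z) \<bullet> grad_x \<phi> z\<bar> \<le> norm (dvel (\<theta> j) z - B z) * norm (grad_x \<phi> z)"
          by (rule Cauchy_Schwarz_ineq2)
        also have "\<dots> \<le> n j z * b" using b nB[of j z] order_trans[OF norm_ge_zero nB[of j z]] by (intro mult_mono) auto
        finally show "\<bar>dvel (\<theta> j) z \<bullet> grad_x \<phi> z - B z \<bullet> grad_x \<phi> z\<bar> \<le> b * n j z"
          by (simp add: inner_diff_left mult.commute)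
      qed
    qed
    then have B0: "(LINT z|lebesgue_on \<Omega>\<^sub>T. B z \<bullet> grad_x \<phi> z) = 0"
      unfolding d0 by (simp add: LIMSEQ_const_iff)
    show ?thesis
      unfolding V_def inner_add_left using inn[OF iv] inn[OF iBD] v0 B0 by simp
  qed

  have slices_v: "AE t in lebesgue_on {0<..<T}. (\<lambda>x. v (x, t)) \<in> borel_measurable (lebesgue_on \<Omega>) \<and>
      (\<lambda>x. \<rho> (x, t)) \<in> borel_measurable (lebesgue_on \<Omega>) \<and>
      (AE x in lebesgue_on \<Omega>. \<bar>\<rho> (x, t)\<bar> \<le> C \<and> norm (v (x, t)) \<le> C)"
  proof -
    have I: "open {0<..<T}" by simp
    have "AE z in lebesgue_on \<Omega>\<^sub>T. \<bar>\<rho> z\<bar> \<le> C \<and> norm (v z) \<le> C" using C(2) by eventually_elim blast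
    from slice_measurable_R2[OF \<Omega>(1) I measurable_components(2)] slice_measurable_real[OF \<Omega>(1) I measurable_components(1)]
      slice_AE[OF \<Omega>(1) I this]
    show ?thesis by eventually_elim blast
  qed
  have slice_m: "(\<lambda>x. A (x, t)) \<in> borel_measurable borel" "(\<lambda>x. B (x, t)) \<in> borel_measurable borel" for t
  proof -
    have "(\<lambda>x::R2. (x, t)) \<in> borel_measurable borel"
      by (intro borel_measurable_continuous_onI continuous_intros)
    then show "(\<lambda>x. A (x, t)) \<in> borel_measurable borel" "(\<lambda>x. B (x, t)) \<in> borel_measurable borel"
      using Am Bm by (auto intro: measurable_compose)
  qed
  have slice_out: "(x, t) \<notin> U" if "x \<notin> \<Omega>" for x t using U_facts(2) that by blast

  \<comment> \<open>The exceptional set of times must not depend on \<open>\<psi>\<close>. Along a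
    subsequence the slice integrals of \<open>n\<close> tend to zero for almost every time, and
    \<open>\<psi>\<close> enters the error only through a bound on its gradient.\<close>
  have curlfree: "AE t in lebesgue_on {0<..<T}. \<forall>\<psi> \<in> test_functions \<Omega>.
        (LINT x|lebesgue_on \<Omega>. (V (x, t) + (0, R (x, t))) \<bullet> grad_perp \<psi> x) = 0"
  proof -
    define u where "u j t = (LINT x|lborel. n j (x, t))" for j t
    have iu: "integrable lborel (u j)" for j unfolding u_def by (rule integrable_integral_slices[OF in_lborel])
    have u0: "0 \<le> u j t" for j t unfolding u_def by (rule integral_nonneg_AE) (simp add: n_def)
    have "(LINT t|lborel. norm (u j t)) = (LINT z|lborel. n j z)" for j
      using u0 integral_integral_slices[OF in_lborel, of j] by (simp add: u_def)
    then have "(\<lambda>j. LINT t|lborel. norm (u j t)) \<longlonglongrightarrow> 0" using L1 by (simp add: n_def)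
    from tendsto_L1_AE_subseq[OF iu this] obtain r :: "nat \<Rightarrow> nat" where
      r: "AE t in lborel. (\<lambda>j. u (r j) t) \<longlonglongrightarrow> 0" by blast
    have iGs: "AE t in lborel. integrable lborel (\<lambda>x. (A (x, t), B (x, t)))"
      by (rule AE_integrable_slices[OF iG])
    have iFs: "AE t in lborel. \<forall>j. integrable lborel (\<lambda>x. (drho (\<theta> j) (x, t), dvel (\<theta> j) (x, t)))"
      unfolding AE_all_countable by (intro allI AE_integrable_slices[OF iF])
    have I: "{0<..<T} \<in> sets lebesgue" by simp
    have sc: "AE t in lborel. t \<in> {0<..<T} \<longrightarrow> (\<forall>\<psi> \<in> test_functions \<Omega>.
        (LINT x|lebesgue_on \<Omega>. (v (x, t) + (0, \<rho> (x, t))) \<bullet> grad_perp \<psi> x) = 0)"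
      using sub unfolding AE_lebesgue_on_iff[OF I, symmetric] by (simp add: admissible_subsolution_def)
    have sv: "AE t in lborel. t \<in> {0<..<T} \<longrightarrow> (\<lambda>x. v (x, t)) \<in> borel_measurable (lebesgue_on \<Omega>) \<and>
      (\<lambda>x. \<rho> (x, t)) \<in> borel_measurable (lebesgue_on \<Omega>) \<and>
      (AE x in lebesgue_on \<Omega>. \<bar>\<rho> (x, t)\<bar> \<le> C \<and> norm (v (x, t)) \<le> C)"
      using slices_v unfolding AE_lebesgue_on_iff[OF I] .
    show ?thesis
      unfolding AE_lebesgue_on_iff[OF I] using r iGs iFs sc sv
    proof eventually_elim
      case (elim t)
      show ?case
      proof (intro impI ballI)
        assume t: "t \<in> {0<..<T}"
        fix \<psi> assume \<psi>: "\<psi> \<in> test_functions \<Omega>"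
        obtain b where b: "b > 0" "\<And>x. norm (grad_perp \<psi> x) \<le> b" using grad_perp_bounded[OF \<psi>] by blast
        note cg = smooth_continuous_gradients(3)[OF test_functions_smooth[OF \<psi>]]
        have gm: "grad_perp \<psi> \<in> borel_measurable borel" by (intro borel_measurable_continuous_onI cg)
        have gm': "grad_perp \<psi> \<in> borel_measurable (lebesgue_on \<Omega>)"
          by (rule borel_measurable_lebesgue_onI[OF domain(6) gm]) simp
        have sum_bound: "\<bar>(y + (0, x)) \<bullet> g\<bar> \<le> (2 * b) * norm (x, y)" if g: "norm g \<le> b" for x :: real and y g :: R2
        proof -
          have n2: "norm ((0::real), x) = \<bar>x\<bar>" by (simp add: norm_prod_def)
          have "\<bar>(y + (0, x)) \<bullet> g\<bar> \<le> norm (y + (0, x)) * norm g" by (rule Cauchy_Schwarz_ineq2)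
          also have "\<dots> \<le> (norm y + \<bar>x\<bar>) * b"
            using norm_triangle_ineq[of y "(0, x)"] g b(1) unfolding n2 by (intro mult_mono) auto
          also have "\<dots> \<le> (norm (x, y) + norm (x, y)) * b"
          proof (intro mult_right_mono add_mono)
            show "norm y \<le> norm (x, y)" by (rule norm_snd_le)
            show "\<bar>x\<bar> \<le> norm (x, y)" using norm_fst_le[of x y] by simp
          qed (use b(1) in simp)
          finally show ?thesis by (simp add: algebra_simps)
        qed
        have inn: "integrable lborel (\<lambda>x. (y x + (0, a x)) \<bullet> grad_perp \<psi> x)"
          if i: "integrable lborel (\<lambda>x. (a x, y x))" for a :: "R2 \<Rightarrow> real" and y :: "R2 \<Rightarrow> R2"
        proof (rule Bochner_Integration.integrable_bound)
          show "integrable lborel (\<lambda>x. (2 * b) * norm (a x, y x))" by (intro integrable_mult_right integrable_norm i)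
          have am: "(\<lambda>x. (a x, y x)) \<in> borel_measurable borel" using borel_measurable_integrable[OF i] by simp
          have "(\<lambda>x. snd (a x, y x) + (0, fst (a x, y x))) \<in> borel_measurable borel"
            by (rule borel_measurable_continuous_on[OF _ am]) (intro continuous_intros)
          then have "(\<lambda>x. y x + (0, a x)) \<in> borel_measurable borel" by simp
          then show "(\<lambda>x. (y x + (0, a x)) \<bullet> grad_perp \<psi> x) \<in> borel_measurable lborel"
            using gm by (intro borel_measurable_inner) simp_all
          show "AE x in lborel. norm ((y x + (0, a x)) \<bullet> grad_perp \<psi> x) \<le> norm ((2 * b) * norm (a x, y x))"
            using sum_bound[OF b(2)] b(1) by (intro AE_I2) simp
        qed
        have iGt: "integrable lborel (\<lambda>x. (A (x, t), B (x, t)))" using elim by blast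
        have iFt: "integrable lborel (\<lambda>x. (drho (\<theta> j) (x, t), dvel (\<theta> j) (x, t)))" for j using elim by blast
        have "(\<lambda>j. LINT x|lborel. (dvel (\<theta> (r j)) (x, t) + (0, drho (\<theta> (r j)) (x, t))) \<bullet> grad_perp \<psi> x)
          \<longlonglongrightarrow> (LINT x|lborel. (B (x, t) + (0, A (x, t))) \<bullet> grad_perp \<psi> x)"
        proof (rule integral_tendsto_of_dist[OF inn[OF iFt] inn[OF iGt]])
          have ni: "integrable lborel (\<lambda>x. n j (x, t))" for j
            unfolding n_def by (intro integrable_norm Bochner_Integration.integrable_diff iFt iGt)
          show "integrable lborel (\<lambda>x. (2 * b) * n (r j) (x, t))" for j
            by (intro integrable_mult_right ni)
          have "(\<lambda>j. (2 * b) * u (r j) t) \<longlonglongrightarrow> 0" using elim(1) by (rule tendsto_mult_right_zero)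
          then show "(\<lambda>j. LINT x|lborel. (2 * b) * n (r j) (x, t)) \<longlonglongrightarrow> 0"
            unfolding u_def using ni by simp
          show "AE x in lborel. \<bar>(dvel (\<theta> (r j)) (x, t) + (0, drho (\<theta> (r j)) (x, t))) \<bullet> grad_perp \<psi> x
              - (B (x, t) + (0, A (x, t))) \<bullet> grad_perp \<psi> x\<bar> \<le> (2 * b) * n (r j) (x, t)" for j
          proof (rule AE_I2)
            fix x
            have "(dvel (\<theta> (r j)) (x, t) + (0, drho (\<theta> (r j)) (x, t))) \<bullet> grad_perp \<psi> x
              - (B (x, t) + (0, A (x, t))) \<bullet> grad_perp \<psi> x
              = ((dvel (\<theta> (r j)) (x, t) - B (x, t)) + (0, drho (\<theta> (r j)) (x, t) - A (x, t))) \<bullet> grad_perp \<psi> x"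
              by (simp add: inner_R2 algebra_simps)
            then show "\<bar>(dvel (\<theta> (r j)) (x, t) + (0, drho (\<theta> (r j)) (x, t))) \<bullet> grad_perp \<psi> x
              - (B (x, t) + (0, A (x, t))) \<bullet> grad_perp \<psi> x\<bar> \<le> (2 * b) * n (r j) (x, t)"
              using sum_bound[OF b(2), of "dvel (\<theta> (r j)) (x, t) - B (x, t)" "drho (\<theta> (r j)) (x, t) - A (x, t)" x]
              by (simp add: n_def)
          qed
        qed
        then have "(LINT x|lborel. (B (x, t) + (0, A (x, t))) \<bullet> grad_perp \<psi> x) = 0"
          unfolding slice_integral_curl_zero[OF \<theta>C test_functions_smooth[OF \<psi>]] by (simp add: LIMSEQ_const_iff)
        moreover have "(LINT x|lebesgue_on \<Omega>. (B (x, t) + (0, A (x, t))) \<bullet> grad_perp \<psi> x)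
            = (LINT x|lborel. (B (x, t) + (0, A (x, t))) \<bullet> grad_perp \<psi> x)"
        proof (rule integral_lebesgue_on_supported[OF _ domain(6)])
          show "(\<lambda>x. (B (x, t) + (0, A (x, t))) \<bullet> grad_perp \<psi> x) \<in> borel_measurable borel"
            using borel_measurable_integrable[OF inn[OF iGt]] by simp
          show "(B (x, t) + (0, A (x, t))) \<bullet> grad_perp \<psi> x = 0" if "x \<notin> \<Omega>" for x
            by (simp add: Aout[OF slice_out[OF that]] Bout[OF slice_out[OF that]] zero_prod_def[symmetric])
        qed
        ultimately have z1: "(LINT x|lebesgue_on \<Omega>. (B (x, t) + (0, A (x, t))) \<bullet> grad_perp \<psi> x) = 0" by simp
        have z2: "(LINT x|lebesgue_on \<Omega>. (v (x, t) + (0, \<rho> (x, t))) \<bullet> grad_perp \<psi> x) = 0"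
          using elim(4) t \<psi> by blast
        have i1: "integrable (lebesgue_on \<Omega>) (\<lambda>x. (B (x, t) + (0, A (x, t))) \<bullet> grad_perp \<psi> x)"
          by (rule integrable_lebesgue_on_supported[OF inn[OF iGt] domain(6)])
        have vm: "(\<lambda>x. v (x, t)) \<in> borel_measurable (lebesgue_on \<Omega>)" and rm: "(\<lambda>x. \<rho> (x, t)) \<in> borel_measurable (lebesgue_on \<Omega>)"
          and vb: "AE x in lebesgue_on \<Omega>. \<bar>\<rho> (x, t)\<bar> \<le> C \<and> norm (v (x, t)) \<le> C" using elim(5) t by blast+
        have i2: "integrable (lebesgue_on \<Omega>) (\<lambda>x. (v (x, t) + (0, \<rho> (x, t))) \<bullet> grad_perp \<psi> x)"
        proof (rule integrable_AE_bounded[OF _ domain(5)])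
          show "(\<lambda>x. (v (x, t) + (0, \<rho> (x, t))) \<bullet> grad_perp \<psi> x) \<in> borel_measurable (lebesgue_on \<Omega>)"
            by (intro borel_measurable_inner borel_measurable_add borel_measurable_Pair vm rm gm' borel_measurable_const)
          show "AE x in lebesgue_on \<Omega>. norm ((v (x, t) + (0, \<rho> (x, t))) \<bullet> grad_perp \<psi> x) \<le> (2 * b) * (C + C)"
            using vb
          proof eventually_elim
            case (elim x)
            have "norm ((v (x, t) + (0, \<rho> (x, t))) \<bullet> grad_perp \<psi> x) \<le> (2 * b) * norm (\<rho> (x, t), v (x, t))"
              unfolding real_norm_def by (rule sum_bound[OF b(2)])
            also have "\<dots> \<le> (2 * b) * (C + C)"
            proof (rule mult_left_mono)
              have "norm (\<rho> (x, t), v (x, t)) \<le> norm (\<rho> (x, t)) + norm (v (x, t))" by (rule norm_Pair_le)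
              then show "norm (\<rho> (x, t), v (x, t)) \<le> C + C" using elim by simp
            qed (use b(1) in simp)
            finally show ?case .
          qed
        qed
        have "(LINT x|lebesgue_on \<Omega>. (V (x, t) + (0, R (x, t))) \<bullet> grad_perp \<psi> x)
          = (LINT x|lebesgue_on \<Omega>. (v (x, t) + (0, \<rho> (x, t))) \<bullet> grad_perp \<psi> x + (B (x, t) + (0, A (x, t))) \<bullet> grad_perp \<psi> x)"
          by (intro Bochner_Integration.integral_cong refl)
            (simp add: V_def R_def inner_R2 algebra_simps)
        also have "\<dots> = 0" using i1 i2 z1 z2 by simp
        finally show "(LINT x|lebesgue_on \<Omega>. (V (x, t) + (0, R (x, t))) \<bullet> grad_perp \<psi> x) = 0" .
      qed
    qed
  qed

  \<comment> \<open>On each slice the velocity increments are bounded in L^2 by the density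
    increments, which are at most 2 in modulus. This gives 4 \<open>\<mu>\<close> for every iterate
    and every time, and Fatou passes it to almost every slice of the limit.\<close>
  have VL2: "V \<in> Linf_L2 \<Omega> T"
  proof -
    define \<mu> where "\<mu> = measure lborel \<Omega>"
    have \<Omega>b: "\<Omega> \<in> sets borel" using \<Omega>(1) by simp
    have i\<Omega>: "integrable lborel (indicator \<Omega> :: R2 \<Rightarrow> real)"
      using emeasure_bounded_finite[OF \<Omega>(2)] \<Omega>b by (intro integrable_real_indicator) auto
    have I: "{0<..<T} \<in> sets lebesgue" by simp
    have BL: "AE t in lborel. integrable lborel (\<lambda>x. (norm (B (x, t)))\<^sup>2) \<and> (LINT x|lborel. (norm (B (x, t)))\<^sup>2) \<le> 4 * \<mu>"
      using AE_slices[OF lims]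
    proof eventually_elim
      case (elim t)
      have l: "AE x in lborel. (\<lambda>j. (norm (dvel (\<theta> j) (x, t)))\<^sup>2) \<longlonglongrightarrow> (norm (B (x, t)))\<^sup>2"
        using elim by eventually_elim (intro tendsto_intros, blast)
      have bd: "(LINT x|lborel. (norm (dvel (\<theta> j) (x, t)))\<^sup>2) \<le> 4 * \<mu>" for j
      proof -
        have "(LINT x|lborel. (norm (dvel (\<theta> j) (x, t)))\<^sup>2) \<le> (LINT x|lborel. (drho (\<theta> j) (x, t))\<^sup>2)"
          by (rule slice_integral_dvel_le[OF \<theta>C])
        also have "\<dots> \<le> (LINT x|lborel. 4 * indicator \<Omega> x)"
        proof (rule integral_mono')
          show "integrable lborel (\<lambda>x. 4 * indicator \<Omega> x :: real)" by (intro integrable_mult_right i\<Omega>)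
          show "(drho (\<theta> j) (x, t))\<^sup>2 \<le> 4 * indicator \<Omega> x" for x
          proof (cases "(x, t) \<in> U")
            case True
            have "\<bar>drho (\<theta> j) (x, t)\<bar> \<le> 2"
              using Rj1[OF True, of j] gap_pos_abs_less_1[OF strict[OF True]] unfolding Rj_def by linarith
            then have "(drho (\<theta> j) (x, t))\<^sup>2 \<le> 2\<^sup>2" by (rule power2_le_iff_abs_le[THEN iffD2, rotated]) simp
            moreover have "x \<in> \<Omega>" using True slice_out by blast
            ultimately show ?thesis by simp
          qed (simp add: out)
        qed simp
        also have "\<dots> = 4 * \<mu>" by (simp add: \<mu>_def)
        finally show ?thesis .
      qed
      have m2: "(\<lambda>x. (norm (B (x, t)))\<^sup>2) \<in> borel_measurable lborel" using slice_m(2)[of t] by measurable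
      show ?case
        using fatou_bound[OF slice_dvel_square_integrable(1)[OF \<theta>C] _ m2 l always_eventually[OF allI[OF bd]]] by simp
    qed
    \<comment> \<open>The constant results from (a + b)^2 \<le> 2 a^2 + 2 b^2, with |v| \<le> C and
      the slice bound 4 \<open>\<mu>\<close> for \<open>B\<close>.\<close>
    have "AE t in lebesgue_on {0<..<T}. (\<lambda>x. V (x, t)) \<in> borel_measurable (lebesgue_on \<Omega>) \<and>
        integrable (lebesgue_on \<Omega>) (\<lambda>x. (norm (V (x, t)))\<^sup>2) \<and>
        sqrt (LINT x|lebesgue_on \<Omega>. (norm (V (x, t)))\<^sup>2) \<le> sqrt (2 * C\<^sup>2 * \<mu> + 2 * (4 * \<mu>))"
    proof -
      have sv: "AE t in lborel. t \<in> {0<..<T} \<longrightarrow> (\<lambda>x. v (x, t)) \<in> borel_measurable (lebesgue_on \<Omega>) \<and>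
        (\<lambda>x. \<rho> (x, t)) \<in> borel_measurable (lebesgue_on \<Omega>) \<and>
        (AE x in lebesgue_on \<Omega>. \<bar>\<rho> (x, t)\<bar> \<le> C \<and> norm (v (x, t)) \<le> C)"
        using slices_v unfolding AE_lebesgue_on_iff[OF I] .
      show ?thesis
        unfolding AE_lebesgue_on_iff[OF I] using sv BL
      proof eventually_elim
        case (elim t)
        show ?case
        proof
          assume t: "t \<in> {0<..<T}"
          have vm: "(\<lambda>x. v (x, t)) \<in> borel_measurable (lebesgue_on \<Omega>)"
            and vb: "AE x in lebesgue_on \<Omega>. norm (v (x, t)) \<le> C" using elim(1) t by (auto elim: eventually_mono)
          have Bm': "(\<lambda>x. B (x, t)) \<in> borel_measurable (lebesgue_on \<Omega>)"
            by (rule borel_measurable_lebesgue_onI[OF domain(6) slice_m(2)[of t]]) simp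
          have Vmt: "(\<lambda>x. V (x, t)) \<in> borel_measurable (lebesgue_on \<Omega>)"
            unfolding V_def by (rule borel_measurable_add[OF vm Bm'])
          have iB2: "integrable (lebesgue_on \<Omega>) (\<lambda>x. (norm (B (x, t)))\<^sup>2)"
            by (rule integrable_lebesgue_on_supported[OF _ domain(6)]) (use elim(2) in blast)
          have eB2: "(LINT x|lebesgue_on \<Omega>. (norm (B (x, t)))\<^sup>2) = (LINT x|lborel. (norm (B (x, t)))\<^sup>2)"
          proof (rule integral_lebesgue_on_supported[OF _ domain(6)])
            show "(\<lambda>x. (norm (B (x, t)))\<^sup>2) \<in> borel_measurable borel" using slice_m(2)[of t] by measurable
            show "(norm (B (x, t)))\<^sup>2 = 0" if "x \<notin> \<Omega>" for x by (simp add: Bout[OF slice_out[OF that]])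
          qed
          have ic: "integrable (lebesgue_on \<Omega>) (\<lambda>x. 2 * C\<^sup>2)"
            by (rule integrable_AE_bounded[OF _ domain(5), of _ "2 * C\<^sup>2"]) auto
          have iw: "integrable (lebesgue_on \<Omega>) (\<lambda>x. 2 * C\<^sup>2 + 2 * (norm (B (x, t)))\<^sup>2)"
            by (intro Bochner_Integration.integrable_add integrable_mult_right ic iB2)
          have Vle: "AE x in lebesgue_on \<Omega>. (norm (V (x, t)))\<^sup>2 \<le> 2 * C\<^sup>2 + 2 * (norm (B (x, t)))\<^sup>2"
            using vb
          proof eventually_elim
            case (elim x)
            have sq: "(a + b)\<^sup>2 \<le> 2 * a\<^sup>2 + 2 * b\<^sup>2" for a b :: real
              using zero_le_power2[of "a - b"] by (simp add: power2_sum power2_diff)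
            have "norm (V (x, t)) \<le> C + norm (B (x, t))"
              unfolding V_def using norm_triangle_ineq[of "v (x, t)" "B (x, t)"] elim by linarith
            then have "(norm (V (x, t)))\<^sup>2 \<le> (C + norm (B (x, t)))\<^sup>2" by (rule power_mono) simp
            also have "\<dots> \<le> 2 * C\<^sup>2 + 2 * (norm (B (x, t)))\<^sup>2" by (rule sq)
            finally show ?case .
          qed
          have iV2: "integrable (lebesgue_on \<Omega>) (\<lambda>x. (norm (V (x, t)))\<^sup>2)"
          proof (rule Bochner_Integration.integrable_bound[OF iw])
            show "(\<lambda>x. (norm (V (x, t)))\<^sup>2) \<in> borel_measurable (lebesgue_on \<Omega>)" using Vmt by measurable
            show "AE x in lebesgue_on \<Omega>. norm ((norm (V (x, t)))\<^sup>2) \<le> norm (2 * C\<^sup>2 + 2 * (norm (B (x, t)))\<^sup>2)"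
              using Vle by eventually_elim simp
          qed
          have "(LINT x|lebesgue_on \<Omega>. (norm (V (x, t)))\<^sup>2) \<le> (LINT x|lebesgue_on \<Omega>. 2 * C\<^sup>2 + 2 * (norm (B (x, t)))\<^sup>2)"
            by (rule integral_mono_AE[OF iV2 iw Vle])
          also have "\<dots> = 2 * C\<^sup>2 * \<mu> + 2 * (LINT x|lborel. (norm (B (x, t)))\<^sup>2)"
          proof -
            have "(LINT x|lebesgue_on \<Omega>. 2 * C\<^sup>2) = 2 * C\<^sup>2 * \<mu>"
              using domain(6) \<Omega>b by (simp add: measure_restrict_space \<mu>_def)
            then show ?thesis using ic iB2 eB2 by simp
          qed
          also have "\<dots> \<le> 2 * C\<^sup>2 * \<mu> + 2 * (4 * \<mu>)" using elim(2) by simp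
          finally show "(\<lambda>x. V (x, t)) \<in> borel_measurable (lebesgue_on \<Omega>) \<and>
            integrable (lebesgue_on \<Omega>) (\<lambda>x. (norm (V (x, t)))\<^sup>2) \<and>
            sqrt (LINT x|lebesgue_on \<Omega>. (norm (V (x, t)))\<^sup>2) \<le> sqrt (2 * C\<^sup>2 * \<mu> + 2 * (4 * \<mu>))"
            using Vmt iV2 by simp
        qed
      qed
    qed
    then show ?thesis unfolding Linf_L2_def using Vm by blast
  qed

  have RL: "R \<in> Linf \<Omega>\<^sub>T"
  proof -
    have "AE z in lebesgue_on \<Omega>\<^sub>T. norm (R z) \<le> 1" using R1' by eventually_elim simp
    then show ?thesis unfolding Linf_def using Rm by blast
  qed

  \<comment> \<open>The hypothesis applies to the potential of every iterate. Since the density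
    increments are bounded by 2, dominated convergence carries the bound over to the limit.\<close>
  have weak: "\<bar>LINT z|lebesgue_on U. (R z - \<rho> z) * f z\<bar> \<le> e"
    if f: "integrable (lebesgue_on U) f" and
      e: "\<And>\<theta>. \<theta> \<in> Cc 3 U \<Longrightarrow> \<forall>z\<in>U. \<bar>drho \<theta> z\<bar> \<le> 2 \<Longrightarrow> \<forall>z. \<bar>\<theta> z\<bar> \<le> \<delta>\<^sub>0 \<Longrightarrow>
          \<bar>LINT z|lebesgue_on U. drho \<theta> z * f z\<bar> \<le> e" for f e
  proof -
    have d2: "\<bar>drho (\<theta> j) z\<bar> \<le> 2" if "z \<in> U" for j z
      using Rj1[OF that, of j] gap_pos_abs_less_1[OF strict[OF that]] unfolding Rj_def by linarith
    have le: "\<bar>LINT z|lebesgue_on U. drho (\<theta> j) z * f z\<bar> \<le> e" for j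
      using e[OF \<theta>C] d2 small by blast
    have fm: "f \<in> borel_measurable (lebesgue_on U)" using f by (rule borel_measurable_integrable)
    have bm: "g \<in> borel_measurable borel \<Longrightarrow> g \<in> borel_measurable (lebesgue_on U)" for g :: "spacetime \<Rightarrow> real"
      by (rule borel_measurable_lebesgue_onI[OF U_facts(3)]) auto
    have "(\<lambda>j. LINT z|lebesgue_on U. drho (\<theta> j) z * f z) \<longlonglongrightarrow> (LINT z|lebesgue_on U. A z * f z)"
    proof (rule integral_dominated_convergence[where w="\<lambda>z. 2 * \<bar>f z\<bar>"])
      show "(\<lambda>z. A z * f z) \<in> borel_measurable (lebesgue_on U)" by (intro borel_measurable_times bm Am fm)
      show "(\<lambda>z. drho (\<theta> j) z * f z) \<in> borel_measurable (lebesgue_on U)" for j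
        by (intro borel_measurable_times fm bm borel_measurable_continuous_onI continuous_on_perturbation[OF \<theta>C \<eta>C])
      show "integrable (lebesgue_on U) (\<lambda>z. 2 * \<bar>f z\<bar>)" using f by simp
      show "AE z in lebesgue_on U. (\<lambda>j. drho (\<theta> j) z * f z) \<longlonglongrightarrow> A z * f z"
        unfolding AE_lebesgue_on_iff[OF U_facts(3)] using lims
        by eventually_elim (intro impI tendsto_intros, blast)
      show "AE z in lebesgue_on U. norm (drho (\<theta> j) z * f z) \<le> 2 * \<bar>f z\<bar>" for j
      proof (rule AE_I2)
        fix z assume "z \<in> space (lebesgue_on U)"
        then show "norm (drho (\<theta> j) z * f z) \<le> 2 * \<bar>f z\<bar>"
          unfolding real_norm_def abs_mult by (intro mult_right_mono d2) auto
      qed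
    qed
    from tendsto_rabs[OF this] have "\<bar>LINT z|lebesgue_on U. A z * f z\<bar> \<le> e"
      by (rule LIMSEQ_le_const2) (use le in blast)
    then show ?thesis by (simp add: R_def)
  qed
  have off: "AE z in lebesgue_on (\<Omega>\<^sub>T - U). R z = \<rho> z"
    unfolding AE_lebesgue_on_iff[OF U_facts(4)] by (intro AE_I2) (simp add: R_def Aout)
  have "weak_solution \<Omega> T \<rho>\<^sub>0 R V"
    unfolding weak_solution_def
    by (intro conjI ballI \<rho>\<^sub>0 RL VL2 transport divfree curlfree)
  then show ?thesis
  proof (intro exI[of _ R] exI[of _ V] conjI R1' off allI impI)
    fix f e
    assume a: "integrable (lebesgue_on U) f \<and>
       (\<forall>\<theta>. \<theta> \<in> Cc 3 U \<and> (\<forall>z\<in>U. \<bar>drho \<theta> z\<bar> \<le> 2) \<and> (\<forall>z. \<bar>\<theta> z\<bar> \<le> \<delta>\<^sub>0) \<longrightarrow>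
          \<bar>LINT z|lebesgue_on U. drho \<theta> z * f z\<bar> \<le> e)"
    show "\<bar>LINT z|lebesgue_on U. (R z - \<rho> z) * f z\<bar> \<le> e"
      by (rule weak[OF conjunct1[OF a]]) (rule conjunct2[OF a, rule_format]; intro conjI; assumption)
  qed
qed

end

section \<open>The sequence of solutions and its weak-star limit\<close>

theorem mainTheorem7:
  fixes T :: real
    and \<Omega> :: "R2 set" and \<D> :: "spacetime set"
    and \<rho>\<^sub>0 :: "R2 \<Rightarrow> real"
    and \<rho> :: "spacetime \<Rightarrow> real" and v m :: "spacetime \<Rightarrow> R2"
    and U :: "spacetime set"
  assumes "\<Omega> = {-1<..<1} \<times> {-1<..<1}"
    and "T > 0"
    and "\<D> = \<Omega> \<times> {0<..<T}"
    and "\<And>x. x \<in> \<Omega> \<Longrightarrow> snd x > 0 \<Longrightarrow> \<rho>\<^sub>0 x = 1"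
    and "\<And>x. x \<in> \<Omega> \<Longrightarrow> snd x < 0 \<Longrightarrow> \<rho>\<^sub>0 x = -1"
    and "admissible_subsolution \<Omega> T \<rho>\<^sub>0 \<rho> v m U"
  shows "\<exists>(\<rho>k :: nat \<Rightarrow> spacetime \<Rightarrow> real) (vk :: nat \<Rightarrow> spacetime \<Rightarrow> R2).
    (\<forall>k. weak_solution \<Omega> T \<rho>\<^sub>0 (\<rho>k k) (vk k) \<and>
         (AE z in lebesgue_on \<D>. \<bar>\<rho>k k z\<bar> = 1) \<and>
         (AE z in lebesgue_on (\<D> - U). \<rho>k k z = \<rho> z)) \<and>
    weak_star_converges U \<rho>k \<rho>"
proof -
  have \<Omega>: "open \<Omega>" "bounded \<Omega>"
  proof -
    show "open \<Omega>" unfolding assms(1) by (intro open_Times) auto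
    have "bounded {-1<..<1::real}" by (rule bounded_subset[OF bounded_closed_interval[of "-1" 1]]) auto
    then show "bounded \<Omega>" unfolding assms(1) by (intro bounded_Times)
  qed
  have \<Omega>s: "\<Omega> \<in> sets lebesgue" using \<Omega>(1) by simp
  \<comment> \<open>\<open>\<rho>\<^sub>0\<close> is unspecified where x_2 = 0. This line is null,
    so measurability and the bound on \<open>\<rho>\<^sub>0\<close> follow from the two
    half-planes.\<close>
  have axis: "AE x :: R2 in lborel. snd x \<noteq> 0"
  proof -
    have "negligible {x :: R2. (0, 1) \<bullet> x = 0}" by (rule negligible_hyperplane) (simp add: zero_prod_def)
    then have "AE x :: R2 in lebesgue. x \<notin> {x. (0, 1) \<bullet> x = 0}"
      by (intro AE_not_in) (simp add: negligible_iff_null_sets)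
    then show ?thesis unfolding AE_completion_iff by (auto simp: inner_R2)
  qed
  have \<rho>\<^sub>0: "\<rho>\<^sub>0 \<in> Linf \<Omega>"
  proof -
    have "open {x :: R2. 0 < snd x}" by (intro open_Collect_less continuous_intros)
    then have m: "(\<lambda>x :: R2. 2 * indicator {x. 0 < snd x} x - 1 :: real) \<in> borel_measurable borel"
      by (intro borel_measurable_diff borel_measurable_times borel_measurable_indicator borel_measurable_const) auto
    have ae: "AE x in lborel. x \<in> \<Omega> \<longrightarrow> \<rho>\<^sub>0 x = 2 * indicator {x. 0 < snd x} x - 1"
      using axis
    proof eventually_elim
      case (elim x)
      show ?case
      proof
        assume x: "x \<in> \<Omega>"
        show "\<rho>\<^sub>0 x = 2 * indicator {x. 0 < snd x} x - 1"
          using assms(4)[OF x] assms(5)[OF x] elim by (cases "0 < snd x") auto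
      qed
    qed
    have b: "AE x in lebesgue_on \<Omega>. norm (\<rho>\<^sub>0 x) \<le> 1"
      unfolding AE_lebesgue_on_iff[OF \<Omega>s] using ae by eventually_elim (auto simp: indicator_def)
    show ?thesis
      unfolding Linf_def using borel_measurable_lebesgue_onI[OF \<Omega>s m ae] b by blast
  qed
  interpret ipm T \<Omega> \<rho>\<^sub>0 \<rho> v m U
    by unfold_locales (fact \<Omega> assms(2) \<rho>\<^sub>0 assms(6))+
  define small where "small \<delta> f e \<longleftrightarrow> (\<forall>\<theta>. \<theta> \<in> Cc 3 U \<and> (\<forall>z\<in>U. \<bar>drho \<theta> z\<bar> \<le> 2) \<and> (\<forall>z. \<bar>\<theta> z\<bar> \<le> \<delta>) \<longrightarrow>
          \<bar>LINT z|lebesgue_on U. drho \<theta> z * f z\<bar> \<le> e)" for \<delta> f e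
  \<comment> \<open>With threshold 1/(k + 1) for the k-th solution, the threshold eventually falls
    below the one that any given test function and accuracy demand.\<close>
  define P where "P k R V \<longleftrightarrow> weak_solution \<Omega> T \<rho>\<^sub>0 R V \<and> (AE z in lebesgue_on \<D>. \<bar>R z\<bar> = 1) \<and>
    (AE z in lebesgue_on (\<D> - U). R z = \<rho> z) \<and>
    (\<forall>f e. integrable (lebesgue_on U) f \<and> small (1 / real (Suc k)) f e \<longrightarrow>
       \<bar>LINT z|lebesgue_on U. (R z - \<rho> z) * f z\<bar> \<le> e)" for k R V
  have "\<exists>R V. P k R V" for k
    unfolding P_def small_def assms(3) by (rule exists_solution) simp
  then have "\<forall>k. \<exists>p. P k (fst p) (snd p)" by simp
  from choice[OF this] obtain p where p: "\<And>k. P k (fst (p k)) (snd (p k))" by blast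
  define Rk Vk where "Rk k = fst (p k)" and "Vk k = snd (p k)" for k
  have sol: "weak_solution \<Omega> T \<rho>\<^sub>0 (Rk k) (Vk k)"
    and R1: "AE z in lebesgue_on \<D>. \<bar>Rk k z\<bar> = 1" and off: "AE z in lebesgue_on (\<D> - U). Rk k z = \<rho> z"
    and weak: "\<And>f e. integrable (lebesgue_on U) f \<Longrightarrow> small (1 / real (Suc k)) f e \<Longrightarrow>
       \<bar>LINT z|lebesgue_on U. (Rk k z - \<rho> z) * f z\<bar> \<le> e" for k
    using p[of k] unfolding P_def Rk_def Vk_def by blast+
  have U\<D>: "U \<subseteq> \<D>" using U_facts(2) assms(3) by simp
  have RkU: "Rk k \<in> Linf U" for k
  proof -
    have "Rk k \<in> borel_measurable (lebesgue_on \<D>)" using sol[of k] by (simp add: weak_solution_def Linf_def assms(3))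
    then have "Rk k \<in> borel_measurable (lebesgue_on U)"
      using U\<D> measurable_restrict_mono by blast
    moreover have "AE z in lebesgue_on U. norm (Rk k z) \<le> 1"
      using R1[of k] unfolding AE_lebesgue_on_iff[OF U_facts(3)] assms(3) AE_lebesgue_on_iff[OF domain(4)]
    proof eventually_elim
      case (elim z)
      then show ?case using U_facts(2) by auto
    qed
    ultimately show ?thesis unfolding Linf_def by blast
  qed
  have \<rho>U: "\<rho> \<in> Linf U"
  proof -
    have "continuous_on U \<rho>" using continuous_on_fst[OF cont] by simp
    then have "\<rho> \<in> borel_measurable (lebesgue_on U)"
      by (rule continuous_imp_measurable_on_sets_lebesgue[OF _ U_facts(3)])
    moreover have "AE z in lebesgue_on U. norm (\<rho> z) \<le> 1"
    proof (rule AE_I2)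
      fix z assume "z \<in> space (lebesgue_on U)"
      then have "z \<in> U" by simp
      then show "norm (\<rho> z) \<le> 1" using gap_pos_abs_less_1[OF strict] by fastforce
    qed
    ultimately show ?thesis unfolding Linf_def by blast
  qed
  have conv: "(\<lambda>k. LINT z|lebesgue_on U. Rk k z * g z) \<longlonglongrightarrow> (LINT z|lebesgue_on U. \<rho> z * g z)"
    if g: "integrable (lebesgue_on U) g" for g
  proof (rule LIMSEQ_I)
    fix e :: real assume e: "0 < e"
    obtain \<delta> where \<delta>: "\<delta> > 0" "small \<delta> g (e / 2)"
      using drho_weakly_small[OF U g half_gt_zero[OF e]] unfolding small_def by blast
    obtain N :: nat where N: "1 / real (Suc N) < \<delta>"
      using reals_Archimedean[OF \<delta>(1)] by (auto simp: inverse_eq_divide)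
    have prod: "integrable (lebesgue_on U) (\<lambda>z. f z * g z)" if f: "f \<in> Linf U" for f :: "spacetime \<Rightarrow> real"
    proof -
      obtain C where C: "AE z in lebesgue_on U. norm (f z) \<le> C" and fm: "f \<in> borel_measurable (lebesgue_on U)"
        using f unfolding Linf_def by blast
      show ?thesis
      proof (rule Bochner_Integration.integrable_bound)
        show "integrable (lebesgue_on U) (\<lambda>z. C * g z)" using g by simp
        show "(\<lambda>z. f z * g z) \<in> borel_measurable (lebesgue_on U)"
          by (rule borel_measurable_times[OF fm borel_measurable_integrable[OF g]])
        show "AE z in lebesgue_on U. norm (f z * g z) \<le> norm (C * g z)"
          using C
        proof eventually_elim
          case (elim z)
          then show ?case unfolding norm_mult by (intro mult_right_mono) auto
        qed
      qed
    qed
    have "norm ((LINT z|lebesgue_on U. Rk k z * g z) - (LINT z|lebesgue_on U. \<rho> z * g z)) < e" if k: "k \<ge> N" for k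
    proof -
      have "1 / real (Suc k) \<le> 1 / real (Suc N)" using k by (intro divide_left_mono) auto
      then have "1 / real (Suc k) \<le> \<delta>" using N by linarith
      \<comment> \<open>A smaller threshold admits fewer potentials, so \<open>small\<close> is
        inherited.\<close>
      then have "small (1 / real (Suc k)) g (e / 2)"
        using \<delta>(2) unfolding small_def by (meson order_trans)
      from weak[OF g this] show ?thesis
        using prod[OF RkU[of k]] prod[OF \<rho>U] e by (simp add: left_diff_distrib)
    qed
    then show "\<exists>N. \<forall>k\<ge>N. norm ((LINT z|lebesgue_on U. Rk k z * g z) - (LINT z|lebesgue_on U. \<rho> z * g z)) < e"
      by blast
  qed
  show ?thesis
  proof (intro exI[of _ Rk] exI[of _ Vk] conjI allI)
    show "weak_star_converges U Rk \<rho>"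
      unfolding weak_star_converges_def using RkU \<rho>U conv by blast
  qed (fact sol R1 off)+
qed

end
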